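(* Let $H$ be a weak Hopf algebra with invertible antipode $S$. Then the data $({H_{par}^w},{A_{par}^w},{\tilde A_{par}^w},s,t,\tilde s,\tilde t,\underline{\Delta}_l,\underline{\Delta}_r,\underline{\epsilon}_l,\underline{\epsilon}_r)$, together with the antipode $\mathcal S$, described in the context, define a Hopf algebroid structure on ${H_{par}^w}$.
   Context: All algebras are associative and unital over a field $\Bbbk$; Sweedler notation $\Delta(h)=h_1\otimes h_2$, $\Delta(1_H)=1_1\otimes1_2$. A weak Hopf algebra is $(H,m,u,\Delta,\varepsilon,S)$ with $H$ an algebra, $(H,\Delta,\varepsilon)$ a coalgebra, and for all $g,h,k$: $\Delta(kh)=\Delta(k)\Delta(h)$; $\varepsilon(kh_1)\varepsilon(h_2g)=\varepsilon(khg)=\varepsilon(kh_2)\varepsilon(h_1g)$; $(1\otimes\Delta(1))(\Delta(1)\otimes1)=\Delta^2(1)=(\Delta(1)\otimes1)(1\otimes\Delta(1))$; $h_1S(h_2)=\varepsilon(1_1h)1_2$; $S(h_1)h_2=1_1\varepsilon(h1_2)$; $S(h)=S(h_1)h_2S(h_3)$. ${H_{par}^w}=T(H)/I$, where $T(H)$ is the tensor algebra of the vector space $H$ and $I$ is the ideal generated by, for all $h,k\in H$: $1_H-1_{T(H)}$; $h\otimes k_1\otimes S(k_2)-hk_1\otimes S(k_2)$; $h\otimes S(k_1)\otimes k_2-hS(k_1)\otimes k_2$; $h_1\otimes S(h_2)\otimes k-h_1\otimes S(h_2)k$; $S(h_1)\otimes h_2\otimes k-S(h_1)\otimes h_2k$;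 $h-h_1\otimes S(h_2)\otimes h_3$; $[h]$ is the class of $h$. Put $E_h=[h_1][S(h_2)]$, $\tilde E_h=[S(h_1)][h_2]$; ${A_{par}^w}$ is the subalgebra generated by the $E_h$ and ${\tilde A_{par}^w}$ the subalgebra generated by the $\tilde E_h$. Let $\mathcal S,\mathcal S'\colon{H_{par}^w}\to{H_{par}^w}$ be the algebra anti-morphisms with $\mathcal S([h^1]\cdots[h^n])=[S(h^n)]\cdots[S(h^1)]$ and $\mathcal S'([h^1]\cdots[h^n])=[S^{-1}(h^n)]\cdots[S^{-1}(h^1)]$. Structure maps: $s(a)=a$, $t(a)=\mathcal S'(a)$ for $a\in{A_{par}^w}$; $\tilde s(\tilde a)=\tilde a$, $\tilde t(\tilde a)=\mathcal S'(\tilde a)$ for $\tilde a\in{\tilde A_{par}^w}$; $\underline{\Delta}_l([h^1]\cdots[h^n])=[h^1_1]\cdots[h^n_1]\otimes_{{A_{par}^w}}[h^1_2]\cdots[h^n_2]$, $\underline{\epsilon}_l([h^1]\cdots[h^n])=E_{h^1_1}E_{h^1_2h^2_1}\cdots E_{h^1_n h^2_{n-1}\cdots h^n}$ (i.e. $E_{h^1_1}E_{h^1_2h^2_1}\cdots E_{h^1\cdots h^n}$ with coproduct indices distributed accordingly); $\underline{\Delta}_r([h^1]\cdots[h^n])=[h^1_1]\cdots[h^n_1]\otimes_{{\tilde A_{par}^w}}[h^1_2]\cdots[h^n_2]$, $\underline{\epsilon}_r([h^1]\cdots[h^n])=\tilde E_{h^1_1h^2_1\cdots h^n_1}\tilde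 E_{h^2_2\cdots h^n_2}\cdots\tilde E_{h^n}$. Hopf algebroid: given an algebra $A$, a left bialgebroid $(\mathcal H,A,s,t,\underline\Delta_l,\underline\epsilon_l)$ consists of an algebra $\mathcal H$, an algebra morphism $s\colon A\to\mathcal H$ and an anti-morphism $t\colon A\to\mathcal H$ with commuting images, making $\mathcal H$ an $A$-bimodule via $a\triangleright h\triangleleft b=s(a)t(b)h$, such that $(\mathcal H,\underline\Delta_l,\underline\epsilon_l)$ is an $A$-coring (coassociative, counital $A$-bimodule maps $\underline\Delta_l\colon\mathcal H\to\mathcal H\otimes_A\mathcal H$, $\underline\epsilon_l\colon\mathcal H\to A$), $\underline\Delta_l$ lands in $\{\sum h_i\otimes k_i:\sum h_it(a)\otimes k_i=\sum h_i\otimes k_is(a)\ \forall a\}$ and is an algebra morphism into it, and $\underline\epsilon_l(hk)=\underline\epsilon_l(hs(\underline\epsilon_l(k)))=\underline\epsilon_l(ht(\underline\epsilon_l(k)))$. A right bialgebroid $(\mathcal H,\tilde A,\tilde s,\tilde t,\underline\Delta_r,\underline\epsilon_r)$ is defined symmetrically with bimodule structure $a\triangleright h\triangleleft b=h\tilde s(a)\tilde t(b)$, Takeuchi condition $\sum\tilde s(a)h_i\otimes k_i=\sum h_i\otimes\tilde t(a)k_i$, and $\underline\epsilon_r(hk)=\underline\epsilon_r(\tilde s(\underline\epsilon_r(h))k)=\underline\epsilon_r(\tilde t(\underline\epsilon_r(h))k)$. With $A\cong\tilde A^{op}$, a Hopf algebroid is a left bialgebroid over $A$ and right bialgebroid over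 $\tilde A$ on the same $\mathcal H$ plus an algebra anti-morphism $\mathcal S\colon\mathcal H\to\mathcal H$ such that: (i) $s\circ\underline\epsilon_l\circ\tilde t=\tilde t$, $t\circ\underline\epsilon_l\circ\tilde s=\tilde s$, $\tilde s\circ\underline\epsilon_r\circ t=t$, $\tilde t\circ\underline\epsilon_r\circ s=s$; (ii) $(\underline\Delta_l\otimes_{\tilde A}I)\circ\underline\Delta_r=(I\otimes_A\underline\Delta_r)\circ\underline\Delta_l$ and $(I\otimes_{\tilde A}\underline\Delta_l)\circ\underline\Delta_r=(\underline\Delta_r\otimes_AI)\circ\underline\Delta_l$; (iii) $\mathcal S(t(a)h\tilde t(\tilde b))=\tilde s(\tilde b)\mathcal S(h)s(a)$; (iv) $\mu\circ(\mathcal S\otimes I)\circ\underline\Delta_l=\tilde s\circ\underline\epsilon_r$ and $\mu\circ(I\otimes\mathcal S)\circ\underline\Delta_r=s\circ\underline\epsilon_l$.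
   Formalization: For the right bialgebroid the bimodule structure is taken as a▷h◁b = h t̃(a) s̃(b) instead of h s̃(a) t̃(b), which is not a bimodule action when Ã is noncommutative; the tensor product over Ã, the bimodule-map and the counit conditions follow this convention. *)

theory Defs
  imports Main "HOL-Library.Poly_Mapping"
begin

text \<open>Elements of all vector spaces below are represented by finitely supported
  functions (finite formal linear combinations) of type 'x =>0 'k, modulo explicitly
  given subspaces / ideals of relations.\<close>

definition fsc :: "'k::field \<Rightarrow> ('x \<Rightarrow>\<^sub>0 'k) \<Rightarrow> ('x \<Rightarrow>\<^sub>0 'k)" where
  "fsc c p = Poly_Mapping.map (\<lambda>a. c * a) p"

inductive_set lspan :: "('x \<Rightarrow>\<^sub>0 'k::field) set \<Rightarrow> ('x \<Rightarrow>\<^sub>0 'k) set" for G where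
  lspan_zero: "0 \<in> lspan G"
| lspan_gen: "g \<in> G \<Longrightarrow> g \<in> lspan G"
| lspan_add: "x \<in> lspan G \<Longrightarrow> y \<in> lspan G \<Longrightarrow> x + y \<in> lspan G"
| lspan_sc: "x \<in> lspan G \<Longrightarrow> fsc c x \<in> lspan G"

section \<open>Tensor powers: representatives with Poly_Mapping.keys x1 # ... # xn meaning x1 (x) ... (x) xn\<close>

definition fsw :: "('a list \<Rightarrow>\<^sub>0 'k::field) \<Rightarrow> ('a list \<Rightarrow> ('y \<Rightarrow>\<^sub>0 'k)) \<Rightarrow> ('y \<Rightarrow>\<^sub>0 'k)" where
  "fsw D f = (\<Sum>xs\<in>Poly_Mapping.keys D. fsc (Poly_Mapping.lookup D xs) (f xs))"

lemma fsw_cong [fundef_cong]: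
  "D = D' \<Longrightarrow> (\<And>xs. xs \<in> Poly_Mapping.keys D' \<Longrightarrow> f xs = g xs) \<Longrightarrow> fsw D f = fsw D' g"
  unfolding fsw_def by (auto intro: sum.cong)

definition kcontr :: "('a list \<Rightarrow> 'k::field) \<Rightarrow> ('a list \<Rightarrow>\<^sub>0 'k) \<Rightarrow> 'k" where
  "kcontr f X = (\<Sum>xs\<in>Poly_Mapping.keys X. Poly_Mapping.lookup X xs * f xs)"

definition hcontr :: "('k::field \<Rightarrow> 'h \<Rightarrow> 'h::ring_1) \<Rightarrow> ('h list \<Rightarrow> 'h) \<Rightarrow> ('h list \<Rightarrow>\<^sub>0 'k) \<Rightarrow> 'h" where
  "hcontr sc f X = (\<Sum>xs\<in>Poly_Mapping.keys X. sc (Poly_Mapping.lookup X xs) (f xs))"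

definition splice :: "nat \<Rightarrow> ('a \<Rightarrow> ('a list \<Rightarrow>\<^sub>0 'k::field)) \<Rightarrow> ('a list \<Rightarrow>\<^sub>0 'k) \<Rightarrow> ('a list \<Rightarrow>\<^sub>0 'k)" where
  "splice i f X = (\<Sum>xs\<in>Poly_Mapping.keys X. \<Sum>ys\<in>Poly_Mapping.keys (f (xs!i)).
      Poly_Mapping.single (take i xs @ ys @ drop (Suc i) xs) (Poly_Mapping.lookup X xs * Poly_Mapping.lookup (f (xs!i)) ys))"

definition tmul :: "('a \<Rightarrow> 'a \<Rightarrow> 'a) \<Rightarrow> ('a list \<Rightarrow>\<^sub>0 'k::field) \<Rightarrow> ('a list \<Rightarrow>\<^sub>0 'k) \<Rightarrow> ('a list \<Rightarrow>\<^sub>0 'k)" where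
  "tmul m X Y = (\<Sum>xs\<in>Poly_Mapping.keys X. \<Sum>ys\<in>Poly_Mapping.keys Y. Poly_Mapping.single (map2 m xs ys) (Poly_Mapping.lookup X xs * Poly_Mapping.lookup Y ys))"

definition tcons :: "'a \<Rightarrow> ('a list \<Rightarrow>\<^sub>0 'k::field) \<Rightarrow> ('a list \<Rightarrow>\<^sub>0 'k)" where
  "tcons a X = (\<Sum>xs\<in>Poly_Mapping.keys X. Poly_Mapping.single (a # xs) (Poly_Mapping.lookup X xs))"
definition tsnoc :: "('a list \<Rightarrow>\<^sub>0 'k::field) \<Rightarrow> 'a \<Rightarrow> ('a list \<Rightarrow>\<^sub>0 'k)" where
  "tsnoc X a = (\<Sum>xs\<in>Poly_Mapping.keys X. Poly_Mapping.single (xs @ [a]) (Poly_Mapping.lookup X xs))"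

definition kalg :: "('k::field \<Rightarrow> 'h::ring_1 \<Rightarrow> 'h) \<Rightarrow> bool" where
  "kalg sc \<longleftrightarrow> (\<forall>c x y. sc c (x + y) = sc c x + sc c y) \<and> (\<forall>c d x. sc (c + d) x = sc c x + sc d x)
     \<and> (\<forall>c d x. sc (c * d) x = sc c (sc d x)) \<and> (\<forall>x. sc 1 x = x)
     \<and> (\<forall>c x y. sc c (x * y) = sc c x * y) \<and> (\<forall>c x y. sc c (x * y) = x * sc c y)"

text \<open>Multilinearity relations: H^(x)n is the quotient of formal combinations of lists of
  length n by the span of these.\<close>
definition mlin_gens :: "('k::field \<Rightarrow> 'h::ring_1 \<Rightarrow> 'h) \<Rightarrow> ('h list \<Rightarrow>\<^sub>0 'k) set" where
  "mlin_gens sc =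
     {Poly_Mapping.single (us @ [a + b] @ vs) 1 - Poly_Mapping.single (us @ [a] @ vs) 1
        - Poly_Mapping.single (us @ [b] @ vs) 1 | us a b vs. True}
   \<union> {Poly_Mapping.single (us @ [sc c a] @ vs) 1 - fsc c (Poly_Mapping.single (us @ [a] @ vs) 1)
        | us c a vs. True}"

definition htens_eq :: "('k::field \<Rightarrow> 'h::ring_1 \<Rightarrow> 'h) \<Rightarrow> ('h list \<Rightarrow>\<^sub>0 'k) \<Rightarrow> ('h list \<Rightarrow>\<^sub>0 'k) \<Rightarrow> bool" where
  "htens_eq sc X Y \<longleftrightarrow> X - Y \<in> lspan (mlin_gens sc)"

text \<open>Weak Hopf algebra (H, m, u, Delta, eps, S); Delta h is a representative of an element of
  H (x) H (Poly_Mapping.keys are lists [h1, h2]).\<close>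
definition weak_hopf :: "('k::field \<Rightarrow> 'h::ring_1 \<Rightarrow> 'h) \<Rightarrow> ('h \<Rightarrow> ('h list \<Rightarrow>\<^sub>0 'k)) \<Rightarrow> ('h \<Rightarrow> 'k) \<Rightarrow> ('h \<Rightarrow> 'h) \<Rightarrow> bool" where
  "weak_hopf sc \<Delta> \<epsilon> S \<longleftrightarrow>
     kalg sc
   \<and> (\<forall>h. \<forall>xs\<in>Poly_Mapping.keys (\<Delta> h). length xs = 2)
   \<and> (\<forall>x y. htens_eq sc (\<Delta> (x + y)) (\<Delta> x + \<Delta> y)) \<and> (\<forall>c x. htens_eq sc (\<Delta> (sc c x)) (fsc c (\<Delta> x)))
   \<and> (\<forall>x y. \<epsilon> (x + y) = \<epsilon> x + \<epsilon> y) \<and> (\<forall>c x. \<epsilon> (sc c x) = c * \<epsilon> x)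
   \<and> (\<forall>x y. S (x + y) = S x + S y) \<and> (\<forall>c x. S (sc c x) = sc c (S x))
   \<and> (\<forall>h. htens_eq sc (splice 0 \<Delta> (\<Delta> h)) (splice 1 \<Delta> (\<Delta> h)))
   \<and> (\<forall>h. hcontr sc (\<lambda>xs. sc (\<epsilon> (xs!0)) (xs!1)) (\<Delta> h) = h)
   \<and> (\<forall>h. hcontr sc (\<lambda>xs. sc (\<epsilon> (xs!1)) (xs!0)) (\<Delta> h) = h)
   \<and> (\<forall>k h. htens_eq sc (\<Delta> (k * h)) (tmul (*) (\<Delta> k) (\<Delta> h)))
   \<and> (\<forall>k h g. kcontr (\<lambda>xs. \<epsilon> (k * xs!0) * \<epsilon> (xs!1 * g)) (\<Delta> h) = \<epsilon> (k * h * g))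
   \<and> (\<forall>k h g. kcontr (\<lambda>xs. \<epsilon> (k * xs!1) * \<epsilon> (xs!0 * g)) (\<Delta> h) = \<epsilon> (k * h * g))
   \<and> htens_eq sc (tmul (*) (tcons 1 (\<Delta> 1)) (tsnoc (\<Delta> 1) 1)) (splice 0 \<Delta> (\<Delta> 1))
   \<and> htens_eq sc (splice 0 \<Delta> (\<Delta> 1)) (tmul (*) (tsnoc (\<Delta> 1) 1) (tcons 1 (\<Delta> 1)))
   \<and> (\<forall>h. hcontr sc (\<lambda>xs. xs!0 * S (xs!1)) (\<Delta> h) = hcontr sc (\<lambda>xs. sc (\<epsilon> (xs!0 * h)) (xs!1)) (\<Delta> 1))
   \<and> (\<forall>h. hcontr sc (\<lambda>xs. S (xs!0) * xs!1) (\<Delta> h) = hcontr sc (\<lambda>xs. sc (\<epsilon> (h * xs!1)) (xs!0)) (\<Delta> 1))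
   \<and> (\<forall>h. S h = hcontr sc (\<lambda>xs. S (xs!0) * xs!1 * S (xs!2)) (splice 0 \<Delta> (\<Delta> h)))"

text \<open>T(H) is the free k-algebra on the set H (formal combinations of words, i.e. 'h list =>0 'k)
  modulo linearity in each letter; these linearity relations are included among the generators
  of the ideal below. The word [h] stands for the class [h].\<close>

definition wd :: "'h list \<Rightarrow> ('h list \<Rightarrow>\<^sub>0 'k::field)" where
  "wd u = Poly_Mapping.single u 1"

definition fone :: "('h list \<Rightarrow>\<^sub>0 'k::field)" where
  "fone = wd []"

definition fmul :: "('h list \<Rightarrow>\<^sub>0 'k::field) \<Rightarrow> ('h list \<Rightarrow>\<^sub>0 'k) \<Rightarrow> ('h list \<Rightarrow>\<^sub>0 'k)" where
  "fmul p q = (\<Sum>u\<in>Poly_Mapping.keys p. \<Sum>v\<in>Poly_Mapping.keys q. Poly_Mapping.single (u @ v) (Poly_Mapping.lookup p u * Poly_Mapping.lookup q v))"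

definition par_gens :: "('k::field \<Rightarrow> 'h::ring_1 \<Rightarrow> 'h) \<Rightarrow> ('h \<Rightarrow> ('h list \<Rightarrow>\<^sub>0 'k)) \<Rightarrow> ('h \<Rightarrow> 'h)
    \<Rightarrow> ('h list \<Rightarrow>\<^sub>0 'k) set" where
  "par_gens sc \<Delta> S =
     {wd (u @ [a + b] @ v) - wd (u @ [a] @ v) - wd (u @ [b] @ v) | u a b v. True}
   \<union> {wd (u @ [sc c a] @ v) - fsc c (wd (u @ [a] @ v)) | u c a v. True}
   \<union> {wd [1] - wd []}
   \<union> {fsw (\<Delta> k) (\<lambda>xs. wd [h, xs!0, S (xs!1)] - wd [h * xs!0, S (xs!1)]) | h k. True}
   \<union> {fsw (\<Delta> k) (\<lambda>xs. wd [h, S (xs!0), xs!1] - wd [h * S (xs!0), xs!1]) | h k. True}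
   \<union> {fsw (\<Delta> h) (\<lambda>xs. wd [xs!0, S (xs!1), k] - wd [xs!0, S (xs!1) * k]) | h k. True}
   \<union> {fsw (\<Delta> h) (\<lambda>xs. wd [S (xs!0), xs!1, k] - wd [S (xs!0), xs!1 * k]) | h k. True}
   \<union> {wd [h] - fsw (splice 0 \<Delta> (\<Delta> h)) (\<lambda>xs. wd [xs!0, S (xs!1), xs!2]) | h. True}"

inductive_set fideal :: "('h list \<Rightarrow>\<^sub>0 'k::field) set \<Rightarrow> ('h list \<Rightarrow>\<^sub>0 'k) set" for G where
  fideal_zero: "0 \<in> fideal G"
| fideal_gen: "g \<in> G \<Longrightarrow> g \<in> fideal G"
| fideal_add: "x \<in> fideal G \<Longrightarrow> y \<in> fideal G \<Longrightarrow> x + y \<in> fideal G"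
| fideal_lmul: "x \<in> fideal G \<Longrightarrow> fmul a x \<in> fideal G"
| fideal_rmul: "x \<in> fideal G \<Longrightarrow> fmul x a \<in> fideal G"

definition peq :: "('k::field \<Rightarrow> 'h::ring_1 \<Rightarrow> 'h) \<Rightarrow> ('h \<Rightarrow> ('h list \<Rightarrow>\<^sub>0 'k)) \<Rightarrow> ('h \<Rightarrow> 'h)
    \<Rightarrow> ('h list \<Rightarrow>\<^sub>0 'k) \<Rightarrow> ('h list \<Rightarrow>\<^sub>0 'k) \<Rightarrow> bool" where
  "peq sc \<Delta> S x y \<longleftrightarrow> x - y \<in> fideal (par_gens sc \<Delta> S)"

definition Ep :: "('h::ring_1 \<Rightarrow> ('h list \<Rightarrow>\<^sub>0 'k::field)) \<Rightarrow> ('h \<Rightarrow> 'h) \<Rightarrow> 'h \<Rightarrow> ('h list \<Rightarrow>\<^sub>0 'k)" where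
  "Ep \<Delta> S h = fsw (\<Delta> h) (\<lambda>xs. wd [xs!0, S (xs!1)])"
definition Et :: "('h::ring_1 \<Rightarrow> ('h list \<Rightarrow>\<^sub>0 'k::field)) \<Rightarrow> ('h \<Rightarrow> 'h) \<Rightarrow> 'h \<Rightarrow> ('h list \<Rightarrow>\<^sub>0 'k)" where
  "Et \<Delta> S h = fsw (\<Delta> h) (\<lambda>xs. wd [S (xs!0), xs!1])"

inductive_set subalg :: "('h list \<Rightarrow>\<^sub>0 'k::field) set \<Rightarrow> ('h list \<Rightarrow>\<^sub>0 'k) set" for G where
  subalg_scalar: "fsc c fone \<in> subalg G"
| subalg_gen: "g \<in> G \<Longrightarrow> g \<in> subalg G"
| subalg_add: "x \<in> subalg G \<Longrightarrow> y \<in> subalg G \<Longrightarrow> x + y \<in> subalg G"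
| subalg_mul: "x \<in> subalg G \<Longrightarrow> y \<in> subalg G \<Longrightarrow> fmul x y \<in> subalg G"

definition Apar :: "('h::ring_1 \<Rightarrow> ('h list \<Rightarrow>\<^sub>0 'k::field)) \<Rightarrow> ('h \<Rightarrow> 'h) \<Rightarrow> ('h list \<Rightarrow>\<^sub>0 'k) set" where
  "Apar \<Delta> S = subalg (range (Ep \<Delta> S))"
definition Atpar :: "('h::ring_1 \<Rightarrow> ('h list \<Rightarrow>\<^sub>0 'k::field)) \<Rightarrow> ('h \<Rightarrow> 'h) \<Rightarrow> ('h list \<Rightarrow>\<^sub>0 'k) set" where
  "Atpar \<Delta> S = subalg (range (Et \<Delta> S))"

text \<open>Anti-morphisms induced by f: [h^1]...[h^n] |-> [f h^n]...[f h^1].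
  antiw S is the antipode \<S>, antiw (inv S) is \<S>'.\<close>
definition antiw :: "('h \<Rightarrow> 'h) \<Rightarrow> ('h list \<Rightarrow>\<^sub>0 'k::field) \<Rightarrow> ('h list \<Rightarrow>\<^sub>0 'k)" where
  "antiw f p = (\<Sum>u\<in>Poly_Mapping.keys p. Poly_Mapping.single (rev (map f u)) (Poly_Mapping.lookup p u))"

text \<open>Coproduct of a word: [h^1]...[h^n] |-> [h^1_1]...[h^n_1] (x) [h^1_2]...[h^n_2];
  tensors of H_par^w are represented by Poly_Mapping.keys that are lists of words.\<close>
fun dword :: "('h::ring_1 \<Rightarrow> ('h list \<Rightarrow>\<^sub>0 'k::field)) \<Rightarrow> 'h list \<Rightarrow> ('h list list \<Rightarrow>\<^sub>0 'k)" where
  "dword \<Delta> [] = Poly_Mapping.single [[], []] 1"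
| "dword \<Delta> (h # u) = (\<Sum>xs\<in>Poly_Mapping.keys (\<Delta> h). \<Sum>ws\<in>Poly_Mapping.keys (dword \<Delta> u).
      Poly_Mapping.single [xs!0 # ws!0, xs!1 # ws!1] (Poly_Mapping.lookup (\<Delta> h) xs * Poly_Mapping.lookup (dword \<Delta> u) ws))"

definition DeltaP :: "('h::ring_1 \<Rightarrow> ('h list \<Rightarrow>\<^sub>0 'k::field)) \<Rightarrow> ('h list \<Rightarrow>\<^sub>0 'k) \<Rightarrow> ('h list list \<Rightarrow>\<^sub>0 'k)" where
  "DeltaP \<Delta> p = (\<Sum>u\<in>Poly_Mapping.keys p. fsc (Poly_Mapping.lookup p u) (dword \<Delta> u))"

text \<open>eps_l([h^1]...[h^n]) = E_{h^1_1} E_{h^1_2 h^2_1} ... E_{h^1_n h^2_{n-1} ... h^n},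
  computed by the recursion eps_l([h][g]w) = E_{h_1} eps_l([h_2 g] w).\<close>
function epsl :: "('h::ring_1 \<Rightarrow> ('h list \<Rightarrow>\<^sub>0 'k::field)) \<Rightarrow> ('h \<Rightarrow> 'h) \<Rightarrow> 'h list \<Rightarrow> ('h list \<Rightarrow>\<^sub>0 'k)" where
  "epsl \<Delta> S [] = fone"
| "epsl \<Delta> S [h] = Ep \<Delta> S h"
| "epsl \<Delta> S (h # g # u) = fsw (\<Delta> h) (\<lambda>xs. fmul (Ep \<Delta> S (xs!0)) (epsl \<Delta> S ((xs!1 * g) # u)))"
  by pat_completeness auto
termination by (relation "measure (\<lambda>(_, _, u). length u)") auto

text \<open>eps_r([h^1]...[h^n]) = E~_{h^1_1 h^2_1 ... h^n_1} E~_{h^2_2 ... h^n_2} ... E~_{h^n},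
  computed on the reversed word by eps_r(w[g][h]) = eps_r(w[g h_1]) E~_{h_2}.\<close>
function epsr_rev :: "('h::ring_1 \<Rightarrow> ('h list \<Rightarrow>\<^sub>0 'k::field)) \<Rightarrow> ('h \<Rightarrow> 'h) \<Rightarrow> 'h list \<Rightarrow> ('h list \<Rightarrow>\<^sub>0 'k)" where
  "epsr_rev \<Delta> S [] = fone"
| "epsr_rev \<Delta> S [h] = Et \<Delta> S h"
| "epsr_rev \<Delta> S (h # g # u) = fsw (\<Delta> h) (\<lambda>xs. fmul (epsr_rev \<Delta> S ((g * xs!0) # u)) (Et \<Delta> S (xs!1)))"
  by pat_completeness auto
termination by (relation "measure (\<lambda>(_, _, u). length u)") auto

definition EpsL :: "('h::ring_1 \<Rightarrow> ('h list \<Rightarrow>\<^sub>0 'k::field)) \<Rightarrow> ('h \<Rightarrow> 'h) \<Rightarrow> ('h list \<Rightarrow>\<^sub>0 'k) \<Rightarrow> ('h list \<Rightarrow>\<^sub>0 'k)" where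
  "EpsL \<Delta> S p = (\<Sum>u\<in>Poly_Mapping.keys p. fsc (Poly_Mapping.lookup p u) (epsl \<Delta> S u))"
definition EpsR :: "('h::ring_1 \<Rightarrow> ('h list \<Rightarrow>\<^sub>0 'k::field)) \<Rightarrow> ('h \<Rightarrow> 'h) \<Rightarrow> ('h list \<Rightarrow>\<^sub>0 'k) \<Rightarrow> ('h list \<Rightarrow>\<^sub>0 'k)" where
  "EpsR \<Delta> S p = (\<Sum>u\<in>Poly_Mapping.keys p. fsc (Poly_Mapping.lookup p u) (epsr_rev \<Delta> S (rev u)))"

fun ttens :: "('h list \<Rightarrow>\<^sub>0 'k::field) list \<Rightarrow> ('h list list \<Rightarrow>\<^sub>0 'k)" where
  "ttens [] = Poly_Mapping.single [] 1"
| "ttens (p # ps) = (\<Sum>u\<in>Poly_Mapping.keys p. \<Sum>ws\<in>Poly_Mapping.keys (ttens ps).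
      Poly_Mapping.single (u # ws) (Poly_Mapping.lookup p u * Poly_Mapping.lookup (ttens ps) ws))"

text \<open>Which base algebra the i-th (x) is over:
  LA: over A_par^w, with bimodule a>h<b = s(a)t(b)h, i.e. t(a)x (x) y = x (x) s(a)y;
  RA: over A~_par^w, with bimodule a>h<b = h t~(a)s~(b), i.e. x s~(a) (x) y = x (x) y t~(a).\<close>
datatype side = LA | RA

definition tgens :: "('k::field \<Rightarrow> 'h::ring_1 \<Rightarrow> 'h) \<Rightarrow> ('h \<Rightarrow> ('h list \<Rightarrow>\<^sub>0 'k)) \<Rightarrow> ('h \<Rightarrow> 'h)
    \<Rightarrow> side list \<Rightarrow> ('h list list \<Rightarrow>\<^sub>0 'k) set" where
  "tgens sc \<Delta> S bs =
     {ttens (ps[i := x]) | ps i x. length ps = Suc (length bs) \<and> i < length ps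
        \<and> x \<in> fideal (par_gens sc \<Delta> S)}
   \<union> {ttens (ps[i := fmul (antiw (inv S) a) x, Suc i := y]) - ttens (ps[i := x, Suc i := fmul a y])
        | ps i x y a. length ps = Suc (length bs) \<and> i < length bs \<and> bs!i = LA \<and> a \<in> Apar \<Delta> S}
   \<union> {ttens (ps[i := fmul x a, Suc i := y]) - ttens (ps[i := x, Suc i := fmul y (antiw (inv S) a)])
        | ps i x y a. length ps = Suc (length bs) \<and> i < length bs \<and> bs!i = RA \<and> a \<in> Atpar \<Delta> S}"

definition teq :: "('k::field \<Rightarrow> 'h::ring_1 \<Rightarrow> 'h) \<Rightarrow> ('h \<Rightarrow> ('h list \<Rightarrow>\<^sub>0 'k)) \<Rightarrow> ('h \<Rightarrow> 'h)
    \<Rightarrow> side list \<Rightarrow> ('h list list \<Rightarrow>\<^sub>0 'k) \<Rightarrow> ('h list list \<Rightarrow>\<^sub>0 'k) \<Rightarrow> bool" where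
  "teq sc \<Delta> S bs X Y \<longleftrightarrow> X - Y \<in> lspan (tgens sc \<Delta> S bs)"

definition slotl :: "nat \<Rightarrow> ('h list \<Rightarrow>\<^sub>0 'k::field) \<Rightarrow> ('h list list \<Rightarrow>\<^sub>0 'k) \<Rightarrow> ('h list list \<Rightarrow>\<^sub>0 'k)" where
  "slotl i p X = (\<Sum>ws\<in>Poly_Mapping.keys X. \<Sum>u\<in>Poly_Mapping.keys p. Poly_Mapping.single (ws[i := u @ ws!i]) (Poly_Mapping.lookup p u * Poly_Mapping.lookup X ws))"
definition slotr :: "nat \<Rightarrow> ('h list \<Rightarrow>\<^sub>0 'k::field) \<Rightarrow> ('h list list \<Rightarrow>\<^sub>0 'k) \<Rightarrow> ('h list list \<Rightarrow>\<^sub>0 'k)" where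
  "slotr i p X = (\<Sum>ws\<in>Poly_Mapping.keys X. \<Sum>u\<in>Poly_Mapping.keys p. Poly_Mapping.single (ws[i := ws!i @ u]) (Poly_Mapping.lookup X ws * Poly_Mapping.lookup p u))"

definition tcontr :: "('h list \<Rightarrow> 'h list \<Rightarrow> ('h list \<Rightarrow>\<^sub>0 'k::field)) \<Rightarrow> ('h list list \<Rightarrow>\<^sub>0 'k) \<Rightarrow> ('h list \<Rightarrow>\<^sub>0 'k)" where
  "tcontr f X = (\<Sum>ws\<in>Poly_Mapping.keys X. fsc (Poly_Mapping.lookup X ws) (f (ws!0) (ws!1)))"

text \<open>s = inclusion of A_par^w, t = \<S>' restricted to A_par^w, Delta_l = DeltaP, eps_l = EpsL.\<close>
definition par_left_bialgebroid :: "('k::field \<Rightarrow> 'h::ring_1 \<Rightarrow> 'h) \<Rightarrow> ('h \<Rightarrow> ('h list \<Rightarrow>\<^sub>0 'k)) \<Rightarrow> ('h \<Rightarrow> 'h) \<Rightarrow> bool" where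
  "par_left_bialgebroid sc \<Delta> S \<longleftrightarrow>
   (let P = peq sc \<Delta> S; A = Apar \<Delta> S; t = antiw (inv S); \<Delta>l = DeltaP \<Delta>; \<epsilon>l = EpsL \<Delta> S;
        T2 = teq sc \<Delta> S [LA]; T3 = teq sc \<Delta> S [LA, LA] in
     \<comment> \<open>t is a well-defined algebra anti-morphism A -> H, with image commuting with s(A)\<close>
     (\<forall>a\<in>A. \<forall>b\<in>A. P a b \<longrightarrow> P (t a) (t b))
   \<and> (\<forall>a\<in>A. \<forall>b\<in>A. P (t (a + b)) (t a + t b) \<and> P (t (fmul a b)) (fmul (t b) (t a)))
   \<and> (\<forall>a\<in>A. \<forall>c. P (t (fsc c a)) (fsc c (t a))) \<and> P (t fone) fone
   \<and> (\<forall>a\<in>A. \<forall>b\<in>A. P (fmul a (t b)) (fmul (t b) a))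
     \<comment> \<open>Delta_l : H -> H (x)_A H well defined, linear, A-bimodule map\<close>
   \<and> (\<forall>x y. P x y \<longrightarrow> T2 (\<Delta>l x) (\<Delta>l y))
   \<and> (\<forall>x y. T2 (\<Delta>l (x + y)) (\<Delta>l x + \<Delta>l y)) \<and> (\<forall>c x. T2 (\<Delta>l (fsc c x)) (fsc c (\<Delta>l x)))
   \<and> (\<forall>a\<in>A. \<forall>b\<in>A. \<forall>h. T2 (\<Delta>l (fmul (fmul a (t b)) h)) (slotl 0 a (slotl 1 (t b) (\<Delta>l h))))
     \<comment> \<open>coassociativity in H (x)_A H (x)_A H\<close>
   \<and> (\<forall>h. T3 (splice 0 (dword \<Delta>) (\<Delta>l h)) (splice 1 (dword \<Delta>) (\<Delta>l h)))
     \<comment> \<open>eps_l : H -> A well defined, linear, A-bimodule map\<close>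
   \<and> (\<forall>x y. P x y \<longrightarrow> P (\<epsilon>l x) (\<epsilon>l y)) \<and> (\<forall>x. \<exists>a\<in>A. P (\<epsilon>l x) a)
   \<and> (\<forall>x y. P (\<epsilon>l (x + y)) (\<epsilon>l x + \<epsilon>l y)) \<and> (\<forall>c x. P (\<epsilon>l (fsc c x)) (fsc c (\<epsilon>l x)))
   \<and> (\<forall>a\<in>A. \<forall>b\<in>A. \<forall>h. P (\<epsilon>l (fmul (fmul a (t b)) h)) (fmul (fmul a (\<epsilon>l h)) b))
     \<comment> \<open>counitality: s(eps(h_1)) h_2 = h = t(eps(h_2)) h_1\<close>
   \<and> (\<forall>h. P (tcontr (\<lambda>u v. fmul (\<epsilon>l (wd u)) (wd v)) (\<Delta>l h)) h)
   \<and> (\<forall>h. P (tcontr (\<lambda>u v. fmul (t (\<epsilon>l (wd v))) (wd u)) (\<Delta>l h)) h)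
     \<comment> \<open>Takeuchi condition and multiplicativity\<close>
   \<and> (\<forall>a\<in>A. \<forall>h. T2 (slotr 0 (t a) (\<Delta>l h)) (slotr 1 a (\<Delta>l h)))
   \<and> (\<forall>x y. T2 (\<Delta>l (fmul x y)) (tmul (@) (\<Delta>l x) (\<Delta>l y)))
   \<and> T2 (\<Delta>l fone) (ttens [fone, fone])
     \<comment> \<open>eps_l(hk) = eps_l(h s(eps_l k)) = eps_l(h t(eps_l k))\<close>
   \<and> (\<forall>x y. P (\<epsilon>l (fmul x y)) (\<epsilon>l (fmul x (\<epsilon>l y))) \<and> P (\<epsilon>l (fmul x y)) (\<epsilon>l (fmul x (t (\<epsilon>l y))))))"

text \<open>s~ = inclusion of A~_par^w, t~ = \<S>' restricted to A~_par^w, Delta_r = DeltaP, eps_r = EpsR.\<close>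
definition par_right_bialgebroid :: "('k::field \<Rightarrow> 'h::ring_1 \<Rightarrow> 'h) \<Rightarrow> ('h \<Rightarrow> ('h list \<Rightarrow>\<^sub>0 'k)) \<Rightarrow> ('h \<Rightarrow> 'h) \<Rightarrow> bool" where
  "par_right_bialgebroid sc \<Delta> S \<longleftrightarrow>
   (let P = peq sc \<Delta> S; A = Atpar \<Delta> S; t = antiw (inv S); \<Delta>r = DeltaP \<Delta>; \<epsilon>r = EpsR \<Delta> S;
        T2 = teq sc \<Delta> S [RA]; T3 = teq sc \<Delta> S [RA, RA] in
     (\<forall>a\<in>A. \<forall>b\<in>A. P a b \<longrightarrow> P (t a) (t b))
   \<and> (\<forall>a\<in>A. \<forall>b\<in>A. P (t (a + b)) (t a + t b) \<and> P (t (fmul a b)) (fmul (t b) (t a)))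
   \<and> (\<forall>a\<in>A. \<forall>c. P (t (fsc c a)) (fsc c (t a))) \<and> P (t fone) fone
   \<and> (\<forall>a\<in>A. \<forall>b\<in>A. P (fmul a (t b)) (fmul (t b) a))
     \<comment> \<open>Delta_r : H -> H (x)_A~ H well defined, linear, bimodule map for a>h<b = h t~(a) s~(b)\<close>
   \<and> (\<forall>x y. P x y \<longrightarrow> T2 (\<Delta>r x) (\<Delta>r y))
   \<and> (\<forall>x y. T2 (\<Delta>r (x + y)) (\<Delta>r x + \<Delta>r y)) \<and> (\<forall>c x. T2 (\<Delta>r (fsc c x)) (fsc c (\<Delta>r x)))
   \<and> (\<forall>a\<in>A. \<forall>b\<in>A. \<forall>h. T2 (\<Delta>r (fmul h (fmul (t a) b))) (slotr 0 (t a) (slotr 1 b (\<Delta>r h))))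
   \<and> (\<forall>h. T3 (splice 0 (dword \<Delta>) (\<Delta>r h)) (splice 1 (dword \<Delta>) (\<Delta>r h)))
   \<and> (\<forall>x y. P x y \<longrightarrow> P (\<epsilon>r x) (\<epsilon>r y)) \<and> (\<forall>x. \<exists>a\<in>A. P (\<epsilon>r x) a)
   \<and> (\<forall>x y. P (\<epsilon>r (x + y)) (\<epsilon>r x + \<epsilon>r y)) \<and> (\<forall>c x. P (\<epsilon>r (fsc c x)) (fsc c (\<epsilon>r x)))
   \<and> (\<forall>a\<in>A. \<forall>b\<in>A. \<forall>h. P (\<epsilon>r (fmul h (fmul (t a) b))) (fmul (fmul a (\<epsilon>r h)) b))
     \<comment> \<open>counitality: h_2 t~(eps(h_1)) = h = h_1 s~(eps(h_2))\<close>
   \<and> (\<forall>h. P (tcontr (\<lambda>u v. fmul (wd v) (t (\<epsilon>r (wd u)))) (\<Delta>r h)) h)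
   \<and> (\<forall>h. P (tcontr (\<lambda>u v. fmul (wd u) (\<epsilon>r (wd v))) (\<Delta>r h)) h)
     \<comment> \<open>Takeuchi condition: s~(a)h_i (x) k_i = h_i (x) t~(a)k_i; multiplicativity\<close>
   \<and> (\<forall>a\<in>A. \<forall>h. T2 (slotl 0 a (\<Delta>r h)) (slotl 1 (t a) (\<Delta>r h)))
   \<and> (\<forall>x y. T2 (\<Delta>r (fmul x y)) (tmul (@) (\<Delta>r x) (\<Delta>r y)))
   \<and> T2 (\<Delta>r fone) (ttens [fone, fone])
     \<comment> \<open>eps_r(hk) = eps_r(s~(eps_r h) k) = eps_r(t~(eps_r h) k)\<close>
   \<and> (\<forall>x y. P (\<epsilon>r (fmul x y)) (\<epsilon>r (fmul (\<epsilon>r x) y)) \<and> P (\<epsilon>r (fmul x y)) (\<epsilon>r (fmul (t (\<epsilon>r x)) y))))"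

definition par_hopf_compat :: "('k::field \<Rightarrow> 'h::ring_1 \<Rightarrow> 'h) \<Rightarrow> ('h \<Rightarrow> ('h list \<Rightarrow>\<^sub>0 'k)) \<Rightarrow> ('h \<Rightarrow> 'h) \<Rightarrow> bool" where
  "par_hopf_compat sc \<Delta> S \<longleftrightarrow>
   (let P = peq sc \<Delta> S; A = Apar \<Delta> S; At = Atpar \<Delta> S; t = antiw (inv S); \<SS> = antiw S;
        \<Delta>' = DeltaP \<Delta>; \<epsilon>l = EpsL \<Delta> S; \<epsilon>r = EpsR \<Delta> S in
     \<comment> \<open>A is isomorphic to A~^op\<close>
     (\<exists>\<phi>. (\<forall>a\<in>A. \<exists>b\<in>At. P (\<phi> a) b) \<and> (\<forall>a\<in>A. \<forall>b\<in>A. P a b \<longleftrightarrow> P (\<phi> a) (\<phi> b))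
        \<and> (\<forall>b\<in>At. \<exists>a\<in>A. P (\<phi> a) b)
        \<and> (\<forall>a\<in>A. \<forall>b\<in>A. P (\<phi> (a + b)) (\<phi> a + \<phi> b) \<and> P (\<phi> (fmul a b)) (fmul (\<phi> b) (\<phi> a)))
        \<and> (\<forall>a\<in>A. \<forall>c. P (\<phi> (fsc c a)) (fsc c (\<phi> a))) \<and> P (\<phi> fone) fone)
     \<comment> \<open>the antipode \<S> (and \<S>') are well-defined algebra anti-morphisms of H_par^w\<close>
   \<and> (\<forall>x y. P x y \<longrightarrow> P (\<SS> x) (\<SS> y) \<and> P (t x) (t y))
   \<and> (\<forall>x y. P (\<SS> (fmul x y)) (fmul (\<SS> y) (\<SS> x)) \<and> P (t (fmul x y)) (fmul (t y) (t x)))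
   \<and> (\<forall>x y. P (\<SS> (x + y)) (\<SS> x + \<SS> y) \<and> P (t (x + y)) (t x + t y))
   \<and> (\<forall>c x. P (\<SS> (fsc c x)) (fsc c (\<SS> x)) \<and> P (t (fsc c x)) (fsc c (t x)))
   \<and> P (\<SS> fone) fone \<and> P (t fone) fone
     \<comment> \<open>(i)\<close>
   \<and> (\<forall>b\<in>At. P (\<epsilon>l (t b)) (t b) \<and> P (t (\<epsilon>l b)) b)
   \<and> (\<forall>a\<in>A. P (\<epsilon>r (t a)) (t a) \<and> P (t (\<epsilon>r a)) a)
     \<comment> \<open>(ii)\<close>
   \<and> (\<forall>h. teq sc \<Delta> S [LA, RA] (splice 0 (dword \<Delta>) (\<Delta>' h)) (splice 1 (dword \<Delta>) (\<Delta>' h)))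
   \<and> (\<forall>h. teq sc \<Delta> S [RA, LA] (splice 1 (dword \<Delta>) (\<Delta>' h)) (splice 0 (dword \<Delta>) (\<Delta>' h)))
     \<comment> \<open>(iii)\<close>
   \<and> (\<forall>a\<in>A. \<forall>b\<in>At. \<forall>h. P (\<SS> (fmul (fmul (t a) h) (t b))) (fmul (fmul b (\<SS> h)) a))
     \<comment> \<open>(iv)\<close>
   \<and> (\<forall>h. P (tcontr (\<lambda>u v. fmul (\<SS> (wd u)) (wd v)) (\<Delta>' h)) (\<epsilon>r h))
   \<and> (\<forall>h. P (tcontr (\<lambda>u v. fmul (wd u) (\<SS> (wd v))) (\<Delta>' h)) (\<epsilon>l h)))"

end

theory Submission
  imports Defs "HOL.Vector_Spaces"
begin

text \<open>Two elements of a quotient of a space of formal combinations agree iff all linear functionals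
  vanishing on the relations agree on them. So every identity in $H$, in $H^w_{par}$ and in the balanced
  tensor squares is checked on scalar-valued functionals of letters, words and pairs of words, where
  Sweedler notation becomes literal: a bilinear functional evaluated on a coproduct.

  In $H^w_{par}$ one has $[h]E_k = E_{h_1 k}[h_2]$ and $E_h \tilde E_k = \tilde E_k E_h$, while
  $t(E_h) = [h_2][S^{-1}(h_1)] = \tilde E_{S^{-1}(h)}$. These give the Takeuchi condition, and with it the
  well-definedness of $\Delta_l$ and $\Delta_l(a) = a \otimes 1$, $\Delta_l(t(a)) = 1 \otimes t(a)$. The
  counit satisfies $\epsilon_l(x) = x_1 \mathcal S(x_2)$; as $\varphi(x \mathcal S(y))$ is balanced over
  $\tilde A$, its well-definedness is that of $\Delta_r$. Passing to $H^{op,cop}$ and reversing words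
  exchanges the left and the right structure; passing to $H^{cop}$ exchanges \<open>S\<close> and its inverse.\<close>

section \<open>Functionals on formal sums\<close>

definition lin_ext :: "('x \<Rightarrow> 'k) \<Rightarrow> ('x \<Rightarrow>\<^sub>0 'k::field) \<Rightarrow> 'k" where
  "lin_ext f p = (\<Sum>u\<in>Poly_Mapping.keys p. Poly_Mapping.lookup p u * f u)"

lemma lin_ext_superset:
  assumes "finite A" "Poly_Mapping.keys p \<subseteq> A"
  shows "lin_ext f p = (\<Sum>u\<in>A. Poly_Mapping.lookup p u * f u)"
  unfolding lin_ext_def using assms
  by (intro sum.mono_neutral_left) (auto simp: in_keys_iff)

lemma lookup_fsc [simp]: "Poly_Mapping.lookup (fsc c p) u = c * Poly_Mapping.lookup p u"
  by (simp add: fsc_def map.rep_eq when_def)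

lemma vector_space_fsc: "vector_space (fsc :: 'k::field \<Rightarrow> ('x \<Rightarrow>\<^sub>0 'k) \<Rightarrow> _)"
  by unfold_locales (auto intro!: poly_mapping_eqI simp: lookup_add algebra_simps)

lemma vector_space_times: "vector_space ((*) :: 'k::field \<Rightarrow> 'k \<Rightarrow> 'k)"
  by unfold_locales (simp_all add: algebra_simps)

lemma linear_lin_ext:
  fixes f :: "'x \<Rightarrow> 'k::field"
  shows "Vector_Spaces.linear fsc (*) (lin_ext f)"
  unfolding Vector_Spaces.linear_iff
proof (intro conjI allI vector_space_fsc vector_space_times)
  fix p q :: "'x \<Rightarrow>\<^sub>0 'k" and c
  let ?A = "Poly_Mapping.keys p \<union> Poly_Mapping.keys q"
  have "lin_ext f (p + q) = (\<Sum>u\<in>?A. Poly_Mapping.lookup (p + q) u * f u)"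
    using keys_add[of p q] by (intro lin_ext_superset) auto
  moreover have "lin_ext f p = (\<Sum>u\<in>?A. Poly_Mapping.lookup p u * f u)"
    "lin_ext f q = (\<Sum>u\<in>?A. Poly_Mapping.lookup q u * f u)"
    by (auto intro!: lin_ext_superset)
  ultimately show "lin_ext f (p + q) = lin_ext f p + lin_ext f q"
    by (simp add: lookup_add distrib_right sum.distrib)
  show "lin_ext f (fsc c p) = c * lin_ext f p"
    by (subst lin_ext_superset[of "Poly_Mapping.keys p"])
      (auto simp: lin_ext_def in_keys_iff sum_distrib_left mult.assoc)
qed

lemmas module_hom_lin_ext = linear_lin_ext[unfolded Vector_Spaces.linear_iff_module_hom]
lemmas lin_ext_zero [simp] = module_hom.zero[OF module_hom_lin_ext]
  and lin_ext_add [simp] = module_hom.add[OF module_hom_lin_ext]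
  and lin_ext_diff [simp] = module_hom.diff[OF module_hom_lin_ext]
  and lin_ext_fsc [simp] = module_hom.scale[OF module_hom_lin_ext]
  and lin_ext_sum [simp] = module_hom.sum[OF module_hom_lin_ext]

lemma lin_ext_single [simp]: "lin_ext f (Poly_Mapping.single u c) = c * f u"
  by (subst lin_ext_superset[of "{u}"]) auto

lemma lin_ext_cong: "(\<And>u. u \<in> Poly_Mapping.keys p \<Longrightarrow> f u = g u) \<Longrightarrow> lin_ext f p = lin_ext g p"
  unfolding lin_ext_def by (auto intro: sum.cong)

lemma lin_ext_fun_add: "lin_ext (\<lambda>x. f x + g x) p = lin_ext f p + lin_ext g p"
  by (simp add: lin_ext_def distrib_left sum.distrib)

lemma lin_ext_fun_diff: "lin_ext (\<lambda>x. f x - g x) p = lin_ext f p - lin_ext g p"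
  by (simp add: lin_ext_def right_diff_distrib sum_subtractf)

lemma lin_ext_fun_scale: "lin_ext (\<lambda>x. c * f x) p = c * lin_ext f p"
  by (simp add: lin_ext_def sum_distrib_left mult.left_commute)

lemma lin_ext_swap: "lin_ext (\<lambda>x. lin_ext (\<lambda>y. f x y) q) p = lin_ext (\<lambda>y. lin_ext (\<lambda>x. f x y) p) q"
  unfolding lin_ext_def sum_distrib_left
  by (subst sum.swap) (simp add: mult.left_commute)

lemma linear_form_eq_lin_ext:
  assumes "Vector_Spaces.linear fsc (*) f"
  shows "f p = lin_ext (\<lambda>u. f (Poly_Mapping.single u 1)) p"
proof -
  interpret f: Vector_Spaces.linear fsc "(*)" f by fact
  have "p = (\<Sum>u\<in>Poly_Mapping.keys p. fsc (Poly_Mapping.lookup p u) (Poly_Mapping.single u 1))"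
    by (rule poly_mapping_eqI)
      (simp add: lookup_sum lookup_single when_def in_keys_iff if_distrib cong: if_cong)
  then have "f p = (\<Sum>u\<in>Poly_Mapping.keys p. f (fsc (Poly_Mapping.lookup p u) (Poly_Mapping.single u 1)))"
    by (metis f.sum)
  then show ?thesis
    by (simp add: lin_ext_def f.scale)
qed

text \<open>Any two such operators commute, which is what permits interchanging iterated Sweedler sums.\<close>

definition finitely_supported :: "(('x \<Rightarrow> 'k::field) \<Rightarrow> 'k) \<Rightarrow> bool" where
  "finitely_supported \<Theta> \<longleftrightarrow> (\<exists>p. \<Theta> = (\<lambda>f. lin_ext f p))"

lemma finitely_supported_lin_ext: "finitely_supported (\<lambda>f. lin_ext f p)"
  by (auto simp: finitely_supported_def)

lemma finitely_supported_point: "finitely_supported (\<lambda>f. c * f x)"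
  using finitely_supported_lin_ext[of "Poly_Mapping.single x c"] by simp

lemma finitely_supported_bind:
  assumes "finitely_supported \<Theta>" "\<And>x. finitely_supported (\<Omega> x)"
  shows "finitely_supported (\<lambda>f. \<Theta> (\<lambda>x. \<Omega> x (\<lambda>y. f (g x y))))"
proof -
  obtain p where p: "\<Theta> = (\<lambda>f. lin_ext f p)"
    using assms(1) by (auto simp: finitely_supported_def)
  obtain q where q: "\<And>x. \<Omega> x = (\<lambda>f. lin_ext f (q x))"
    using assms(2) unfolding finitely_supported_def by metis
  define r where "r = (\<Sum>x\<in>Poly_Mapping.keys p. \<Sum>y\<in>Poly_Mapping.keys (q x).
      Poly_Mapping.single (g x y) (Poly_Mapping.lookup p x * Poly_Mapping.lookup (q x) y))"
  have "\<Theta> (\<lambda>x. \<Omega> x (\<lambda>y. f (g x y))) = lin_ext f r" for f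
    by (simp add: p q r_def) (simp add: lin_ext_def sum_distrib_left mult.assoc)
  then show ?thesis
    by (simp add: finitely_supported_lin_ext)
qed

lemma finitely_supported_map:
  assumes "finitely_supported \<Theta>"
  shows "finitely_supported (\<lambda>f. \<Theta> (\<lambda>x. f (g x)))"
proof -
  have "finitely_supported (\<lambda>f. f x)" for x :: 'b
    using finitely_supported_point[of 1 x] by simp
  from finitely_supported_bind[OF assms this, where g = "\<lambda>x _. g x"] show ?thesis
    by simp
qed

lemma finitely_supported_add:
  assumes "finitely_supported \<Theta>" "finitely_supported \<Omega>"
  shows "finitely_supported (\<lambda>f. \<Theta> f + \<Omega> f)"
proof -
  obtain p q where "\<Theta> = (\<lambda>f. lin_ext f p)" "\<Omega> = (\<lambda>f. lin_ext f q)"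
    using assms by (auto simp: finitely_supported_def)
  then show ?thesis
    using finitely_supported_lin_ext[of "p + q"] by simp
qed

lemma finitely_supported_swap:
  assumes "finitely_supported \<Theta>" "finitely_supported \<Omega>"
  shows "\<Theta> (\<lambda>x. \<Omega> (\<lambda>y. f x y)) = \<Omega> (\<lambda>y. \<Theta> (\<lambda>x. f x y))"
proof -
  obtain p q where "\<Theta> = (\<lambda>f. lin_ext f p)" "\<Omega> = (\<lambda>f. lin_ext f q)"
    using assms by (auto simp: finitely_supported_def)
  then show ?thesis
    by (simp add: lin_ext_swap[of f])
qed

lemma finitely_supported_fun_add: "finitely_supported \<Theta> \<Longrightarrow> \<Theta> (\<lambda>x. f x + g x) = \<Theta> f + \<Theta> g"
  by (auto simp: finitely_supported_def lin_ext_fun_add)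

lemma finitely_supported_fun_scale: "finitely_supported \<Theta> \<Longrightarrow> \<Theta> (\<lambda>x. c * f x) = c * \<Theta> f"
  by (auto simp: finitely_supported_def lin_ext_fun_scale)

section \<open>Multilinear forms\<close>

context vector_space
begin

abbreviation linear_form :: "('b \<Rightarrow> 'a) \<Rightarrow> bool" where
  "linear_form \<equiv> Vector_Spaces.linear scale (*)"

abbreviation linear_endo :: "('b \<Rightarrow> 'b) \<Rightarrow> bool" where
  "linear_endo \<equiv> Vector_Spaces.linear scale scale"

definition bilinear_form :: "('b \<Rightarrow> 'b \<Rightarrow> 'a) \<Rightarrow> bool" where
  "bilinear_form F \<longleftrightarrow> (\<forall>b. linear_form (\<lambda>a. F a b)) \<and> (\<forall>a. linear_form (\<lambda>b. F a b))"

definition trilinear_form :: "('b \<Rightarrow> 'b \<Rightarrow> 'b \<Rightarrow> 'a) \<Rightarrow> bool" where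
  "trilinear_form G \<longleftrightarrow> (\<forall>b c. linear_form (\<lambda>a. G a b c)) \<and> (\<forall>a c. linear_form (\<lambda>b. G a b c))
    \<and> (\<forall>a b. linear_form (\<lambda>c. G a b c))"

definition multilinear_form :: "('b list \<Rightarrow> 'a) \<Rightarrow> bool" where
  "multilinear_form \<phi> \<longleftrightarrow> (\<forall>u v. linear_form (\<lambda>x. \<phi> (u @ x # v)))"

definition linear_in_letter :: "('b \<Rightarrow> 'b list) \<Rightarrow> bool" where
  "linear_in_letter w \<longleftrightarrow> (\<exists>u v g. linear_endo g \<and> w = (\<lambda>x. u @ g x # v))"

lemma linear_form_iff:
  "linear_form f \<longleftrightarrow> (\<forall>x y. f (x + y) = f x + f y) \<and> (\<forall>c x. f (scale c x) = c * f x)"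
  by (simp add: Vector_Spaces.linear_iff vector_space_axioms vector_space_times)

lemma linear_endo_iff:
  "linear_endo f \<longleftrightarrow> (\<forall>x y. f (x + y) = f x + f y) \<and> (\<forall>c x. f (scale c x) = scale c (f x))"
  by (simp add: Vector_Spaces.linear_iff vector_space_axioms)

lemma linear_form_sum: "linear_form f \<Longrightarrow> f (\<Sum>i\<in>I. g i) = (\<Sum>i\<in>I. f (g i))"
  by (simp add: Vector_Spaces.linear_iff_module_hom module_hom.sum)

lemma linear_form_zero [simp]: "linear_form (\<lambda>x. 0)"
  by (simp add: linear_form_iff)

lemma linear_form_comp: "linear_form f \<Longrightarrow> linear_endo g \<Longrightarrow> linear_form (\<lambda>x. f (g x))"
  by (simp add: linear_form_iff linear_endo_iff)

lemma linear_endo_comp: "linear_endo f \<Longrightarrow> linear_endo g \<Longrightarrow> linear_endo (\<lambda>x. f (g x))"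
  by (simp add: linear_endo_iff)

lemma linear_form_scale_left [simp]: "linear_form f \<Longrightarrow> linear_form (\<lambda>x. c * f x)"
  by (simp add: linear_form_iff algebra_simps)

lemma linear_form_scale_right [simp]: "linear_form f \<Longrightarrow> linear_form (\<lambda>x. f x * c)"
  by (simp add: linear_form_iff algebra_simps)

lemma linear_form_finitely_supported:
  assumes "finitely_supported \<Theta>" "\<And>y. linear_form (\<lambda>x. K x y)"
  shows "linear_form (\<lambda>x. \<Theta> (\<lambda>y. K x y))"
proof -
  have "K (x + x') = (\<lambda>y. K x y + K x' y)" "K (scale c x) = (\<lambda>y. c * K x y)" for x x' c
    using assms(2) by (auto simp: linear_form_iff)
  then show ?thesis
    by (simp add: linear_form_iff finitely_supported_fun_add[OF assms(1)]
        finitely_supported_fun_scale[OF assms(1)])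
qed

lemma bilinear_form_comp:
  assumes "bilinear_form F" "linear_endo g"
  shows "linear_form (\<lambda>x. F (g x) b)" and "linear_form (\<lambda>x. F a (g x))"
  using assms linear_form_comp[of "\<lambda>a. F a b" g] linear_form_comp[of "F a" g]
  by (simp_all add: bilinear_form_def)

lemma linear_in_letter_Cons [simp]: "linear_endo g \<Longrightarrow> linear_in_letter (\<lambda>x. g x # v)"
  unfolding linear_in_letter_def by (metis append_Nil)

lemma linear_in_letter_append_left [simp]: "linear_in_letter w \<Longrightarrow> linear_in_letter (\<lambda>x. u @ w x)"
  unfolding linear_in_letter_def by (metis append_assoc)

lemma linear_in_letter_tail [simp]: "linear_in_letter w \<Longrightarrow> linear_in_letter (\<lambda>x. a # w x)"
  using linear_in_letter_append_left[of w "[a]"] by simp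

lemma linear_in_letter_comp: "linear_in_letter w \<Longrightarrow> linear_endo g \<Longrightarrow> linear_in_letter (\<lambda>x. w (g x))"
  unfolding linear_in_letter_def by (auto intro: linear_endo_comp)

lemma multilinear_form_linear: "multilinear_form \<phi> \<Longrightarrow> linear_in_letter w \<Longrightarrow> linear_form (\<lambda>x. \<phi> (w x))"
  unfolding multilinear_form_def linear_in_letter_def
  by (auto intro: linear_form_comp[of "\<lambda>x. \<phi> (_ @ x # _)"])

lemma multilinear_form_comp:
  assumes "multilinear_form \<phi>" "\<And>u v. linear_in_letter (\<lambda>x. w (u @ x # v))"
  shows "multilinear_form (\<lambda>z. \<phi> (w z))"
  unfolding multilinear_form_def by (intro allI multilinear_form_linear[OF assms(1)] assms(2))

lemma multilinear_form_finitely_supported: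
  "finitely_supported \<Theta> \<Longrightarrow> (\<And>y. multilinear_form (\<lambda>w. K w y)) \<Longrightarrow> multilinear_form (\<lambda>w. \<Theta> (\<lambda>y. K w y))"
  unfolding multilinear_form_def by (auto intro: linear_form_finitely_supported)

end

section \<open>Separation by linear forms\<close>

context vector_space
begin

lemma separating_linear_form:
  assumes I: "subspace I" and x: "x \<notin> I"
  obtains f where "linear_form f" "\<And>y. y \<in> I \<Longrightarrow> f y = 0" "f x \<noteq> 0"
proof -
  interpret vector_space_pair scale "(*) :: 'a \<Rightarrow> 'a \<Rightarrow> 'a"
    by (intro vector_space_pair.intro vector_space_axioms vector_space_times)
  obtain B where B: "B \<subseteq> I" "independent B" "I \<subseteq> span B"
    using maximal_independent_subset[of I] by blast
  have "x \<notin> span B"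
    using x span_minimal[OF B(1) I] by blast
  then have "x \<notin> B" "independent (insert x B)"
    using B(2) span_base by (blast, intro independent_insertI)
  then obtain f where f: "linear_form f" "f x = 1" "\<And>y. y \<in> B \<Longrightarrow> f y = 0"
    using linear_independent_extend[of "insert x B" "\<lambda>y. if y = x then 1 else 0"] by (metis insertCI)
  have "f y = 0" if "y \<in> I" for y
    using linear_eq_0_on_span[OF f(1,3)] B(3) that by blast
  with f show ?thesis
    by (intro that[of f]) auto
qed

lemma linear_form_eqI:
  assumes "\<And>f. linear_form f \<Longrightarrow> f x = f y"
  shows "x = y"
proof (rule ccontr)
  assume "x \<noteq> y"
  then have "x - y \<notin> {0}" by simp
  from separating_linear_form[OF subspace_single_0 this] obtain f
    where f: "linear_form f" "f (x - y) \<noteq> 0" .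
  moreover from f(1) have "f (x - y) = f x - f y"
    by (simp add: Vector_Spaces.linear_iff_module_hom module_hom.diff)
  ultimately show False
    using assms by simp
qed

end

lemma formal_sum_in_subspaceI:
  assumes I: "module.subspace fsc I" and "\<And>f. (\<And>y. y \<in> I \<Longrightarrow> lin_ext f y = 0) \<Longrightarrow> lin_ext f x = 0"
  shows "x \<in> I"
proof (rule ccontr)
  assume "x \<notin> I"
  then obtain f where f: "Vector_Spaces.linear fsc (*) f" "\<And>y. y \<in> I \<Longrightarrow> f y = 0" "f x \<noteq> 0"
    using vector_space.separating_linear_form[OF vector_space_fsc I] by blast
  then show False
    using assms(2)[of "\<lambda>u. f (Poly_Mapping.single u 1)"]
    by (simp add: linear_form_eq_lin_ext[OF f(1), symmetric])
qed

section \<open>Sweedler calculus\<close>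

text \<open>\<open>SW h F\<close> stands for $F(h_1, h_2)$ for a bilinear scalar-valued \<open>F\<close>. Neither a multiplication
  of the type nor a tensor product type is used, so that the opposite and the co-opposite
  structures are instances on the same type.\<close>

locale prebialgebra = vector_space sc
  for sc :: "'k::field \<Rightarrow> 'h::ab_group_add \<Rightarrow> 'h" +
  fixes mul :: "'h \<Rightarrow> 'h \<Rightarrow> 'h" (infixl "\<odot>" 70)
    and one :: 'h
    and SW :: "'h \<Rightarrow> ('h \<Rightarrow> 'h \<Rightarrow> 'k) \<Rightarrow> 'k"
    and \<epsilon> :: "'h \<Rightarrow> 'k"
  assumes linear_mul_left: "linear_endo (\<lambda>x. x \<odot> y)"
    and linear_mul_right: "linear_endo (\<lambda>y. x \<odot> y)"
    and mul_assoc: "x \<odot> y \<odot> z = x \<odot> (y \<odot> z)"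
    and one_left [simp]: "one \<odot> x = x"
    and one_right [simp]: "x \<odot> one = x"
    and finitely_supported_SW: "finitely_supported (\<lambda>f. SW h (\<lambda>a b. f (a, b)))"
    and linear_SW: "bilinear_form F \<Longrightarrow> linear_form (\<lambda>h. SW h F)"
    and SW_coassoc: "trilinear_form G
      \<Longrightarrow> SW h (\<lambda>a b. SW a (\<lambda>c d. G c d b)) = SW h (\<lambda>a b. SW b (\<lambda>c d. G a c d))"
    and SW_mul: "bilinear_form F
      \<Longrightarrow> SW (x \<odot> y) F = SW x (\<lambda>a b. SW y (\<lambda>c d. F (a \<odot> c) (b \<odot> d)))"
    and linear_eps: "linear_form \<epsilon>"
    and counit_left: "linear_form f \<Longrightarrow> SW h (\<lambda>a b. \<epsilon> a * f b) = f h"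
    and counit_right: "linear_form f \<Longrightarrow> SW h (\<lambda>a b. \<epsilon> b * f a) = f h"
begin

abbreviation (input) SW3 :: "'h \<Rightarrow> ('h \<Rightarrow> 'h \<Rightarrow> 'h \<Rightarrow> 'k) \<Rightarrow> 'k" where
  "SW3 h F \<equiv> SW h (\<lambda>a r. SW r (F a))"

abbreviation (input) SW4 :: "'h \<Rightarrow> ('h \<Rightarrow> 'h \<Rightarrow> 'h \<Rightarrow> 'h \<Rightarrow> 'k) \<Rightarrow> 'k" where
  "SW4 h F \<equiv> SW h (\<lambda>a r. SW3 r (F a))"

lemma SW_add: "SW h (\<lambda>a b. F a b + G a b) = SW h F + SW h G"
  using finitely_supported_fun_add[OF finitely_supported_SW, of h "\<lambda>(a, b). F a b" "\<lambda>(a, b). G a b"]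
  by simp

lemma SW_scale: "SW h (\<lambda>a b. c * F a b) = c * SW h F"
  using finitely_supported_fun_scale[OF finitely_supported_SW, of h c "\<lambda>(a, b). F a b"] by simp

lemma SW_scale_right: "SW h (\<lambda>a b. F a b * c) = SW h F * c"
  using SW_scale[of h c F] by (simp add: mult.commute)

lemma SW_finitely_supported_swap:
  assumes "finitely_supported \<Theta>"
  shows "SW h (\<lambda>a b. \<Theta> (\<lambda>x. F a b x)) = \<Theta> (\<lambda>x. SW h (\<lambda>a b. F a b x))"
  using finitely_supported_swap[OF finitely_supported_SW assms, of h "\<lambda>(a, b). F a b"] by simp

lemma SW_swap: "SW h (\<lambda>a b. SW k (\<lambda>c d. F a b c d)) = SW k (\<lambda>c d. SW h (\<lambda>a b. F a b c d))"
  using SW_finitely_supported_swap[OF finitely_supported_SW, of h k "\<lambda>a b (c, d). F a b c d"] by simp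

lemma SW_swap_pair:
  "SW h (\<lambda>a b. SW k (\<lambda>c d. SW (l c d) (\<lambda>p q. F a b c d p q)))
    = SW k (\<lambda>c d. SW (l c d) (\<lambda>p q. SW h (\<lambda>a b. F a b c d p q)))"
  by (simp only: SW_swap[of h])

lemma SW_cong: "(\<And>a b. F a b = G a b) \<Longrightarrow> SW h F = SW h G"
  by presburger

lemma finitely_supported_SW_bind:
  "(\<And>a b. finitely_supported (\<Omega> a b)) \<Longrightarrow> finitely_supported (\<lambda>f. SW h (\<lambda>a b. \<Omega> a b (\<lambda>y. f (g a b y))))"
  using finitely_supported_bind[OF finitely_supported_SW, where \<Omega> = "\<lambda>(a, b). \<Omega> a b" and g = "\<lambda>(a, b). g a b"]
  by auto

lemma finitely_supported_SW_map: "finitely_supported (\<lambda>f. SW h (\<lambda>a b. f (g a b)))"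
  using finitely_supported_map[OF finitely_supported_SW, of h "\<lambda>(a, b). g a b"] by simp

declare bilinear_form_def [simp] trilinear_form_def [simp] linear_ident [simp]

lemma linear_mul_left_comp [simp]: "linear_endo g \<Longrightarrow> linear_endo (\<lambda>x. g x \<odot> y)"
  by (rule linear_endo_comp[OF linear_mul_left])

lemma linear_mul_right_comp [simp]: "linear_endo g \<Longrightarrow> linear_endo (\<lambda>x. y \<odot> g x)"
  by (rule linear_endo_comp[OF linear_mul_right])

lemma linear_eps_comp [simp]: "linear_endo g \<Longrightarrow> linear_form (\<lambda>x. \<epsilon> (g x))"
  by (rule linear_form_comp[OF linear_eps])

lemma linear_SW_comp [simp]: "bilinear_form F \<Longrightarrow> linear_endo g \<Longrightarrow> linear_form (\<lambda>x. SW (g x) (\<lambda>a b. F a b))"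
  by (rule linear_form_comp[OF linear_SW])

lemma linear_SW_inside [simp]:
  "(\<And>a b. linear_form (\<lambda>x. F x a b)) \<Longrightarrow> linear_form (\<lambda>x. SW h (\<lambda>a b. F x a b))"
  using linear_form_finitely_supported[OF finitely_supported_SW, of "\<lambda>x (a, b). F x a b"] by auto

lemma SW_coassoc3:
  assumes "trilinear_form (\<lambda>x y s. SW s (\<lambda>b c. F x y b c))"
  shows "SW3 h (\<lambda>a b c. SW a (\<lambda>x y. F x y b c)) = SW4 h F"
proof -
  have "SW3 h (\<lambda>a b c. SW a (\<lambda>x y. F x y b c)) = SW h (\<lambda>a r. SW a (\<lambda>x y. SW r (\<lambda>b c. F x y b c)))"
    by (intro SW_cong SW_swap)
  then show ?thesis
    by (simp only: SW_coassoc[OF assms])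
qed

lemma SW_coassoc4:
  assumes "trilinear_form (\<lambda>x y s. SW3 s (\<lambda>b c d. F x y b c d))"
  shows "SW4 h (\<lambda>a b c d. SW a (\<lambda>x y. F x y b c d)) = SW h (\<lambda>x r. SW4 r (F x))"
proof -
  have "SW4 h (\<lambda>a b c d. SW a (\<lambda>x y. F x y b c d))
      = SW h (\<lambda>a r. SW r (\<lambda>b s. SW a (\<lambda>x y. SW s (\<lambda>c d. F x y b c d))))"
    by (intro SW_cong SW_swap)
  also have "\<dots> = SW h (\<lambda>a r. SW a (\<lambda>x y. SW3 r (\<lambda>b c d. F x y b c d)))"
    by (intro SW_cong SW_swap)
  finally show ?thesis
    by (simp only: SW_coassoc[OF assms])
qed

lemmas right_nested = SW_coassoc SW_coassoc3 SW_coassoc4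

lemma SW_one_left: "bilinear_form F \<Longrightarrow> SW one (\<lambda>a b. SW y (\<lambda>c d. F (a \<odot> c) (b \<odot> d))) = SW y F"
  using SW_mul[of F one y] by simp

lemma SW_one_right: "bilinear_form F \<Longrightarrow> SW y (\<lambda>a b. SW one (\<lambda>c d. F (a \<odot> c) (b \<odot> d))) = SW y F"
  using SW_mul[of F y one] by simp

definition SW_vec :: "'h \<Rightarrow> ('h \<Rightarrow> 'h \<Rightarrow> 'h) \<Rightarrow> 'h" where
  "SW_vec h \<gamma> = (THE z. \<forall>f. linear_form f \<longrightarrow> f z = SW h (\<lambda>a b. f (\<gamma> a b)))"

lemma SW_vec:
  assumes "linear_form f"
  shows "f (SW_vec h \<gamma>) = SW h (\<lambda>a b. f (\<gamma> a b))"
proof -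
  obtain p where p: "\<And>f. SW h (\<lambda>a b. f (a, b)) = lin_ext f p"
    using finitely_supported_SW[of h] unfolding finitely_supported_def by metis
  define z where "z = (\<Sum>u\<in>Poly_Mapping.keys p. sc (Poly_Mapping.lookup p u) (\<gamma> (fst u) (snd u)))"
  have z: "f z = SW h (\<lambda>a b. f (\<gamma> a b))" if "linear_form f" for f
    using p[of "\<lambda>u. f (\<gamma> (fst u) (snd u))"] that
    by (simp add: z_def lin_ext_def linear_form_sum[OF that]) (simp add: linear_form_iff)
  have "SW_vec h \<gamma> = z"
    unfolding SW_vec_def by (rule the_equality) (use z in \<open>auto intro: linear_form_eqI\<close>)
  with z[OF assms] show ?thesis
    by simp
qed

text \<open>The target and source subalgebras, described by
  $\Delta(x) = x 1_1 \otimes 1_2 = 1_1 x \otimes 1_2$ and $\Delta(x) = 1_1 \otimes x 1_2 = 1_1 \otimes 1_2 x$.\<close>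

definition H\<^sub>t :: "'h set" where
  "H\<^sub>t = {x. \<forall>F. bilinear_form F \<longrightarrow>
    SW x F = SW one (\<lambda>a b. F (x \<odot> a) b) \<and> SW x F = SW one (\<lambda>a b. F (a \<odot> x) b)}"

definition H\<^sub>s :: "'h set" where
  "H\<^sub>s = {x. \<forall>F. bilinear_form F \<longrightarrow>
    SW x F = SW one (\<lambda>a b. F a (x \<odot> b)) \<and> SW x F = SW one (\<lambda>a b. F a (b \<odot> x))}"

lemma prebialgebra_cop: "prebialgebra sc mul one (\<lambda>h F. SW h (\<lambda>a b. F b a)) \<epsilon>"
proof (intro prebialgebra.intro prebialgebra_axioms.intro vector_space_axioms)
  show "finitely_supported (\<lambda>f. SW h (\<lambda>a b. f (b, a)))" for h
    by (rule finitely_supported_SW_map)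
qed (simp_all add: linear_mul_left linear_mul_right linear_eps mul_assoc linear_SW SW_mul SW_coassoc
    counit_left counit_right)

sublocale opcop: prebialgebra sc "\<lambda>x y. y \<odot> x" one "\<lambda>h F. SW h (\<lambda>a b. F b a)" \<epsilon>
proof (intro prebialgebra.intro prebialgebra_axioms.intro vector_space_axioms)
  fix F x y
  assume "bilinear_form F"
  then show "SW (y \<odot> x) (\<lambda>a b. F b a) = SW x (\<lambda>b a. SW y (\<lambda>d c. F (c \<odot> a) (d \<odot> b)))"
    by (subst SW_swap) (simp add: SW_mul)
qed (simp_all add: linear_mul_left linear_mul_right linear_eps mul_assoc[symmetric] linear_SW SW_coassoc
    finitely_supported_SW_map counit_left counit_right)

end

text \<open>The facts of a context are available for the opposite co-opposite structure only once the context
  has been closed; this is why contexts are reopened here and below.\<close>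

context prebialgebra
begin

lemma all_bilinear_flip:
  "(\<forall>F. bilinear_form F \<longrightarrow> P (\<lambda>a b. F b a)) \<longleftrightarrow> (\<forall>F. bilinear_form F \<longrightarrow> P F)"
proof -
  have "bilinear_form (\<lambda>a b. F b a)" if "bilinear_form F" for F
    using that by simp
  then show ?thesis
    by (auto dest: spec[of _ "\<lambda>a b. F b a" for F])
qed

lemma opcop_Ht: "opcop.H\<^sub>t = H\<^sub>s" and opcop_Hs: "opcop.H\<^sub>s = H\<^sub>t"
  unfolding H\<^sub>t_def H\<^sub>s_def opcop.H\<^sub>t_def opcop.H\<^sub>s_def
  by (subst all_bilinear_flip[symmetric], auto)+

lemma SW_Ht_left: "x \<in> H\<^sub>t \<Longrightarrow> bilinear_form F \<Longrightarrow> SW x F = SW one (\<lambda>a b. F (x \<odot> a) b)"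
  and SW_Ht_right: "x \<in> H\<^sub>t \<Longrightarrow> bilinear_form F \<Longrightarrow> SW x F = SW one (\<lambda>a b. F (a \<odot> x) b)"
  unfolding H\<^sub>t_def by blast+

lemma SW_Hs_left: "x \<in> H\<^sub>s \<Longrightarrow> bilinear_form F \<Longrightarrow> SW x F = SW one (\<lambda>a b. F a (x \<odot> b))"
  unfolding H\<^sub>s_def by blast

lemma SW_mul_Ht:
  assumes x: "x \<in> H\<^sub>t" and F: "bilinear_form F"
  shows "SW (h \<odot> x) F = SW h (\<lambda>a b. F (a \<odot> x) b)"
proof -
  note [simp] = bilinear_form_comp[OF F]
  have "SW (h \<odot> x) F = SW h (\<lambda>a b. SW x (\<lambda>c d. F (a \<odot> c) (b \<odot> d)))"
    by (rule SW_mul[OF F])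
  also have "\<dots> = SW h (\<lambda>a b. SW one (\<lambda>c d. F ((a \<odot> c) \<odot> x) (b \<odot> d)))"
    by (simp add: SW_Ht_right[OF x] mul_assoc)
  also have "\<dots> = SW h (\<lambda>a b. F (a \<odot> x) b)"
    by (rule SW_one_right[of "\<lambda>a b. F (a \<odot> x) b"]) simp
  finally show ?thesis .
qed

end

section \<open>Weak bialgebras\<close>

locale weak_bialgebra = prebialgebra sc mul one SW \<epsilon>
  for sc :: "'k::field \<Rightarrow> 'h::ab_group_add \<Rightarrow> 'h"
    and mul :: "'h \<Rightarrow> 'h \<Rightarrow> 'h" (infixl "\<odot>" 70) and one :: 'h
    and SW :: "'h \<Rightarrow> ('h \<Rightarrow> 'h \<Rightarrow> 'k) \<Rightarrow> 'k" and \<epsilon> :: "'h \<Rightarrow> 'k" +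
  assumes weak_counit: "SW h (\<lambda>a b. \<epsilon> (k \<odot> a) * \<epsilon> (b \<odot> g)) = \<epsilon> (k \<odot> h \<odot> g)"
    and weak_counit_flip: "SW h (\<lambda>a b. \<epsilon> (k \<odot> b) * \<epsilon> (a \<odot> g)) = \<epsilon> (k \<odot> h \<odot> g)"
    and weak_unit: "trilinear_form G
      \<Longrightarrow> SW one (\<lambda>a b. SW b (\<lambda>c d. G a c d)) = SW one (\<lambda>a b. SW one (\<lambda>c d. G a (c \<odot> b) d))"
    and weak_unit_flip: "trilinear_form G
      \<Longrightarrow> SW one (\<lambda>a b. SW b (\<lambda>c d. G a c d)) = SW one (\<lambda>a b. SW one (\<lambda>c d. G a (b \<odot> c) d))"
begin

definition eps_t :: "'h \<Rightarrow> 'h" ("\<epsilon>\<^sub>t") where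
  "\<epsilon>\<^sub>t h = SW_vec one (\<lambda>a b. sc (\<epsilon> (a \<odot> h)) b)"

definition eps_s :: "'h \<Rightarrow> 'h" ("\<epsilon>\<^sub>s") where
  "\<epsilon>\<^sub>s h = SW_vec one (\<lambda>a b. sc (\<epsilon> (h \<odot> b)) a)"

lemma linear_form_eps_t: "linear_form f \<Longrightarrow> f (\<epsilon>\<^sub>t h) = SW one (\<lambda>a b. \<epsilon> (a \<odot> h) * f b)"
  unfolding eps_t_def by (subst SW_vec) (simp_all add: linear_form_iff)

lemma linear_form_eps_s: "linear_form f \<Longrightarrow> f (\<epsilon>\<^sub>s h) = SW one (\<lambda>a b. \<epsilon> (h \<odot> b) * f a)"
  unfolding eps_s_def by (subst SW_vec) (simp_all add: linear_form_iff)

lemma linear_eps_t [simp]: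
  assumes "linear_endo g"
  shows "linear_endo (\<lambda>x. \<epsilon>\<^sub>t (g x))"
proof (rule linear_endo_comp[OF _ assms])
  have "linear_form (\<lambda>x. f (\<epsilon>\<^sub>t x))" if "linear_form f" for f
    unfolding linear_form_eps_t[OF that] by simp
  then show "linear_endo \<epsilon>\<^sub>t"
    unfolding linear_endo_iff by (auto intro!: linear_form_eqI simp: linear_form_iff)
qed

lemma eps_mul_eps_t: "\<epsilon> (k \<odot> \<epsilon>\<^sub>t h) = \<epsilon> (k \<odot> h)"
  using weak_counit_flip[of one k h]
  by (subst linear_form_eps_t[of "\<lambda>z. \<epsilon> (k \<odot> z)"]) (simp_all add: mult.commute)

lemma eps_t_mul_eps_t: "\<epsilon>\<^sub>t (h \<odot> \<epsilon>\<^sub>t g) = \<epsilon>\<^sub>t (h \<odot> g)"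
  by (rule linear_form_eqI) (simp add: linear_form_eps_t mul_assoc[symmetric] eps_mul_eps_t)

lemma eps_t_one [simp]: "\<epsilon>\<^sub>t one = one"
  by (rule linear_form_eqI) (simp add: linear_form_eps_t counit_left)

lemma SW_eps_t_left_mul:
  assumes F: "bilinear_form F"
  shows "SW (\<epsilon>\<^sub>t h) F = SW one (\<lambda>a b. F (\<epsilon>\<^sub>t h \<odot> a) b)"
    and "SW (\<epsilon>\<^sub>t h) F = SW one (\<lambda>a b. F (a \<odot> \<epsilon>\<^sub>t h) b)"
proof -
  note [simp] = bilinear_form_comp[OF F]
  have expand: "SW (\<epsilon>\<^sub>t h) F = SW one (\<lambda>a b. SW b (\<lambda>c d. \<epsilon> (a \<odot> h) * F c d))"
    by (subst linear_form_eps_t[of "\<lambda>z. SW z F"]) (simp_all add: SW_scale)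
  also have "\<dots> = SW one (\<lambda>a b. SW one (\<lambda>c d. \<epsilon> (a \<odot> h) * F (b \<odot> c) d))"
    by (rule weak_unit_flip) simp
  also have "\<dots> = SW one (\<lambda>c d. F (\<epsilon>\<^sub>t h \<odot> c) d)"
    by (subst SW_swap) (simp add: linear_form_eps_t[of "\<lambda>z. F (z \<odot> _) _", symmetric])
  finally show "SW (\<epsilon>\<^sub>t h) F = SW one (\<lambda>a b. F (\<epsilon>\<^sub>t h \<odot> a) b)" .
  have "SW (\<epsilon>\<^sub>t h) F = SW one (\<lambda>a b. SW one (\<lambda>c d. \<epsilon> (a \<odot> h) * F (c \<odot> b) d))"
    unfolding expand by (rule weak_unit) simp
  also have "\<dots> = SW one (\<lambda>c d. F (c \<odot> \<epsilon>\<^sub>t h) d)"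
    by (subst SW_swap) (simp add: linear_form_eps_t[of "\<lambda>z. F (_ \<odot> z) _", symmetric])
  finally show "SW (\<epsilon>\<^sub>t h) F = SW one (\<lambda>a b. F (a \<odot> \<epsilon>\<^sub>t h) b)" .
qed

lemma eps_t_in_Ht: "\<epsilon>\<^sub>t h \<in> H\<^sub>t"
  unfolding H\<^sub>t_def using SW_eps_t_left_mul by blast

lemma SW_eps_t:
  assumes F: "bilinear_form F"
  shows "SW h (\<lambda>a b. F a (\<epsilon>\<^sub>t b)) = SW one (\<lambda>a b. F (a \<odot> h) b)"
proof -
  note [simp] = bilinear_form_comp[OF F]
  have "SW one (\<lambda>a b. F (a \<odot> h) b) = SW one (\<lambda>a b. SW (a \<odot> h) (\<lambda>x y. \<epsilon> y * F x b))"
    by (simp add: counit_right)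
  also have "\<dots> = SW one (\<lambda>a b. SW a (\<lambda>p q. SW h (\<lambda>c d. \<epsilon> (q \<odot> d) * F (p \<odot> c) b)))"
    by (simp add: SW_mul)
  also have "\<dots> = SW one (\<lambda>p b. SW b (\<lambda>q b. SW h (\<lambda>c d. \<epsilon> (q \<odot> d) * F (p \<odot> c) b)))"
    by (rule SW_coassoc) simp
  also have "\<dots> = SW one (\<lambda>p b. SW one (\<lambda>q r. SW h (\<lambda>c d. \<epsilon> ((q \<odot> b) \<odot> d) * F (p \<odot> c) r)))"
    by (rule weak_unit) simp
  also have "\<dots> = SW one (\<lambda>q r. SW one (\<lambda>p b. SW h (\<lambda>c d. \<epsilon> (q \<odot> (b \<odot> d)) * F (p \<odot> c) r)))"
    by (subst SW_swap) (simp add: mul_assoc)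
  also have "\<dots> = SW one (\<lambda>q r. SW h (\<lambda>c d. \<epsilon> (q \<odot> d) * F c r))"
    by (intro SW_cong SW_one_left[of "\<lambda>c d. \<epsilon> (_ \<odot> d) * F c _"]) simp
  also have "\<dots> = SW h (\<lambda>a b. F a (\<epsilon>\<^sub>t b))"
    using F by (subst SW_swap) (simp add: linear_form_eps_t[of "F _"])
  finally show ?thesis ..
qed

lemma weak_unit_left_nested:
  assumes "trilinear_form G"
  shows "SW one (\<lambda>a b. SW a (\<lambda>c d. G b d c)) = SW one (\<lambda>a b. SW one (\<lambda>c d. G b (d \<odot> a) c))"
    and "SW one (\<lambda>a b. SW a (\<lambda>c d. G b d c)) = SW one (\<lambda>a b. SW one (\<lambda>c d. G b (a \<odot> d) c))"
proof -
  have nest: "SW one (\<lambda>a b. SW a (\<lambda>c d. G b d c)) = SW one (\<lambda>a b. SW b (\<lambda>c d. G d c a))"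
    using assms by (intro SW_coassoc) simp
  show "SW one (\<lambda>a b. SW a (\<lambda>c d. G b d c)) = SW one (\<lambda>a b. SW one (\<lambda>c d. G b (d \<odot> a) c))"
    unfolding nest using assms by (subst weak_unit_flip) (auto intro: SW_swap)
  show "SW one (\<lambda>a b. SW a (\<lambda>c d. G b d c)) = SW one (\<lambda>a b. SW one (\<lambda>c d. G b (a \<odot> d) c))"
    unfolding nest using assms by (subst weak_unit) (auto intro: SW_swap)
qed

lemma weak_bialgebra_cop: "weak_bialgebra sc mul one (\<lambda>h F. SW h (\<lambda>a b. F b a)) \<epsilon>"
  by (intro weak_bialgebra.intro weak_bialgebra_axioms.intro prebialgebra_cop)
    (rule weak_counit_flip weak_counit | erule weak_unit_left_nested)+

sublocale opcop: weak_bialgebra sc "\<lambda>x y. y \<odot> x" one "\<lambda>h F. SW h (\<lambda>a b. F b a)" \<epsilon>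
proof
  show "SW h (\<lambda>b a. \<epsilon> (a \<odot> k) * \<epsilon> (g \<odot> b)) = \<epsilon> (g \<odot> (h \<odot> k))" for h k g
    using weak_counit[of h g k] by (simp add: mult.commute mul_assoc)
  show "SW h (\<lambda>b a. \<epsilon> (b \<odot> k) * \<epsilon> (g \<odot> a)) = \<epsilon> (g \<odot> (h \<odot> k))" for h k g
    using weak_counit_flip[of h g k] by (simp add: mult.commute mul_assoc)
qed (erule weak_unit_left_nested)+

end

context weak_bialgebra
begin

lemma opcop_eps_t: "opcop.eps_t = \<epsilon>\<^sub>s" and opcop_eps_s: "opcop.eps_s = \<epsilon>\<^sub>t"
  unfolding fun_eq_iff
  by (auto intro!: linear_form_eqI simp: opcop.linear_form_eps_t opcop.linear_form_eps_s
      linear_form_eps_t linear_form_eps_s)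

lemmas opcop_simps = opcop_Ht opcop_Hs opcop_eps_t opcop_eps_s

lemmas linear_eps_s [simp] = opcop.linear_eps_t[unfolded opcop_simps]

lemmas eps_eps_s_mul = opcop.eps_mul_eps_t[unfolded opcop_simps]

lemmas eps_s_eps_s_mul = opcop.eps_t_mul_eps_t[unfolded opcop_simps]

lemmas eps_s_one [simp] = opcop.eps_t_one[unfolded opcop_simps]

lemmas eps_s_in_Hs = opcop.eps_t_in_Ht[unfolded opcop_simps]

lemma eps_t_eps_s_commute: "\<epsilon>\<^sub>t h \<odot> \<epsilon>\<^sub>s g = \<epsilon>\<^sub>s g \<odot> \<epsilon>\<^sub>t h"
proof (rule linear_form_eqI)
  fix f assume f: "linear_form f"
  note [simp] = linear_form_comp[OF f]
  have "f (\<epsilon>\<^sub>t h \<odot> \<epsilon>\<^sub>s g) = SW one (\<lambda>a b. SW one (\<lambda>c d. \<epsilon> (a \<odot> h) * (\<epsilon> (g \<odot> d) * f (b \<odot> c))))"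
    by (subst linear_form_eps_t[of "\<lambda>z. f (z \<odot> \<epsilon>\<^sub>s g)"], simp)
      (simp add: linear_form_eps_s[of "\<lambda>z. f (_ \<odot> z)"] SW_scale)
  also have "\<dots> = SW one (\<lambda>a b. SW b (\<lambda>c d. \<epsilon> (a \<odot> h) * (\<epsilon> (g \<odot> d) * f c)))"
    by (rule weak_unit_flip[symmetric]) simp
  also have "\<dots> = SW one (\<lambda>a b. SW one (\<lambda>c d. \<epsilon> (a \<odot> h) * (\<epsilon> (g \<odot> d) * f (c \<odot> b))))"
    by (rule weak_unit) simp
  also have "\<dots> = f (\<epsilon>\<^sub>s g \<odot> \<epsilon>\<^sub>t h)"
    by (subst linear_form_eps_t[of "\<lambda>z. f (\<epsilon>\<^sub>s g \<odot> z)"], simp)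
      (simp add: linear_form_eps_s[of "\<lambda>z. f (z \<odot> _)"] SW_scale)
  finally show "f (\<epsilon>\<^sub>t h \<odot> \<epsilon>\<^sub>s g) = f (\<epsilon>\<^sub>s g \<odot> \<epsilon>\<^sub>t h)" .
qed

lemma SW_eps_s: "bilinear_form F \<Longrightarrow> SW h (\<lambda>a b. F (\<epsilon>\<^sub>s a) b) = SW one (\<lambda>a b. F a (h \<odot> b))"
  using opcop.SW_eps_t[of "\<lambda>a b. F b a" h] by (simp add: opcop_simps)

lemma SW_eps_mul_one:
  assumes F: "bilinear_form F"
  shows "SW h (\<lambda>a b. SW one (\<lambda>c d. \<epsilon> (b \<odot> c) * F a d)) = SW one (\<lambda>a b. F (h \<odot> a) b)"
proof -
  interpret op: weak_bialgebra sc "\<lambda>x y. y \<odot> x" one SW \<epsilon>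
    by (rule opcop.weak_bialgebra_cop)
  show ?thesis
    using op.SW_eps_t[OF F, of h] F by (simp add: op.linear_form_eps_t)
qed

lemma SW_one_eps:
  assumes F: "bilinear_form F"
  shows "SW one (\<lambda>a b. F (\<epsilon>\<^sub>s a) (\<epsilon>\<^sub>t b)) = SW one F"
proof -
  note [simp] = bilinear_form_comp[OF F]
  have "SW one (\<lambda>a b. F (\<epsilon>\<^sub>s a) (\<epsilon>\<^sub>t b)) = SW one (\<lambda>a b. F (\<epsilon>\<^sub>s (a \<odot> one)) b)"
    by (rule SW_eps_t) simp
  also have "\<dots> = SW one F"
    using SW_eps_s[OF F, of one] by simp
  finally show ?thesis .
qed

lemma SW_one_cong:
  assumes "bilinear_form F" "bilinear_form G"
    and "\<And>a b. a \<in> H\<^sub>s \<Longrightarrow> b \<in> H\<^sub>t \<Longrightarrow> F a b = G a b"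
  shows "SW one F = SW one G"
  using SW_one_eps[OF assms(1)] SW_one_eps[OF assms(2)] by (simp add: assms(3) eps_s_in_Hs eps_t_in_Ht)

end

section \<open>The antipode of a weak Hopf algebra\<close>

locale weak_hopf_algebra = weak_bialgebra sc mul one SW \<epsilon>
  for sc :: "'k::field \<Rightarrow> 'h::ab_group_add \<Rightarrow> 'h"
    and mul :: "'h \<Rightarrow> 'h \<Rightarrow> 'h" (infixl "\<odot>" 70) and one :: 'h
    and SW :: "'h \<Rightarrow> ('h \<Rightarrow> 'h \<Rightarrow> 'k) \<Rightarrow> 'k" and \<epsilon> :: "'h \<Rightarrow> 'k" +
  fixes S :: "'h \<Rightarrow> 'h"
  assumes linear_S: "linear_endo S"
    and SW_mul_S: "linear_form f \<Longrightarrow> SW h (\<lambda>a b. f (a \<odot> S b)) = f (\<epsilon>\<^sub>t h)"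
    and SW_S_mul: "linear_form f \<Longrightarrow> SW h (\<lambda>a b. f (S a \<odot> b)) = f (\<epsilon>\<^sub>s h)"
    and S_triple: "linear_form f \<Longrightarrow> f (S h) = SW3 h (\<lambda>a b c. f (S a \<odot> b \<odot> S c))"
begin

lemma linear_S_comp [simp]: "linear_endo g \<Longrightarrow> linear_endo (\<lambda>x. S (g x))"
  by (rule linear_endo_comp[OF linear_S])

sublocale opcop: weak_hopf_algebra sc "\<lambda>x y. y \<odot> x" one "\<lambda>h F. SW h (\<lambda>a b. F b a)" \<epsilon> S
proof (intro weak_hopf_algebra.intro opcop.weak_bialgebra_axioms weak_hopf_algebra_axioms.intro linear_S)
  fix f h assume f: "linear_form f"
  note [simp] = linear_form_comp[OF f]
  show "SW h (\<lambda>b a. f (S b \<odot> a)) = f (opcop.eps_t h)" "SW h (\<lambda>b a. f (b \<odot> S a)) = f (opcop.eps_s h)"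
    by (simp_all add: SW_S_mul SW_mul_S f opcop_simps)
  show "f (S h) = SW h (\<lambda>r a. SW r (\<lambda>c b. f (S c \<odot> (b \<odot> S a))))"
    using S_triple[OF f, of h] by (simp add: right_nested mul_assoc)
qed

lemma SW_S_mul_eps_t:
  assumes f: "linear_form f"
  shows "SW h (\<lambda>a b. f (S a \<odot> \<epsilon>\<^sub>t b)) = f (S h)"
proof -
  note [simp] = linear_form_comp[OF f]
  show ?thesis
    unfolding S_triple[OF f, of h] by (simp add: SW_mul_S[of "\<lambda>z. f (S _ \<odot> z)", symmetric] mul_assoc)
qed

lemma S_one [simp]: "S one = one"
proof (rule linear_form_eqI)
  fix f assume f: "linear_form f"
  note [simp] = linear_form_comp[OF f]
  have "f (S one) = SW one (\<lambda>a b. f (S a \<odot> \<epsilon>\<^sub>t b))"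
    by (simp add: SW_S_mul_eps_t f)
  also have "\<dots> = SW one (\<lambda>a b. f (S (a \<odot> one) \<odot> b))"
    by (rule SW_eps_t) simp
  also have "\<dots> = f one"
    using f by (simp add: SW_S_mul)
  finally show "f (S one) = f one" .
qed

lemma eps_t_mul_eps_t_expand:
  assumes f: "linear_form f"
  shows "f (\<epsilon>\<^sub>t (h \<odot> \<epsilon>\<^sub>t x)) = SW h (\<lambda>a b. f (a \<odot> \<epsilon>\<^sub>t x \<odot> S b))"
proof -
  note [simp] = linear_form_comp[OF f]
  have "f (\<epsilon>\<^sub>t (h \<odot> \<epsilon>\<^sub>t x)) = SW (h \<odot> \<epsilon>\<^sub>t x) (\<lambda>a b. f (a \<odot> S b))"
    by (simp add: SW_mul_S f)
  also have "\<dots> = SW h (\<lambda>a b. f (a \<odot> \<epsilon>\<^sub>t x \<odot> S b))"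
    by (rule SW_mul_Ht[OF eps_t_in_Ht]) simp
  finally show ?thesis .
qed

end

context weak_hopf_algebra
begin

lemmas SW_eps_s_mul_S = opcop.SW_S_mul_eps_t[unfolded opcop_simps]
  and eps_s_eps_s_mul_expand = opcop.eps_t_mul_eps_t_expand[unfolded opcop_simps]

lemma S_mul_eq_eps_s_mul:
  assumes f: "linear_form f"
  shows "f (S (h \<odot> g)) = SW h (\<lambda>p z. SW g (\<lambda>q y. f (\<epsilon>\<^sub>s (p \<odot> q) \<odot> (S y \<odot> S z))))"
proof -
  note [simp] = linear_form_comp[OF f]
  have "f (S (h \<odot> g)) = SW h (\<lambda>a b. SW g (\<lambda>c d. f (S (a \<odot> c) \<odot> \<epsilon>\<^sub>t (b \<odot> \<epsilon>\<^sub>t d))))"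
    by (subst SW_S_mul_eps_t[symmetric]) (simp_all add: f SW_mul eps_t_mul_eps_t)
  also have "\<dots> = SW h (\<lambda>a b. SW g (\<lambda>c d. SW b (\<lambda>x z. f (S (a \<odot> c) \<odot> (x \<odot> \<epsilon>\<^sub>t d \<odot> S z)))))"
    by (simp add: eps_t_mul_eps_t_expand[of "\<lambda>w. f (_ \<odot> w)"])
  also have "\<dots> = SW h (\<lambda>a b. SW b (\<lambda>x z. SW g (\<lambda>c d. f (S (a \<odot> c) \<odot> (x \<odot> \<epsilon>\<^sub>t d \<odot> S z)))))"
    by (intro SW_cong SW_swap)
  also have "\<dots> = SW h (\<lambda>a b. SW b (\<lambda>x z. SW g (\<lambda>c d. SW d (\<lambda>w y. f (S (a \<odot> c) \<odot> (x \<odot> (w \<odot> S y) \<odot> S z))))))"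
    by (simp add: SW_mul_S[of "\<lambda>w. f (_ \<odot> (_ \<odot> w \<odot> _))", symmetric])
  also have "\<dots> = SW h (\<lambda>p z. SW p (\<lambda>a x. SW g (\<lambda>q y. SW q (\<lambda>c w. f (S (a \<odot> c) \<odot> (x \<odot> (w \<odot> S y) \<odot> S z))))))"
    by (simp add: right_nested)
  also have "\<dots> = SW h (\<lambda>p z. SW g (\<lambda>q y. SW p (\<lambda>a x. SW q (\<lambda>c w. f (S (a \<odot> c) \<odot> (x \<odot> (w \<odot> S y) \<odot> S z))))))"
    by (intro SW_cong SW_swap)
  also have "\<dots> = SW h (\<lambda>p z. SW g (\<lambda>q y. SW (p \<odot> q) (\<lambda>a x. f ((S a \<odot> x) \<odot> (S y \<odot> S z)))))"
    by (simp add: SW_mul mul_assoc)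
  also have "\<dots> = SW h (\<lambda>p z. SW g (\<lambda>q y. f (\<epsilon>\<^sub>s (p \<odot> q) \<odot> (S y \<odot> S z))))"
    by (simp add: SW_S_mul[of "\<lambda>w. f (w \<odot> _)"])
  finally show ?thesis .
qed

lemma S_mul_S_eq_eps_s_mul:
  assumes f: "linear_form f"
  shows "f (S g \<odot> S h) = SW h (\<lambda>p z. SW g (\<lambda>q y. f (\<epsilon>\<^sub>s (p \<odot> q) \<odot> (S y \<odot> S z))))"
proof -
  note [simp] = linear_form_comp[OF f]
  have "SW h (\<lambda>p z. SW g (\<lambda>q y. f (\<epsilon>\<^sub>s (p \<odot> q) \<odot> (S y \<odot> S z))))
      = SW h (\<lambda>p z. SW g (\<lambda>q y. f (\<epsilon>\<^sub>s (\<epsilon>\<^sub>s p \<odot> q) \<odot> (S y \<odot> S z))))"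
    by (simp add: eps_s_eps_s_mul)
  also have "\<dots> = SW h (\<lambda>p z. SW g (\<lambda>q y. SW q (\<lambda>a b. f (S a \<odot> (\<epsilon>\<^sub>s p \<odot> b) \<odot> (S y \<odot> S z)))))"
    by (simp add: eps_s_eps_s_mul_expand[of "\<lambda>w. f (w \<odot> _)"])
  also have "\<dots> = SW h (\<lambda>p z. SW g (\<lambda>a d. SW d (\<lambda>b y. f (S a \<odot> \<epsilon>\<^sub>s p \<odot> (b \<odot> S y) \<odot> S z))))"
    by (simp add: right_nested mul_assoc)
  also have "\<dots> = SW h (\<lambda>p z. SW g (\<lambda>a d. f (S a \<odot> \<epsilon>\<^sub>s p \<odot> \<epsilon>\<^sub>t d \<odot> S z)))"
    by (simp add: SW_mul_S[of "\<lambda>w. f (_ \<odot> w \<odot> _)"])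
  also have "\<dots> = SW h (\<lambda>p z. SW g (\<lambda>a d. f ((S a \<odot> \<epsilon>\<^sub>t d) \<odot> (\<epsilon>\<^sub>s p \<odot> S z))))"
    by (simp add: mul_assoc) (simp add: mul_assoc[symmetric] eps_t_eps_s_commute)
  also have "\<dots> = SW h (\<lambda>p z. f (S g \<odot> (\<epsilon>\<^sub>s p \<odot> S z)))"
    by (simp add: SW_S_mul_eps_t[of "\<lambda>w. f (w \<odot> _)"])
  also have "\<dots> = f (S g \<odot> S h)"
    by (simp add: SW_eps_s_mul_S[of "\<lambda>w. f (_ \<odot> w)"])
  finally show ?thesis ..
qed

lemma S_mul: "S (h \<odot> g) = S g \<odot> S h"
  by (rule linear_form_eqI) (simp add: S_mul_eq_eps_s_mul S_mul_S_eq_eps_s_mul)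

lemma S_Ht:
  assumes x: "x \<in> H\<^sub>t"
  shows "S x = \<epsilon>\<^sub>s x"
proof (rule linear_form_eqI)
  fix f assume f: "linear_form f"
  note [simp] = linear_form_comp[OF f]
  have "f (\<epsilon>\<^sub>s x) = SW x (\<lambda>a b. f (S a \<odot> b))"
    by (simp add: SW_S_mul f)
  also have "\<dots> = SW one (\<lambda>a b. f (S x \<odot> (S a \<odot> b)))"
    by (subst SW_Ht_right[OF x]) (simp_all add: S_mul mul_assoc)
  also have "\<dots> = f (S x)"
    by (subst SW_S_mul[of "\<lambda>w. f (_ \<odot> w)"]) simp_all
  finally show "f (S x) = f (\<epsilon>\<^sub>s x)" ..
qed

lemma S_Ht_in_Hs: "x \<in> H\<^sub>t \<Longrightarrow> S x \<in> H\<^sub>s"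
  by (simp add: S_Ht eps_s_in_Hs)

lemma SW_eps_t_expand:
  assumes F: "bilinear_form F"
  shows "SW (\<epsilon>\<^sub>t h) F = SW h (\<lambda>p q. SW p (\<lambda>a b. SW q (\<lambda>c d. F (a \<odot> S d) (b \<odot> S c))))"
proof -
  note [simp] = bilinear_form_comp[OF F]
  have "SW h (\<lambda>p q. SW p (\<lambda>a b. SW q (\<lambda>c d. F (a \<odot> S d) (b \<odot> S c))))
      = SW h (\<lambda>q d. SW q (\<lambda>a m. SW m (\<lambda>b c. F (a \<odot> S d) (b \<odot> S c))))"
    by (simp add: right_nested)
  also have "\<dots> = SW h (\<lambda>q d. SW q (\<lambda>a m. F (a \<odot> S d) (\<epsilon>\<^sub>t m)))"
    using F by (simp add: SW_mul_S[of "F _"])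
  also have "\<dots> = SW h (\<lambda>q d. SW one (\<lambda>x y. F ((x \<odot> q) \<odot> S d) y))"
    by (intro SW_cong SW_eps_t) simp
  also have "\<dots> = SW one (\<lambda>x y. SW h (\<lambda>q d. F (x \<odot> (q \<odot> S d)) y))"
    by (subst SW_swap) (simp add: mul_assoc)
  also have "\<dots> = SW one (\<lambda>x y. F (x \<odot> \<epsilon>\<^sub>t h) y)"
    by (simp add: SW_mul_S[of "\<lambda>z. F (_ \<odot> z) _"])
  also have "\<dots> = SW (\<epsilon>\<^sub>t h) F"
    by (rule SW_Ht_right[OF eps_t_in_Ht F, symmetric])
  finally show ?thesis ..
qed

lemma SW_one_eps_mul_S:
  assumes f: "linear_form f"
  shows "SW one (\<lambda>a b. \<epsilon> (h \<odot> a) * f (S b)) = f (\<epsilon>\<^sub>s h)"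
proof -
  note [simp] = linear_form_comp[OF f]
  have "SW one (\<lambda>a b. \<epsilon> (h \<odot> a) * f (S b)) = SW one (\<lambda>a b. \<epsilon> (h \<odot> a) * f (\<epsilon>\<^sub>s b))"
    by (rule SW_one_cong) (simp_all add: S_Ht)
  also have "\<dots> = SW one (\<lambda>a b. SW one (\<lambda>c d. (\<epsilon> (h \<odot> a) * \<epsilon> (b \<odot> d)) * f c))"
    by (simp add: linear_form_eps_s[OF f] SW_scale mult.assoc)
  also have "\<dots> = SW one (\<lambda>c d. SW one (\<lambda>a b. (\<epsilon> (h \<odot> a) * \<epsilon> (b \<odot> d)) * f c))"
    by (rule SW_swap)
  also have "\<dots> = f (\<epsilon>\<^sub>s h)"
    by (simp add: SW_scale_right weak_counit linear_form_eps_s[OF f])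
  finally show ?thesis .
qed

lemma SW3_mul_S:
  assumes F: "bilinear_form F"
  shows "SW3 h (\<lambda>a b c. F a (b \<odot> S c)) = SW one (\<lambda>a b. F (a \<odot> h) b)"
  using F by (simp add: SW_mul_S[of "F _"] SW_eps_t)

lemma SW3_S_mul:
  assumes F: "bilinear_form F"
  shows "SW3 h (\<lambda>a b c. F a (S b \<odot> c)) = SW one (\<lambda>a b. F (h \<odot> a) (S b))"
proof -
  note [simp] = bilinear_form_comp[OF F]
  have "SW3 h (\<lambda>a b c. F a (S b \<odot> c)) = SW h (\<lambda>a b. SW one (\<lambda>c d. \<epsilon> (b \<odot> c) * F a (S d)))"
    using F by (simp add: SW_S_mul[of "F _"] SW_one_eps_mul_S[of "F _"])
  also have "\<dots> = SW one (\<lambda>a b. F (h \<odot> a) (S b))"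
    by (rule SW_eps_mul_one) simp
  finally show ?thesis .
qed

end

context weak_hopf_algebra
begin

lemmas S_Hs = opcop.S_Ht[unfolded opcop_simps]
  and S_Hs_in_Ht = opcop.S_Ht_in_Hs[unfolded opcop_simps]

lemma SW_eps_s_expand:
  assumes F: "bilinear_form F"
  shows "SW (\<epsilon>\<^sub>s h) F = SW h (\<lambda>p q. SW p (\<lambda>a b. SW q (\<lambda>c d. F (S b \<odot> c) (S a \<odot> d))))"
proof -
  have "SW (\<epsilon>\<^sub>s h) F = SW h (\<lambda>p q. SW q (\<lambda>c d. SW p (\<lambda>a b. F (S b \<odot> c) (S a \<odot> d))))"
    using opcop.SW_eps_t_expand[of "\<lambda>a b. F b a" h] F by (simp add: opcop_simps)
  also have "\<dots> = SW h (\<lambda>p q. SW p (\<lambda>a b. SW q (\<lambda>c d. F (S b \<odot> c) (S a \<odot> d))))"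
    by (intro SW_cong SW_swap)
  finally show ?thesis .
qed

lemma SW_one_S:
  assumes F: "bilinear_form F"
  shows "SW one (\<lambda>a b. F (S b) (S a)) = SW one F"
proof -
  note [simp] = bilinear_form_comp[OF F]
  have "SW one (\<lambda>a b. F (S b) (S a)) = SW one (\<lambda>a b. F (\<epsilon>\<^sub>s b) (\<epsilon>\<^sub>t a))"
    by (rule SW_one_cong) (simp_all add: S_Ht S_Hs)
  also have "\<dots> = SW one (\<lambda>a b. SW one (\<lambda>p q. SW one (\<lambda>c d. (\<epsilon> (p \<odot> a) * \<epsilon> (b \<odot> d)) * F c q)))"
    using F
    by (simp add: linear_form_eps_s[of "\<lambda>z. F z _"] linear_form_eps_t[of "F _"] SW_scale mult.assoc)
  also have "\<dots> = SW one (\<lambda>p q. SW one (\<lambda>a b. SW one (\<lambda>c d. (\<epsilon> (p \<odot> a) * \<epsilon> (b \<odot> d)) * F c q)))"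
    by (rule SW_swap)
  also have "\<dots> = SW one (\<lambda>p q. SW one (\<lambda>c d. SW one (\<lambda>a b. (\<epsilon> (p \<odot> a) * \<epsilon> (b \<odot> d)) * F c q)))"
    by (intro SW_cong SW_swap)
  also have "\<dots> = SW one (\<lambda>p q. SW one (\<lambda>c d. \<epsilon> (p \<odot> d) * F c q))"
    by (simp add: SW_scale_right weak_counit)
  also have "\<dots> = SW one (\<lambda>c d. F c (\<epsilon>\<^sub>t d))"
    using F by (subst SW_swap) (simp add: linear_form_eps_t[of "F _"])
  also have "\<dots> = SW one F"
    using SW_eps_t[OF F, of one] by simp
  finally show ?thesis .
qed

text \<open>Write $X(h) = S(h_2) \otimes S(h_1)$. Then
  $X(h_1) \Delta(\epsilon_t(h_2)) = X(h)$ and, since $\Delta \circ \epsilon_t$ and $\Delta \circ \epsilon_s$ are the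
  convolution products of \<open>\<Delta>\<close> and \<open>X\<close>,
  $\Delta(S(h)) = \Delta(S(h_1) h_2) X(h_3) = X(h_1) \Delta(h_2) X(h_3) = X(h_1) \Delta(\epsilon_t(h_2))$.\<close>

lemma SW_S_eps_t:
  assumes F: "bilinear_form F"
  shows "SW h (\<lambda>m r. SW m (\<lambda>a b. SW (\<epsilon>\<^sub>t r) (\<lambda>x y. F (S b \<odot> x) (S a \<odot> y)))) = SW h (\<lambda>a b. F (S b) (S a))"
proof -
  note [simp] = bilinear_form_comp[OF F]
  have "SW h (\<lambda>m r. SW m (\<lambda>a b. SW (\<epsilon>\<^sub>t r) (\<lambda>x y. F (S b \<odot> x) (S a \<odot> y))))
      = SW h (\<lambda>m r. SW m (\<lambda>a b. SW one (\<lambda>x y. F ((S b \<odot> \<epsilon>\<^sub>t r) \<odot> x) (S a \<odot> y))))"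
    by (simp add: SW_Ht_left[OF eps_t_in_Ht] mul_assoc)
  also have "\<dots> = SW h (\<lambda>a s. SW s (\<lambda>b r. SW one (\<lambda>x y. F ((S b \<odot> \<epsilon>\<^sub>t r) \<odot> x) (S a \<odot> y))))"
    by (simp add: right_nested)
  also have "\<dots> = SW h (\<lambda>a s. SW one (\<lambda>x y. F (S s \<odot> x) (S a \<odot> y)))"
    by (simp add: SW_S_mul_eps_t[of "\<lambda>z. SW one (\<lambda>x y. F (z \<odot> x) (S _ \<odot> y))"])
  also have "\<dots> = SW h (\<lambda>a s. SW one (\<lambda>x y. F (S s \<odot> S y) (S a \<odot> S x)))"
    by (simp add: SW_one_S[of "\<lambda>x y. F (S _ \<odot> x) (S _ \<odot> y)"])
  also have "\<dots> = SW one (\<lambda>x y. SW h (\<lambda>a s. F (S (y \<odot> s)) (S (x \<odot> a))))"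
    by (subst SW_swap) (simp add: S_mul)
  also have "\<dots> = SW h (\<lambda>a b. F (S b) (S a))"
    by (rule SW_one_left) simp
  finally show ?thesis .
qed

lemma SW_S:
  assumes F: "bilinear_form F"
  shows "SW (S h) F = SW h (\<lambda>a b. F (S b) (S a))"
proof -
  note [simp] = bilinear_form_comp[OF F]
  have "SW (S h) F = SW h (\<lambda>a r. SW (S a \<odot> \<epsilon>\<^sub>t r) F)"
    using F by (simp add: SW_S_mul_eps_t[of "\<lambda>z. SW z F"])
  also have "\<dots> = SW h (\<lambda>a r. SW (S a) (\<lambda>x y. SW r (\<lambda>p q. SW p (\<lambda>u v. SW q (\<lambda>c d.
      F (x \<odot> (u \<odot> S d)) (y \<odot> (v \<odot> S c)))))))"
    by (simp add: SW_mul SW_eps_t_expand)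
  also have "\<dots> = SW h (\<lambda>a r. SW r (\<lambda>p q. SW (S a) (\<lambda>x y. SW p (\<lambda>u v. SW q (\<lambda>c d.
      F ((x \<odot> u) \<odot> S d) ((y \<odot> v) \<odot> S c))))))"
    by (subst SW_swap) (simp add: mul_assoc)
  also have "\<dots> = SW h (\<lambda>a r. SW r (\<lambda>p q. SW (S a \<odot> p) (\<lambda>x y. SW q (\<lambda>c d. F (x \<odot> S d) (y \<odot> S c)))))"
    by (simp add: SW_mul)
  also have "\<dots> = SW h (\<lambda>n q. SW n (\<lambda>a p. SW (S a \<odot> p) (\<lambda>x y. SW q (\<lambda>c d. F (x \<odot> S d) (y \<odot> S c)))))"
    by (simp add: right_nested)
  also have "\<dots> = SW h (\<lambda>n q. SW (\<epsilon>\<^sub>s n) (\<lambda>x y. SW q (\<lambda>c d. F (x \<odot> S d) (y \<odot> S c))))"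
    by (subst SW_S_mul[of "\<lambda>z. SW z _"]) simp_all
  also have "\<dots> = SW h (\<lambda>n q. SW n (\<lambda>m p. SW m (\<lambda>a b. SW p (\<lambda>u v. SW q (\<lambda>c d.
      F (S b \<odot> (u \<odot> S d)) (S a \<odot> (v \<odot> S c)))))))"
    by (simp add: SW_eps_s_expand mul_assoc)
  also have "\<dots> = SW h (\<lambda>m r. SW r (\<lambda>p q. SW m (\<lambda>a b. SW p (\<lambda>u v. SW q (\<lambda>c d.
      F (S b \<odot> (u \<odot> S d)) (S a \<odot> (v \<odot> S c)))))))"
    by (rule SW_coassoc) simp
  also have "\<dots> = SW h (\<lambda>m r. SW m (\<lambda>a b. SW r (\<lambda>p q. SW p (\<lambda>u v. SW q (\<lambda>c d.
      F (S b \<odot> (u \<odot> S d)) (S a \<odot> (v \<odot> S c)))))))"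
    by (intro SW_cong SW_swap)
  also have "\<dots> = SW h (\<lambda>m r. SW m (\<lambda>a b. SW (\<epsilon>\<^sub>t r) (\<lambda>x y. F (S b \<odot> x) (S a \<odot> y))))"
    by (simp add: SW_eps_t_expand)
  also have "\<dots> = SW h (\<lambda>a b. F (S b) (S a))"
    by (rule SW_S_eps_t[OF F])
  finally show ?thesis .
qed

lemma SW3_S_mul_left:
  assumes F: "bilinear_form F"
  shows "SW h (\<lambda>p c. SW p (\<lambda>a b. F (S a \<odot> b) c)) = SW one (\<lambda>a b. F a (h \<odot> b))"
  using opcop.SW3_mul_S[of "\<lambda>a b. F b a" h] F by simp

end

section \<open>Invertible antipodes\<close>

locale invertible_weak_hopf_algebra = weak_hopf_algebra sc mul one SW \<epsilon> S
  for sc :: "'k::field \<Rightarrow> 'h::ab_group_add \<Rightarrow> 'h"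
    and mul :: "'h \<Rightarrow> 'h \<Rightarrow> 'h" (infixl "\<odot>" 70) and one :: 'h
    and SW :: "'h \<Rightarrow> ('h \<Rightarrow> 'h \<Rightarrow> 'k) \<Rightarrow> 'k" and \<epsilon> :: "'h \<Rightarrow> 'k" and S :: "'h \<Rightarrow> 'h" +
  fixes T :: "'h \<Rightarrow> 'h"
  assumes S_T [simp]: "S (T x) = x" and T_S [simp]: "T (S x) = x"
begin

sublocale opcop: invertible_weak_hopf_algebra sc "\<lambda>x y. y \<odot> x" one "\<lambda>h F. SW h (\<lambda>a b. F b a)" \<epsilon> S T
  by unfold_locales simp_all

lemma linear_T: "linear_endo T"
proof -
  have "S (T x + T y) = x + y" "S (sc c (T x)) = sc c x" for x y c
    using linear_S by (simp_all add: linear_endo_iff)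
  then have "T x + T y = T (x + y)" "sc c (T x) = T (sc c x)" for x y c
    by (metis T_S)+
  then show ?thesis
    by (simp add: linear_endo_iff)
qed

lemma linear_T_comp [simp]: "linear_endo g \<Longrightarrow> linear_endo (\<lambda>x. T (g x))"
  by (rule linear_endo_comp[OF linear_T])

lemma T_mul: "T (x \<odot> y) = T y \<odot> T x"
  by (metis S_T T_S S_mul)

lemma SW_T:
  assumes F: "bilinear_form F"
  shows "SW (T h) F = SW h (\<lambda>a b. F (T b) (T a))"
proof -
  note [simp] = bilinear_form_comp[OF F]
  show ?thesis
    using SW_S[of "\<lambda>a b. F (T b) (T a)" "T h"] by simp
qed

lemma SW_via_T: "bilinear_form F \<Longrightarrow> SW h F = SW (T h) (\<lambda>a b. F (S b) (S a))"
  using SW_S[of F "T h"] by simp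

lemma linear_form_T_eps_t:
  assumes f: "linear_form f"
  shows "f (T (\<epsilon>\<^sub>t h)) = SW one (\<lambda>a b. \<epsilon> (b \<odot> h) * f a)"
proof -
  note [simp] = linear_form_comp[OF f]
  have "f (T (\<epsilon>\<^sub>t h)) = SW one (\<lambda>a b. \<epsilon> (a \<odot> h) * f (T b))"
    by (rule linear_form_eps_t[of "\<lambda>z. f (T z)"]) simp
  also have "\<dots> = SW one (\<lambda>a b. \<epsilon> (S b \<odot> h) * f a)"
    using SW_one_S[of "\<lambda>a b. \<epsilon> (a \<odot> h) * f (T b)"] by simp
  also have "\<dots> = SW one (\<lambda>a b. \<epsilon> (b \<odot> h) * f a)"
    by (rule SW_one_cong) (simp_all add: S_Ht eps_eps_s_mul f)
  finally show ?thesis .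
qed

lemma SW_mul_T:
  assumes f: "linear_form f"
  shows "SW h (\<lambda>a b. f (b \<odot> T a)) = SW one (\<lambda>a b. \<epsilon> (b \<odot> h) * f a)"
proof -
  note [simp] = linear_form_comp[OF f]
  have "SW h (\<lambda>a b. f (b \<odot> T a)) = f (T (\<epsilon>\<^sub>t h))"
    using SW_mul_S[of "\<lambda>z. f (T z)" h] by (simp add: T_mul)
  then show ?thesis
    by (simp add: linear_form_T_eps_t f)
qed

lemma SW3_mul_S_mul:
  assumes f: "linear_form f"
  shows "f h = SW3 h (\<lambda>a b c. f (a \<odot> S b \<odot> c))"
proof -
  note [simp] = linear_form_comp[OF f]
  have "SW3 h (\<lambda>a b c. f (a \<odot> S b \<odot> c)) = SW one (\<lambda>a b. f ((h \<odot> a) \<odot> S b))"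
    using SW3_S_mul[of "\<lambda>x y. f (x \<odot> y)" h] by (simp add: mul_assoc)
  also have "\<dots> = f h"
    using SW_mul_S[of "\<lambda>z. f (h \<odot> z)" one] by (simp add: mul_assoc)
  finally show ?thesis ..
qed

end

context invertible_weak_hopf_algebra
begin

lemma weak_hopf_algebra_cop: "weak_hopf_algebra sc mul one (\<lambda>h F. SW h (\<lambda>a b. F b a)) \<epsilon> T"
proof -
  interpret cop: weak_bialgebra sc mul one "\<lambda>h F. SW h (\<lambda>a b. F b a)" \<epsilon>
    by (rule weak_bialgebra_cop)
  show ?thesis
  proof (intro weak_hopf_algebra.intro weak_bialgebra_cop weak_hopf_algebra_axioms.intro linear_T)
    fix f h assume f: "linear_form f"
    note [simp] = linear_form_comp[OF f]
    show "SW h (\<lambda>b a. f (a \<odot> T b)) = f (cop.eps_t h)"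
      by (simp add: SW_mul_T f cop.linear_form_eps_t)
    show "SW h (\<lambda>b a. f (T a \<odot> b)) = f (cop.eps_s h)"
      using opcop.SW_mul_T[OF f, of h] by (simp add: f cop.linear_form_eps_s)
    have "f (T h) = SW3 (T h) (\<lambda>a b c. f (a \<odot> S b \<odot> c))"
      by (rule SW3_mul_S_mul[OF f])
    also have "\<dots> = SW h (\<lambda>b a. SW b (\<lambda>d c. f (T a \<odot> c \<odot> T d)))"
      by (simp add: SW_T)
    finally show "f (T h) = SW h (\<lambda>b a. SW b (\<lambda>d c. f (T a \<odot> c \<odot> T d)))" .
  qed
qed

lemma invertible_weak_hopf_algebra_cop:
  "invertible_weak_hopf_algebra sc mul one (\<lambda>h F. SW h (\<lambda>a b. F b a)) \<epsilon> T S"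
  by (intro invertible_weak_hopf_algebra.intro weak_hopf_algebra_cop invertible_weak_hopf_algebra_axioms.intro)
    simp_all

end

context invertible_weak_hopf_algebra
begin

interpretation cop: invertible_weak_hopf_algebra sc mul one "\<lambda>h F. SW h (\<lambda>a b. F b a)" \<epsilon> T S
  by (rule invertible_weak_hopf_algebra_cop)

lemma cop_Ht: "cop.H\<^sub>t = H\<^sub>s" and cop_Hs: "cop.H\<^sub>s = H\<^sub>t"
  unfolding H\<^sub>t_def H\<^sub>s_def cop.H\<^sub>t_def cop.H\<^sub>s_def
  by (subst all_bilinear_flip[symmetric], auto)+

lemma T_Ht_in_Hs: "x \<in> H\<^sub>t \<Longrightarrow> T x \<in> H\<^sub>s"
  using cop.S_Hs_in_Ht[of x] by (simp add: cop_Ht cop_Hs)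

end

section \<open>Linear forms on the partial algebra\<close>

context weak_hopf_algebra
begin

text \<open>A linear form on the free algebra is given by its values on words, and the two sides of a
  relation of $H^w_{par}$ by the operators evaluating such forms.\<close>

definition par_relations :: "((('h list \<Rightarrow> 'k) \<Rightarrow> 'k) \<times> (('h list \<Rightarrow> 'k) \<Rightarrow> 'k)) set" where
  "par_relations =
     {(\<lambda>\<phi>. \<phi> [one], \<lambda>\<phi>. \<phi> [])}
   \<union> {(\<lambda>\<phi>. SW k (\<lambda>a b. \<phi> [h, a, S b]), \<lambda>\<phi>. SW k (\<lambda>a b. \<phi> [h \<odot> a, S b])) | h k. True}
   \<union> {(\<lambda>\<phi>. SW k (\<lambda>a b. \<phi> [h, S a, b]), \<lambda>\<phi>. SW k (\<lambda>a b. \<phi> [h \<odot> S a, b])) | h k. True}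
   \<union> {(\<lambda>\<phi>. SW h (\<lambda>a b. \<phi> [a, S b, k]), \<lambda>\<phi>. SW h (\<lambda>a b. \<phi> [a, S b \<odot> k])) | h k. True}
   \<union> {(\<lambda>\<phi>. SW h (\<lambda>a b. \<phi> [S a, b, k]), \<lambda>\<phi>. SW h (\<lambda>a b. \<phi> [S a, b \<odot> k])) | h k. True}
   \<union> {(\<lambda>\<phi>. \<phi> [h], \<lambda>\<phi>. SW3 h (\<lambda>a b c. \<phi> [a, S b, c])) | h. True}"

definition par_form :: "('h list \<Rightarrow> 'k) \<Rightarrow> bool" where
  "par_form \<phi> \<longleftrightarrow> multilinear_form \<phi> \<and>
    (\<forall>(\<alpha>, \<beta>)\<in>par_relations. \<forall>u v. \<alpha> (\<lambda>w. \<phi> (u @ w @ v)) = \<beta> (\<lambda>w. \<phi> (u @ w @ v)))"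

lemma par_formI:
  assumes "multilinear_form \<phi>" "\<And>u v. \<phi> (u @ one # v) = \<phi> (u @ v)"
    "\<And>u v h k. SW k (\<lambda>a b. \<phi> (u @ h # a # S b # v)) = SW k (\<lambda>a b. \<phi> (u @ (h \<odot> a) # S b # v))"
    "\<And>u v h k. SW k (\<lambda>a b. \<phi> (u @ h # S a # b # v)) = SW k (\<lambda>a b. \<phi> (u @ (h \<odot> S a) # b # v))"
    "\<And>u v h k. SW h (\<lambda>a b. \<phi> (u @ a # S b # k # v)) = SW h (\<lambda>a b. \<phi> (u @ a # (S b \<odot> k) # v))"
    "\<And>u v h k. SW h (\<lambda>a b. \<phi> (u @ S a # b # k # v)) = SW h (\<lambda>a b. \<phi> (u @ S a # (b \<odot> k) # v))"
    "\<And>u v h. \<phi> (u @ h # v) = SW3 h (\<lambda>a b c. \<phi> (u @ a # S b # c # v))"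
  shows "par_form \<phi>"
  unfolding par_form_def par_relations_def
  by (auto intro: assms)

lemma par_formD:
  assumes "par_form \<phi>"
  shows par_form_multilinear: "multilinear_form \<phi>"
    and par_form_one: "\<phi> (u @ one # v) = \<phi> (u @ v)"
    and par_form_left_E: "SW k (\<lambda>a b. \<phi> (u @ h # a # S b # v)) = SW k (\<lambda>a b. \<phi> (u @ (h \<odot> a) # S b # v))"
    and par_form_left_Et: "SW k (\<lambda>a b. \<phi> (u @ h # S a # b # v)) = SW k (\<lambda>a b. \<phi> (u @ (h \<odot> S a) # b # v))"
    and par_form_E_right: "SW h (\<lambda>a b. \<phi> (u @ a # S b # k # v)) = SW h (\<lambda>a b. \<phi> (u @ a # (S b \<odot> k) # v))"
    and par_form_Et_right: "SW h (\<lambda>a b. \<phi> (u @ S a # b # k # v)) = SW h (\<lambda>a b. \<phi> (u @ S a # (b \<odot> k) # v))"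
    and par_form_triple: "\<phi> (u @ h # v) = SW3 h (\<lambda>a b c. \<phi> (u @ a # S b # c # v))"
proof -
  have relation: "\<alpha> (\<lambda>w. \<phi> (u @ w @ v)) = \<beta> (\<lambda>w. \<phi> (u @ w @ v))" if "(\<alpha>, \<beta>) \<in> par_relations" for \<alpha> \<beta>
    using assms that unfolding par_form_def by blast
  show "multilinear_form \<phi>"
    using assms by (simp add: par_form_def)
  have "(\<lambda>\<phi>. \<phi> [one], \<lambda>\<phi>. \<phi> []) \<in> par_relations"
    "(\<lambda>\<phi>. SW k (\<lambda>a b. \<phi> [h, a, S b]), \<lambda>\<phi>. SW k (\<lambda>a b. \<phi> [h \<odot> a, S b])) \<in> par_relations"
    "(\<lambda>\<phi>. SW k (\<lambda>a b. \<phi> [h, S a, b]), \<lambda>\<phi>. SW k (\<lambda>a b. \<phi> [h \<odot> S a, b])) \<in> par_relations"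
    "(\<lambda>\<phi>. SW h (\<lambda>a b. \<phi> [a, S b, k]), \<lambda>\<phi>. SW h (\<lambda>a b. \<phi> [a, S b \<odot> k])) \<in> par_relations"
    "(\<lambda>\<phi>. SW h (\<lambda>a b. \<phi> [S a, b, k]), \<lambda>\<phi>. SW h (\<lambda>a b. \<phi> [S a, b \<odot> k])) \<in> par_relations"
    "(\<lambda>\<phi>. \<phi> [h], \<lambda>\<phi>. SW3 h (\<lambda>a b c. \<phi> [a, S b, c])) \<in> par_relations"
    unfolding par_relations_def by blast+
  from this[THEN relation] show "\<phi> (u @ one # v) = \<phi> (u @ v)"
    "SW k (\<lambda>a b. \<phi> (u @ h # a # S b # v)) = SW k (\<lambda>a b. \<phi> (u @ (h \<odot> a) # S b # v))"
    "SW k (\<lambda>a b. \<phi> (u @ h # S a # b # v)) = SW k (\<lambda>a b. \<phi> (u @ (h \<odot> S a) # b # v))"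
    "SW h (\<lambda>a b. \<phi> (u @ a # S b # k # v)) = SW h (\<lambda>a b. \<phi> (u @ a # (S b \<odot> k) # v))"
    "SW h (\<lambda>a b. \<phi> (u @ S a # b # k # v)) = SW h (\<lambda>a b. \<phi> (u @ S a # (b \<odot> k) # v))"
    "\<phi> (u @ h # v) = SW3 h (\<lambda>a b c. \<phi> (u @ a # S b # c # v))"
    by simp_all
qed

lemma par_form_linear: "par_form \<phi> \<Longrightarrow> linear_in_letter w \<Longrightarrow> linear_form (\<lambda>x. \<phi> (w x))"
  by (rule multilinear_form_linear[OF par_form_multilinear])

lemma par_form_context:
  assumes "par_form \<phi>"
  shows "par_form (\<lambda>w. \<phi> (p @ w @ q))"
proof -
  have "multilinear_form (\<lambda>w. \<phi> (p @ w @ q))"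
    by (rule multilinear_form_comp[OF par_form_multilinear[OF assms]]) simp
  moreover have "\<alpha> (\<lambda>w. \<phi> (p @ (u @ w @ v) @ q)) = \<beta> (\<lambda>w. \<phi> (p @ (u @ w @ v) @ q))"
    if "(\<alpha>, \<beta>) \<in> par_relations" for \<alpha> \<beta> u v
  proof -
    have "\<alpha> (\<lambda>w. \<phi> ((p @ u) @ w @ (v @ q))) = \<beta> (\<lambda>w. \<phi> ((p @ u) @ w @ (v @ q)))"
      using assms that unfolding par_form_def by blast
    then show ?thesis by simp
  qed
  ultimately show ?thesis
    unfolding par_form_def by blast
qed

lemma par_form_append_left: "par_form \<phi> \<Longrightarrow> par_form (\<lambda>w. \<phi> (u @ w))"
  using par_form_context[of \<phi> u "[]"] by simp

lemma par_form_append_right: "par_form \<phi> \<Longrightarrow> par_form (\<lambda>w. \<phi> (w @ v))"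
  using par_form_context[of \<phi> "[]" v] by simp

lemma par_form_Cons: "par_form \<phi> \<Longrightarrow> par_form (\<lambda>w. \<phi> (x # w))"
  using par_form_append_left[of \<phi> "[x]"] by simp

lemma finitely_supported_par_relations:
  assumes "(\<alpha>, \<beta>) \<in> par_relations"
  shows "finitely_supported \<alpha>" and "finitely_supported \<beta>"
  using assms finitely_supported_point[of 1]
  unfolding par_relations_def by (auto intro: finitely_supported_SW_map finitely_supported_SW_bind)

lemma par_form_finitely_supported:
  assumes \<Theta>: "finitely_supported \<Theta>" and K: "\<And>y. par_form (\<lambda>w. K w y)"
  shows "par_form (\<lambda>w. \<Theta> (\<lambda>y. K w y))"
proof -
  have "multilinear_form (\<lambda>w. \<Theta> (\<lambda>y. K w y))"
    by (rule multilinear_form_finitely_supported[OF \<Theta> par_form_multilinear[OF K]])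
  moreover have "\<alpha> (\<lambda>w. \<Theta> (\<lambda>y. K (u @ w @ v) y)) = \<beta> (\<lambda>w. \<Theta> (\<lambda>y. K (u @ w @ v) y))"
    if "(\<alpha>, \<beta>) \<in> par_relations" for \<alpha> \<beta> u v
  proof -
    have "\<alpha> (\<lambda>w. K (u @ w @ v) y) = \<beta> (\<lambda>w. K (u @ w @ v) y)" for y
      using K that unfolding par_form_def by blast
    then show ?thesis
      by (simp add: finitely_supported_swap[OF finitely_supported_par_relations(1)[OF that] \<Theta>]
          finitely_supported_swap[OF finitely_supported_par_relations(2)[OF that] \<Theta>])
  qed
  ultimately show ?thesis
    unfolding par_form_def by blast
qed

lemma par_form_SW: "(\<And>a b. par_form (\<lambda>w. K w a b)) \<Longrightarrow> par_form (\<lambda>w. SW h (\<lambda>a b. K w a b))"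
  using par_form_finitely_supported[OF finitely_supported_SW, of "\<lambda>w (a, b). K w a b"] by auto

end

context weak_hopf_algebra
begin

lemma par_form_rev:
  assumes \<phi>: "par_form \<phi>"
  shows "opcop.par_form (\<lambda>w. \<phi> (rev w))"
proof (rule opcop.par_formI)
  note [simp] = par_form_linear[OF \<phi>]
  show "multilinear_form (\<lambda>w. \<phi> (rev w))"
    by (rule multilinear_form_comp[OF par_form_multilinear[OF \<phi>]]) simp
  show "\<phi> (rev (u @ h # v)) = SW h (\<lambda>r a. SW r (\<lambda>c b. \<phi> (rev (u @ a # S b # c # v))))" for u h v
    using par_form_triple[OF \<phi>, of "rev v" h "rev u"] by (simp add: right_nested)
qed (simp_all add: par_form_one[OF \<phi>] par_form_left_E[OF \<phi>] par_form_left_Et[OF \<phi>]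
    par_form_E_right[OF \<phi>] par_form_Et_right[OF \<phi>])

end

context weak_hopf_algebra
begin

lemmas par_form_unrev = opcop.par_form_rev

abbreviation \<S> :: "'h list \<Rightarrow> 'h list" where
  "\<S> w \<equiv> rev (map S w)"

lemma par_form_antipode:
  assumes \<phi>: "par_form \<phi>"
  shows "par_form (\<lambda>w. \<phi> (\<S> w))"
proof (rule par_formI)
  note [simp] = par_form_linear[OF \<phi>] SW_S S_mul
  show "multilinear_form (\<lambda>w. \<phi> (\<S> w))"
    by (rule multilinear_form_comp[OF par_form_multilinear[OF \<phi>]]) simp
  fix u v h k
  let ?u = "\<S> u" and ?v = "\<S> v"
  show "\<phi> (\<S> (u @ one # v)) = \<phi> (\<S> (u @ v))"
    by (simp add: par_form_one[OF \<phi>])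
  show "SW k (\<lambda>a b. \<phi> (\<S> (u @ h # a # S b # v))) = SW k (\<lambda>a b. \<phi> (\<S> (u @ (h \<odot> a) # S b # v)))"
    using par_form_Et_right[OF \<phi>, of "S k" ?v "S h" ?u] by simp
  show "SW k (\<lambda>a b. \<phi> (\<S> (u @ h # S a # b # v))) = SW k (\<lambda>a b. \<phi> (\<S> (u @ (h \<odot> S a) # b # v)))"
    using par_form_E_right[OF \<phi>, of "S k" ?v "S h" ?u] by simp
  show "SW h (\<lambda>a b. \<phi> (\<S> (u @ a # S b # k # v))) = SW h (\<lambda>a b. \<phi> (\<S> (u @ a # (S b \<odot> k) # v)))"
    using par_form_left_Et[OF \<phi>, of "S h" ?v "S k" ?u] by simp
  show "SW h (\<lambda>a b. \<phi> (\<S> (u @ S a # b # k # v))) = SW h (\<lambda>a b. \<phi> (\<S> (u @ S a # (b \<odot> k) # v)))"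
    using par_form_left_E[OF \<phi>, of "S h" ?v "S k" ?u] by simp
  show "\<phi> (\<S> (u @ h # v)) = SW3 h (\<lambda>a b c. \<phi> (\<S> (u @ a # S b # c # v)))"
    using par_form_triple[OF \<phi>, of ?v "S h" ?u] by (simp add: right_nested)
qed

lemma par_form_E_one:
  assumes \<phi>: "par_form \<phi>"
  shows "SW one (\<lambda>a b. \<phi> (u @ a # S b # v)) = \<phi> (u @ v)"
proof -
  note [simp] = par_form_linear[OF \<phi>]
  have "\<phi> (u @ v) = SW3 one (\<lambda>a b c. \<phi> (u @ a # S b # c # v))"
    using par_form_one[OF \<phi>, of u v] par_form_triple[OF \<phi>, of u one v] by simp
  also have "\<dots> = SW one (\<lambda>p c. SW p (\<lambda>a b. \<phi> (u @ a # S b # c # v)))"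
    by (simp add: right_nested)
  also have "\<dots> = SW one (\<lambda>p c. SW p (\<lambda>a b. \<phi> (u @ a # (S b \<odot> c) # v)))"
    by (simp add: par_form_E_right[OF \<phi>])
  also have "\<dots> = SW3 one (\<lambda>a b c. \<phi> (u @ a # (S b \<odot> c) # v))"
    by (simp add: right_nested)
  also have "\<dots> = SW one (\<lambda>a b. \<phi> (u @ a # S b # v))"
    by (subst SW3_S_mul[of "\<lambda>x y. \<phi> (u @ x # y # v)"]) simp_all
  finally show ?thesis ..
qed

lemma par_form_E_Ht:
  assumes \<phi>: "par_form \<phi>" and x: "x \<in> H\<^sub>t"
  shows "SW x (\<lambda>a b. \<phi> (u @ a # S b # v)) = \<phi> (u @ x # v)"
proof -
  note [simp] = par_form_linear[OF \<phi>]
  have "SW x (\<lambda>a b. \<phi> (u @ a # S b # v)) = SW one (\<lambda>a b. \<phi> (u @ (x \<odot> a) # S b # v))"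
    by (rule SW_Ht_left[OF x]) simp
  also have "\<dots> = SW one (\<lambda>a b. \<phi> (u @ x # a # S b # v))"
    by (simp add: par_form_left_E[OF \<phi>])
  also have "\<dots> = \<phi> (u @ x # v)"
    using par_form_E_one[OF \<phi>, of "u @ [x]" v] by simp
  finally show ?thesis .
qed

lemma par_form_mul_Ht:
  assumes \<phi>: "par_form \<phi>" and x: "x \<in> H\<^sub>t"
  shows "\<phi> (u @ h # x # v) = \<phi> (u @ (h \<odot> x) # v)"
proof -
  note [simp] = par_form_linear[OF \<phi>]
  have "\<phi> (u @ h # x # v) = SW x (\<lambda>a b. \<phi> (u @ h # a # S b # v))"
    using par_form_E_Ht[OF \<phi> x, of "u @ [h]" v] by simp
  also have "\<dots> = SW x (\<lambda>a b. \<phi> (u @ (h \<odot> a) # S b # v))"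
    by (rule par_form_left_E[OF \<phi>])
  also have "\<dots> = SW one (\<lambda>a b. \<phi> (u @ ((h \<odot> x) \<odot> a) # S b # v))"
    by (subst SW_Ht_left[OF x]) (simp_all add: mul_assoc)
  also have "\<dots> = SW one (\<lambda>a b. \<phi> (u @ (h \<odot> x) # a # S b # v))"
    by (simp add: par_form_left_E[OF \<phi>])
  also have "\<dots> = \<phi> (u @ (h \<odot> x) # v)"
    using par_form_E_one[OF \<phi>, of "u @ [h \<odot> x]" v] by simp
  finally show ?thesis .
qed

lemma par_form_triple_S:
  assumes \<phi>: "par_form \<phi>"
  shows "\<phi> (u @ S h # v) = SW3 h (\<lambda>a b c. \<phi> (u @ S a # b # S c # v))"
proof -
  note [simp] = par_form_linear[OF \<phi>]
  have "SW3 h (\<lambda>a b c. \<phi> (u @ S a # b # S c # v)) = SW3 h (\<lambda>a b c. \<phi> (u @ (S a \<odot> b) # S c # v))"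
    by (simp add: par_form_left_E[OF \<phi>])
  also have "\<dots> = SW h (\<lambda>p c. SW p (\<lambda>a b. \<phi> (u @ (S a \<odot> b) # S c # v)))"
    by (simp add: right_nested)
  also have "\<dots> = SW one (\<lambda>a b. \<phi> (u @ a # (S b \<odot> S h) # v))"
    by (subst SW3_S_mul_left[of "\<lambda>x y. \<phi> (u @ x # S y # v)"]) (simp_all add: S_mul)
  also have "\<dots> = SW one (\<lambda>a b. \<phi> (u @ a # S b # S h # v))"
    by (simp add: par_form_E_right[OF \<phi>])
  also have "\<dots> = \<phi> (u @ S h # v)"
    by (rule par_form_E_one[OF \<phi>])
  finally show ?thesis ..
qed

lemma par_form_letter_E:
  assumes \<phi>: "par_form \<phi>"
  shows "SW k (\<lambda>a b. \<phi> (u @ h # a # S b # v)) = SW h (\<lambda>x y. SW (x \<odot> k) (\<lambda>a b. \<phi> (u @ a # S b # y # v)))"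
proof -
  note [simp] = par_form_linear[OF \<phi>]
  have "SW h (\<lambda>x y. SW (x \<odot> k) (\<lambda>a b. \<phi> (u @ a # S b # y # v)))
      = SW h (\<lambda>x y. SW (x \<odot> k) (\<lambda>a b. \<phi> (u @ a # (S b \<odot> y) # v)))"
    by (simp add: par_form_E_right[OF \<phi>])
  also have "\<dots> = SW h (\<lambda>x y. SW x (\<lambda>p q. SW k (\<lambda>c d. \<phi> (u @ (p \<odot> c) # (S d \<odot> (S q \<odot> y)) # v))))"
    by (simp add: SW_mul S_mul mul_assoc)
  also have "\<dots> = SW3 h (\<lambda>p q y. SW k (\<lambda>c d. \<phi> (u @ (p \<odot> c) # (S d \<odot> (S q \<odot> y)) # v)))"
    by (simp add: right_nested)
  also have "\<dots> = SW one (\<lambda>p q. SW k (\<lambda>c d. \<phi> (u @ ((h \<odot> p) \<odot> c) # (S d \<odot> S q) # v)))"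
    by (subst SW3_S_mul[of "\<lambda>x y. SW k (\<lambda>c d. \<phi> (u @ (x \<odot> c) # (S d \<odot> y) # v))"]) simp_all
  also have "\<dots> = SW one (\<lambda>p q. SW k (\<lambda>c d. \<phi> (u @ (h \<odot> (p \<odot> c)) # S (q \<odot> d) # v)))"
    by (simp add: S_mul mul_assoc)
  also have "\<dots> = SW k (\<lambda>c d. \<phi> (u @ (h \<odot> c) # S d # v))"
    by (rule SW_one_left[of "\<lambda>x y. \<phi> (u @ (h \<odot> x) # S y # v)"]) simp
  also have "\<dots> = SW k (\<lambda>c d. \<phi> (u @ h # c # S d # v))"
    by (rule par_form_left_E[OF \<phi>, symmetric])
  finally show ?thesis ..
qed

end

context invertible_weak_hopf_algebra
begin

interpretation cop: invertible_weak_hopf_algebra sc mul one "\<lambda>h F. SW h (\<lambda>a b. F b a)" \<epsilon> T S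
  by (rule invertible_weak_hopf_algebra_cop)

lemma par_form_cop:
  assumes \<phi>: "par_form \<phi>"
  shows "cop.par_form \<phi>"
proof (rule cop.par_formI[OF par_form_multilinear[OF \<phi>] par_form_one[OF \<phi>]])
  note [simp] = par_form_linear[OF \<phi>]
  show "SW k (\<lambda>a b. \<phi> (u @ h # b # T a # v)) = SW k (\<lambda>a b. \<phi> (u @ (h \<odot> b) # T a # v))" for u h k v
    by (subst (1 2) SW_via_T) (simp_all add: par_form_left_Et[OF \<phi>])
  show "SW k (\<lambda>a b. \<phi> (u @ h # T b # a # v)) = SW k (\<lambda>a b. \<phi> (u @ (h \<odot> T b) # a # v))" for u h k v
    by (subst (1 2) SW_via_T) (simp_all add: par_form_left_E[OF \<phi>])
  show "SW h (\<lambda>a b. \<phi> (u @ b # T a # k # v)) = SW h (\<lambda>a b. \<phi> (u @ b # (T a \<odot> k) # v))" for u h k v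
    by (subst (1 2) SW_via_T) (simp_all add: par_form_Et_right[OF \<phi>])
  show "SW h (\<lambda>a b. \<phi> (u @ T b # a # k # v)) = SW h (\<lambda>a b. \<phi> (u @ T b # (a \<odot> k) # v))" for u h k v
    by (subst (1 2) SW_via_T) (simp_all add: par_form_E_right[OF \<phi>])
  show "\<phi> (u @ h # v) = SW h (\<lambda>r a. SW r (\<lambda>c b. \<phi> (u @ a # T b # c # v)))" for u h v
  proof -
    have "SW h (\<lambda>r a. SW r (\<lambda>c b. \<phi> (u @ a # T b # c # v)))
      = SW (T h) (\<lambda>a r. SW (S r) (\<lambda>c b. \<phi> (u @ S a # T b # c # v)))"
      by (subst SW_via_T) simp_all
    also have "\<dots> = SW3 (T h) (\<lambda>a b c. \<phi> (u @ S a # b # S c # v))"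
      by (simp add: SW_S)
    also have "\<dots> = \<phi> (u @ h # v)"
      using par_form_triple_S[OF \<phi>, of u "T h" v] by simp
    finally show ?thesis ..
  qed
qed

lemma par_form_Ht_mul:
  assumes \<phi>: "par_form \<phi>" and x: "x \<in> H\<^sub>t"
  shows "\<phi> (u @ x # k # v) = \<phi> (u @ (x \<odot> k) # v)"
proof -
  note [simp] = par_form_linear[OF \<phi>] and Tx = T_Ht_in_Hs[OF x]
  have "\<phi> (u @ x # k # v) = SW one (\<lambda>a b. \<phi> (u @ a # S b # x # k # v))"
    using par_form_E_one[OF \<phi>, of u "x # k # v"] by simp
  also have "\<dots> = SW one (\<lambda>a b. \<phi> (u @ a # (S b \<odot> x) # k # v))"
    by (rule par_form_E_right[OF \<phi>])
  also have "\<dots> = SW (T x) (\<lambda>a b. \<phi> (u @ a # S b # k # v))"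
    by (subst SW_Hs_left[OF Tx]) (simp_all add: S_mul)
  also have "\<dots> = SW (T x) (\<lambda>a b. \<phi> (u @ a # (S b \<odot> k) # v))"
    by (rule par_form_E_right[OF \<phi>])
  also have "\<dots> = SW one (\<lambda>a b. \<phi> (u @ a # (S b \<odot> (x \<odot> k)) # v))"
    by (subst SW_Hs_left[OF Tx]) (simp_all add: S_mul mul_assoc)
  also have "\<dots> = SW one (\<lambda>a b. \<phi> (u @ a # S b # (x \<odot> k) # v))"
    by (simp add: par_form_E_right[OF \<phi>])
  also have "\<dots> = \<phi> (u @ (x \<odot> k) # v)"
    using par_form_E_one[OF \<phi>, of u "(x \<odot> k) # v"] by simp
  finally show ?thesis .
qed

end

context invertible_weak_hopf_algebra
begin

interpretation cop: invertible_weak_hopf_algebra sc mul one "\<lambda>h F. SW h (\<lambda>a b. F b a)" \<epsilon> T S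
  by (rule invertible_weak_hopf_algebra_cop)

abbreviation \<S>' :: "'h list \<Rightarrow> 'h list" where
  "\<S>' w \<equiv> rev (map T w)"

lemma antipode_inverse_word [simp]: "\<S> (\<S>' w) = w" "\<S>' (\<S> w) = w"
  by (simp_all add: rev_map comp_def)

lemma par_form_inverse_antipode: "par_form \<phi> \<Longrightarrow> par_form (\<lambda>w. \<phi> (\<S>' w))"
  by (rule cop.par_form_cop[OF cop.par_form_antipode[OF par_form_cop]])

lemma par_form_tE_Ht:
  assumes "par_form \<phi>" "x \<in> H\<^sub>t"
  shows "SW x (\<lambda>a b. \<phi> (u @ b # T a # v)) = \<phi> (u @ T x # v)"
  using par_form_E_Ht[OF par_form_inverse_antipode[OF assms(1)] assms(2), of "\<S> v" "\<S> u"]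
  by (simp add: rev_map comp_def)

lemma par_form_mul_Hs: "par_form \<phi> \<Longrightarrow> x \<in> H\<^sub>s \<Longrightarrow> \<phi> (u @ h # x # v) = \<phi> (u @ (h \<odot> x) # v)"
  using opcop.par_form_Ht_mul[OF par_form_rev, of \<phi> x "rev v" h "rev u"] by (simp add: opcop_simps)

lemma par_form_Hs_mul: "par_form \<phi> \<Longrightarrow> x \<in> H\<^sub>s \<Longrightarrow> \<phi> (u @ x # k # v) = \<phi> (u @ (x \<odot> k) # v)"
  using opcop.par_form_mul_Ht[OF par_form_rev, of \<phi> x "rev v" k "rev u"] by (simp add: opcop_simps)

lemma par_form_Et_letter:
  "par_form \<phi> \<Longrightarrow>
    SW k (\<lambda>a b. \<phi> (u @ S a # b # h # v)) = SW h (\<lambda>x y. SW (k \<odot> y) (\<lambda>a b. \<phi> (u @ x # S a # b # v)))"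
  using opcop.par_form_letter_E[OF par_form_rev, of \<phi> k "rev v" h "rev u"] by simp

lemma par_form_Et_E:
  assumes \<phi>: "par_form \<phi>"
  shows "SW h (\<lambda>a b. SW k (\<lambda>c d. \<phi> (u @ S c # d # a # S b # v)))
       = SW h (\<lambda>g q. SW one (\<lambda>s t. SW (k \<odot> t) (\<lambda>c d. \<phi> (u @ (s \<odot> g) # S q # S c # d # v))))"
proof -
  note [simp] = par_form_linear[OF \<phi>]
  let ?M = "\<lambda>x w q. SW (k \<odot> w) (\<lambda>c d. \<phi> (u @ x # S q # S c # d # v))"
  have "SW h (\<lambda>a b. SW k (\<lambda>c d. \<phi> (u @ S c # d # a # S b # v)))
      = SW h (\<lambda>a b. SW a (\<lambda>x y. SW (k \<odot> y) (\<lambda>c d. \<phi> (u @ x # S c # d # S b # v))))"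
    by (simp add: par_form_Et_letter[OF \<phi>])
  also have "\<dots> = SW h (\<lambda>a b. SW a (\<lambda>x y. SW (S b) (\<lambda>z w. SW (k \<odot> y \<odot> w) (\<lambda>c d. \<phi> (u @ x # z # S c # d # v)))))"
    using par_form_Et_letter[OF \<phi>, of _ "u @ [_]"] by simp
  also have "\<dots> = SW h (\<lambda>a b. SW a (\<lambda>x y. SW b (\<lambda>p q. ?M x (y \<odot> S p) q)))"
    by (simp add: SW_S mul_assoc)
  also have "\<dots> = SW h (\<lambda>a b. SW b (\<lambda>p q. SW a (\<lambda>x y. ?M x (y \<odot> S p) q)))"
    by (intro SW_cong SW_swap)
  also have "\<dots> = SW h (\<lambda>g q. SW3 g (\<lambda>x y p. ?M x (y \<odot> S p) q))"
    by (simp add: right_nested)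
  also have "\<dots> = SW h (\<lambda>g q. SW one (\<lambda>s t. ?M (s \<odot> g) t q))"
    by (subst SW3_mul_S[of "\<lambda>x y. ?M x y _"]) simp_all
  finally show ?thesis .
qed

lemma par_form_E_Et_commute:
  assumes \<phi>: "par_form \<phi>"
  shows "SW h (\<lambda>a b. SW k (\<lambda>c d. \<phi> (u @ a # S b # S c # d # v)))
       = SW h (\<lambda>a b. SW k (\<lambda>c d. \<phi> (u @ S c # d # a # S b # v)))"
proof -
  note [simp] = par_form_linear[OF \<phi>]
  have "SW h (\<lambda>a b. SW k (\<lambda>c d. \<phi> (u @ S c # d # a # S b # v)))
      = SW h (\<lambda>g q. SW one (\<lambda>s t. SW (k \<odot> t) (\<lambda>c d. \<phi> (u @ (s \<odot> g) # S q # S c # d # v))))"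
    by (rule par_form_Et_E[OF \<phi>])
  also have "\<dots> = SW h (\<lambda>g q. SW one (\<lambda>s t. SW k (\<lambda>c d. \<phi> (u @ (s \<odot> g) # S (t \<odot> q) # S c # d # v))))"
  proof (rule SW_cong, rule SW_one_cong)
    fix g q s t assume t: "t \<in> H\<^sub>t"
    have "SW (k \<odot> t) (\<lambda>c d. \<phi> (u @ (s \<odot> g) # S q # S c # d # v))
        = SW k (\<lambda>c d. \<phi> (u @ (s \<odot> g) # S q # S (c \<odot> t) # d # v))"
      by (rule SW_mul_Ht[OF t]) simp
    also have "\<dots> = SW k (\<lambda>c d. \<phi> (u @ (s \<odot> g) # S (t \<odot> q) # S c # d # v))"
      using par_form_Hs_mul[OF \<phi> S_Ht_in_Hs[OF t], of "u @ [s \<odot> g, S q]"]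
        par_form_mul_Hs[OF \<phi> S_Ht_in_Hs[OF t], of "u @ [s \<odot> g]"]
      by (simp add: S_mul)
    finally show "SW (k \<odot> t) (\<lambda>c d. \<phi> (u @ (s \<odot> g) # S q # S c # d # v))
        = SW k (\<lambda>c d. \<phi> (u @ (s \<odot> g) # S (t \<odot> q) # S c # d # v))" .
  qed simp_all
  also have "\<dots> = SW one (\<lambda>s t. SW h (\<lambda>g q. SW k (\<lambda>c d. \<phi> (u @ (s \<odot> g) # S (t \<odot> q) # S c # d # v))))"
    by (rule SW_swap)
  also have "\<dots> = SW h (\<lambda>g q. SW k (\<lambda>c d. \<phi> (u @ g # S q # S c # d # v)))"
    by (rule SW_one_left[of "\<lambda>g q. SW k (\<lambda>c d. \<phi> (u @ g # S q # S c # d # v))"]) simp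
  finally show ?thesis ..
qed

end

section \<open>The coproduct of words\<close>

context prebialgebra
begin

primrec SW_word :: "'h list \<Rightarrow> ('h list \<Rightarrow> 'h list \<Rightarrow> 'k) \<Rightarrow> 'k" where
  "SW_word [] F = F [] []"
| "SW_word (h # w) F = SW h (\<lambda>a b. SW_word w (\<lambda>x y. F (a # x) (b # y)))"

lemma SW_word_append: "SW_word (u @ v) F = SW_word u (\<lambda>p q. SW_word v (\<lambda>r s. F (p @ r) (q @ s)))"
  by (induction u arbitrary: F) auto

lemma SW_word_cong: "(\<And>x y. F x y = G x y) \<Longrightarrow> SW_word w F = SW_word w G"
  by presburger

lemma finitely_supported_SW_word: "finitely_supported (\<lambda>f. SW_word w (\<lambda>x y. f (x, y)))"
proof (induction w)
  case Nil
  show ?case using finitely_supported_point[of 1] by simp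
next
  case (Cons h w)
  show ?case
    using finitely_supported_SW_bind[of "\<lambda>a b f. SW_word w (\<lambda>x y. f (x, y))" h "\<lambda>a b (x, y). (a # x, b # y)"] Cons
    by simp
qed

lemma SW_word_finitely_supported_swap:
  assumes "finitely_supported \<Theta>"
  shows "SW_word w (\<lambda>x y. \<Theta> (\<lambda>z. F x y z)) = \<Theta> (\<lambda>z. SW_word w (\<lambda>x y. F x y z))"
  using finitely_supported_swap[OF finitely_supported_SW_word assms, of w "\<lambda>(x, y). F x y"] by simp

lemma SW_SW_word_swap:
  "SW h (\<lambda>a b. SW_word w (\<lambda>x y. F a b x y)) = SW_word w (\<lambda>x y. SW h (\<lambda>a b. F a b x y))"
  using SW_word_finitely_supported_swap[OF finitely_supported_SW, of w h "\<lambda>x y (a, b). F a b x y"]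
  by simp

lemma SW_word_swap:
  "SW_word v (\<lambda>a b. SW_word w (\<lambda>x y. F a b x y)) = SW_word w (\<lambda>x y. SW_word v (\<lambda>a b. F a b x y))"
  using SW_word_finitely_supported_swap[OF finitely_supported_SW_word, of w v "\<lambda>x y (a, b). F a b x y"]
  by simp

lemma SW_word_rev: "SW_word (rev w) F = SW_word w (\<lambda>x y. F (rev x) (rev y))"
proof (induction w arbitrary: F)
  case (Cons h w)
  have "SW_word (rev (h # w)) F = SW_word w (\<lambda>p q. SW h (\<lambda>a b. F (rev p @ [a]) (rev q @ [b])))"
    by (simp add: SW_word_append Cons)
  also have "\<dots> = SW_word (h # w) (\<lambda>x y. F (rev x) (rev y))"
    by (simp add: SW_SW_word_swap)
  finally show ?case .
qed simp

lemma SW_word_context: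
  "SW_word (u @ z @ v) F
      = SW_word z (\<lambda>x y. SW_word u (\<lambda>p q. SW_word v (\<lambda>r s. F (p @ x @ r) (q @ y @ s))))"
  unfolding SW_word_append by (rule SW_word_swap)

lemma linear_SW_word_inside [simp]:
  "(\<And>x y. linear_form (\<lambda>z. F z x y)) \<Longrightarrow> linear_form (\<lambda>z. SW_word w (\<lambda>x y. F z x y))"
  using linear_form_finitely_supported[OF finitely_supported_SW_word, of "\<lambda>z (x, y). F z x y"] by auto

lemma multilinear_form_SW_word:
  assumes "\<And>q. multilinear_form (\<lambda>p. F p q)" "\<And>p. multilinear_form (\<lambda>q. F p q)"
  shows "multilinear_form (\<lambda>w. SW_word w F)"
proof -
  note [simp] = multilinear_form_linear[OF assms(1)] multilinear_form_linear[OF assms(2)]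
  show ?thesis
    unfolding multilinear_form_def by (simp add: SW_word_append)
qed

lemma SW_word_coassoc:
  assumes "\<And>b c. multilinear_form (\<lambda>a. F a b c)" "\<And>a c. multilinear_form (\<lambda>b. F a b c)"
    "\<And>a b. multilinear_form (\<lambda>c. F a b c)"
  shows "SW_word w (\<lambda>x y. SW_word x (\<lambda>p q. F p q y)) = SW_word w (\<lambda>x y. SW_word y (\<lambda>p q. F x p q))"
  using assms
proof (induction w arbitrary: F)
  case (Cons h w)
  have Cons_forms: "multilinear_form (\<lambda>a. F (x # a) b c)" "multilinear_form (\<lambda>b. F a (x # b) c)"
    "multilinear_form (\<lambda>c. F a b (x # c))" for x a b c
    by (rule multilinear_form_comp[where w = "\<lambda>w. x # w"], simp add: Cons.prems, simp)+
  note [simp] = multilinear_form_linear[OF Cons.prems(1)] multilinear_form_linear[OF Cons.prems(2)]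
    multilinear_form_linear[OF Cons.prems(3)]
  have "SW_word (h # w) (\<lambda>x y. SW_word x (\<lambda>p q. F p q y))
      = SW h (\<lambda>a b. SW a (\<lambda>c d. SW_word w (\<lambda>x y. SW_word x (\<lambda>p q. F (c # p) (d # q) (b # y)))))"
    by (simp add: SW_SW_word_swap[of _ w])
  also have "\<dots> = SW h (\<lambda>a b. SW a (\<lambda>c d. SW_word w (\<lambda>x y. SW_word y (\<lambda>p q. F (c # x) (d # p) (b # q)))))"
    by (subst Cons.IH)
      (auto intro: multilinear_form_comp[OF Cons_forms(1)] multilinear_form_comp[OF Cons_forms(2)]
        multilinear_form_comp[OF Cons_forms(3)] simp: Cons_forms)
  also have "\<dots> = SW h (\<lambda>a b. SW b (\<lambda>c d. SW_word w (\<lambda>x y. SW_word y (\<lambda>p q. F (a # x) (c # p) (d # q)))))"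
    by (rule SW_coassoc) simp
  also have "\<dots> = SW_word (h # w) (\<lambda>x y. SW_word y (\<lambda>p q. F x p q))"
    by (simp add: SW_SW_word_swap[of _ w])
  finally show ?case .
qed simp

end

context prebialgebra
begin

lemma opcop_SW_word: "opcop.SW_word w F = SW_word w (\<lambda>x y. F y x)"
  by (induction w arbitrary: F) auto

lemma opcop_SW_word_rev: "opcop.SW_word (rev w) (\<lambda>x y. F (rev y) (rev x)) = SW_word w F"
  by (simp add: opcop_SW_word SW_word_rev)

end

section \<open>Balanced forms\<close>

context invertible_weak_hopf_algebra
begin

text \<open>The linear forms on $H^w_{par} \otimes_A H^w_{par}$ and $H^w_{par} \otimes_{\tilde A} H^w_{par}$. It
  suffices to balance over the generators, and $t(E_h) = [h_2][S^{-1}(h_1)]$.\<close>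

definition left_balanced :: "('h list \<Rightarrow> 'h list \<Rightarrow> 'k) \<Rightarrow> bool" where
  "left_balanced F \<longleftrightarrow> (\<forall>q. par_form (\<lambda>p. F p q)) \<and> (\<forall>p. par_form (\<lambda>q. F p q))
     \<and> (\<forall>h x y. SW h (\<lambda>a b. F (b # T a # x) y) = SW h (\<lambda>a b. F x (a # S b # y)))"

definition right_balanced :: "('h list \<Rightarrow> 'h list \<Rightarrow> 'k) \<Rightarrow> bool" where
  "right_balanced F \<longleftrightarrow> (\<forall>q. par_form (\<lambda>p. F p q)) \<and> (\<forall>p. par_form (\<lambda>q. F p q))
     \<and> (\<forall>h x y. SW h (\<lambda>a b. F (x @ [S a, b]) y) = SW h (\<lambda>a b. F x (y @ [T b, a])))"

lemma left_balancedD: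
  assumes "left_balanced F"
  shows left_balanced_par_form_left: "par_form (\<lambda>p. F p q)"
    and left_balanced_par_form_right: "par_form (\<lambda>q. F p q)"
    and left_balanced_move: "SW h (\<lambda>a b. F (b # T a # x) y) = SW h (\<lambda>a b. F x (a # S b # y))"
  using assms unfolding left_balanced_def by blast+

lemma right_balancedD:
  assumes "right_balanced F"
  shows right_balanced_par_form_left: "par_form (\<lambda>p. F p q)"
    and right_balanced_par_form_right: "par_form (\<lambda>q. F p q)"
    and right_balanced_move: "SW h (\<lambda>a b. F (x @ [S a, b]) y) = SW h (\<lambda>a b. F x (y @ [T b, a]))"
  using assms unfolding right_balanced_def by blast+

lemma left_balanced_linear:
  assumes "left_balanced F" and "linear_in_letter w"
  shows "linear_form (\<lambda>x. F (w x) q)" and "linear_form (\<lambda>x. F q (w x))"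
  using par_form_linear[OF left_balanced_par_form_left[OF assms(1)] assms(2)]
    par_form_linear[OF left_balanced_par_form_right[OF assms(1)] assms(2)]
  by simp_all

lemma left_balanced_append_right:
  assumes F: "left_balanced F"
  shows "left_balanced (\<lambda>x y. F (x @ r) (y @ s))"
  unfolding left_balanced_def
proof (intro conjI allI)
  show "SW h (\<lambda>a b. F ((b # T a # x) @ r) (y @ s))
      = SW h (\<lambda>a b. F (x @ r) ((a # S b # y) @ s))" for h x y
    using left_balanced_move[OF F, of h "x @ r" "y @ s"] by simp
qed (simp_all add: par_form_append_right[OF left_balanced_par_form_left[OF F]]
    par_form_append_right[OF left_balanced_par_form_right[OF F]])

lemma left_balanced_finitely_supported:
  assumes \<Theta>: "finitely_supported \<Theta>" and K: "\<And>z. left_balanced (\<lambda>x y. K x y z)"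
  shows "left_balanced (\<lambda>x y. \<Theta> (\<lambda>z. K x y z))"
  unfolding left_balanced_def
proof (intro conjI allI)
  show "par_form (\<lambda>p. \<Theta> (\<lambda>z. K p q z))" for q
    by (rule par_form_finitely_supported[OF \<Theta>]) (rule left_balanced_par_form_left[OF K])
  show "par_form (\<lambda>q. \<Theta> (\<lambda>z. K p q z))" for p
    by (rule par_form_finitely_supported[OF \<Theta>]) (rule left_balanced_par_form_right[OF K])
  show "SW h (\<lambda>a b. \<Theta> (\<lambda>z. K (b # T a # x) y z)) = SW h (\<lambda>a b. \<Theta> (\<lambda>z. K x (a # S b # y) z))" for h x y
    by (simp only: SW_finitely_supported_swap[OF \<Theta>] left_balanced_move[OF K])
qed

lemma left_balanced_SW_word:
  "(\<And>r s. left_balanced (\<lambda>x y. K x y r s)) \<Longrightarrow> left_balanced (\<lambda>x y. SW_word w (\<lambda>r s. K x y r s))"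
  using left_balanced_finitely_supported[OF finitely_supported_SW_word, of "\<lambda>x y (r, s). K x y r s"]
  by auto

end

context invertible_weak_hopf_algebra
begin

interpretation cop: invertible_weak_hopf_algebra sc mul one "\<lambda>h F. SW h (\<lambda>a b. F b a)" \<epsilon> T S
  by (rule invertible_weak_hopf_algebra_cop)

lemma cop_SW_word: "cop.SW_word w F = SW_word w (\<lambda>x y. F y x)"
  by (rule opcop_SW_word)

lemma left_balanced_cop: "left_balanced F \<Longrightarrow> cop.left_balanced (\<lambda>x y. F y x)"
  unfolding cop.left_balanced_def
  by (auto intro: par_form_cop left_balancedD left_balanced_move[symmetric])

lemma right_balanced_rev:
  assumes F: "right_balanced F"
  shows "opcop.left_balanced (\<lambda>x y. F (rev y) (rev x))"
  unfolding opcop.left_balanced_def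
  using par_form_rev[OF right_balanced_par_form_left[OF F]]
    par_form_rev[OF right_balanced_par_form_right[OF F]]
  by (simp add: right_balanced_move[OF F])

lemma right_balanced_unrev:
  assumes F: "opcop.left_balanced F"
  shows "right_balanced (\<lambda>x y. F (rev y) (rev x))"
  unfolding right_balanced_def
  using par_form_unrev[OF opcop.left_balanced_par_form_left[OF F]]
    par_form_unrev[OF opcop.left_balanced_par_form_right[OF F]]
    opcop.left_balanced_move[OF F]
  by simp

text \<open>The Takeuchi condition for a single letter: $[h_1] t(E_k) \otimes [h_2] = [h_1] \otimes [h_2] E_k$. Move
  $E_{h_2 k}$ in $[h_2] E_k = E_{h_2 k} [h_3]$ to the first factor, where
  $t(E_{h_2 k}) [h_1] = [h_1] t(E_k)$.\<close>

lemma left_balanced_SW: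
  assumes F: "left_balanced F"
  shows "left_balanced (\<lambda>x y. SW h (\<lambda>a b. F (a # x) (b # y)))"
  unfolding left_balanced_def
proof (intro conjI allI)
  note form_left = left_balanced_par_form_left[OF F] and form_right = left_balanced_par_form_right[OF F]
  note [simp] = left_balanced_linear[OF F]
  show "par_form (\<lambda>p. SW h (\<lambda>a b. F (a # p) (b # q)))" for q
    by (intro par_form_SW par_form_Cons[where \<phi> = "\<lambda>p. F p _"] form_left)
  show "par_form (\<lambda>q. SW h (\<lambda>a b. F (a # p) (b # q)))" for p
    by (intro par_form_SW par_form_Cons[where \<phi> = "\<lambda>q. F _ q"] form_right)
  fix k x y
  have "SW k (\<lambda>c d. SW h (\<lambda>a b. F (a # x) (b # c # S d # y)))
      = SW h (\<lambda>a b. SW k (\<lambda>c d. F (a # x) (b # c # S d # y)))"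
    by (rule SW_swap)
  also have "\<dots> = SW3 h (\<lambda>a p q. SW (p \<odot> k) (\<lambda>c d. F (a # x) (c # S d # q # y)))"
    using par_form_letter_E[OF form_right, of k _ "[]"] by simp
  also have "\<dots> = SW3 h (\<lambda>a p q. SW (p \<odot> k) (\<lambda>c d. F (d # T c # a # x) (q # y)))"
    by (simp add: left_balanced_move[OF F])
  also have "\<dots> = SW h (\<lambda>m q. SW m (\<lambda>a p. SW (p \<odot> k) (\<lambda>c d. F (d # T c # a # x) (q # y))))"
    by (simp add: right_nested)
  also have "\<dots> = SW h (\<lambda>m q. SW k (\<lambda>c d. F (m # d # T c # x) (q # y)))"
    using cop.par_form_letter_E[OF par_form_cop[OF form_left], of k "[]"] by simp
  also have "\<dots> = SW k (\<lambda>c d. SW h (\<lambda>a b. F (a # d # T c # x) (b # y)))"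
    by (rule SW_swap)
  finally show "SW k (\<lambda>c d. SW h (\<lambda>a b. F (a # d # T c # x) (b # y)))
      = SW k (\<lambda>c d. SW h (\<lambda>a b. F (a # x) (b # c # S d # y)))" ..
qed

lemma left_balanced_SW_word_left:
  "left_balanced F \<Longrightarrow> left_balanced (\<lambda>x y. SW_word w (\<lambda>p q. F (p @ x) (q @ y)))"
proof (induction w arbitrary: F)
  case (Cons h w)
  from Cons.IH[OF left_balanced_SW[OF Cons.prems, of h]] show ?case
    by (simp add: SW_SW_word_swap)
qed simp

lemma left_balanced_SW_word_right:
  "left_balanced F \<Longrightarrow> left_balanced (\<lambda>x y. SW_word w (\<lambda>r s. F (x @ r) (y @ s)))"
  by (intro left_balanced_SW_word left_balanced_append_right)

lemma left_balanced_context: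
  assumes "left_balanced F"
  shows "left_balanced (\<lambda>x y. SW_word u (\<lambda>p q. SW_word v (\<lambda>r s. F (p @ x @ r) (q @ y @ s))))"
  using left_balanced_SW_word_left[OF left_balanced_SW_word_right[OF assms, of v], of u] by simp

section \<open>The coproduct is well defined\<close>

text \<open>$\Delta_l(E_k) = E_k \otimes 1$, with an arbitrary further dependence on $k$ in the first factor.\<close>

lemma left_balanced_absorb_E:
  assumes F: "left_balanced F" and w: "linear_in_letter w"
  shows "SW4 k (\<lambda>a b c d. F (a # w d) (b # S c # y)) = SW k (\<lambda>a b. F (a # w b) y)"
proof -
  note [simp] = left_balanced_linear[OF F] linear_in_letter_comp[OF w]
  have "SW4 k (\<lambda>a b c d. F (a # w d) (b # S c # y))
      = SW3 k (\<lambda>a m d. SW m (\<lambda>b c. F (a # w d) (b # S c # y)))"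
    by (simp add: right_nested)
  also have "\<dots> = SW3 k (\<lambda>a m d. SW m (\<lambda>b c. F (c # T b # a # w d) y))"
    by (simp add: left_balanced_move[OF F])
  also have "\<dots> = SW k (\<lambda>r d. SW r (\<lambda>m c. SW m (\<lambda>a b. F (c # T b # a # w d) y)))"
    by (simp add: right_nested)
  also have "\<dots> = SW k (\<lambda>r d. F (r # w d) y)"
    using cop.par_form_triple[OF par_form_cop[OF left_balanced_par_form_left[OF F]], of "[]", symmetric]
    by simp
  finally show ?thesis .
qed

lemma left_balanced_one:
  assumes F: "left_balanced F"
  shows "SW one (\<lambda>a b. F [a] [b]) = F [] []"
proof -
  note [simp] = left_balanced_linear[OF F]
  note form_left = left_balanced_par_form_left[OF F] and form_right = left_balanced_par_form_right[OF F]
  have "SW one (\<lambda>a b. F [a] [b]) = SW one (\<lambda>a b. F [T b \<odot> a] [])"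
  proof (rule SW_one_cong)
    fix a b assume b: "b \<in> H\<^sub>t"
    have "F [a] [b] = SW b (\<lambda>c d. F [a] [c, S d])"
      using par_form_E_Ht[OF form_right b, of _ "[]" "[]"] by simp
    also have "\<dots> = SW b (\<lambda>c d. F [d, T c, a] [])"
      by (simp add: left_balanced_move[OF F])
    also have "\<dots> = F [T b, a] []"
      using par_form_tE_Ht[OF form_left b, of "[]" "[a]"] by simp
    also have "\<dots> = F [T b \<odot> a] []"
      using par_form_Hs_mul[OF form_left T_Ht_in_Hs[OF b], of "[]"] by simp
    finally show "F [a] [b] = F [T b \<odot> a] []" .
  qed simp_all
  also have "\<dots> = F [one] []"
    using cop.SW_S_mul[of "\<lambda>z. F [z] []" one] by simp
  also have "\<dots> = F [] []"
    using par_form_one[OF form_left, of "[]" "[]"] by simp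
  finally show ?thesis .
qed

text \<open>The coproducts of $[h]E_k$ and of $[h k_1][S(k_2)]$ are both $[h_1 k_1][S(k_2)] \otimes [h_2]$; in the
  latter the first factor arises as $t(E_{h_2 k_2}) [h_1 k_1] [S(k_3)]$, where
  $t(E_{g_2}) [g_1] = [g]$.\<close>

lemma SW_word_letter_E_left:
  assumes F: "left_balanced F"
  shows "SW k (\<lambda>c d. SW_word [h, c, S d] F) = SW h (\<lambda>a b. SW k (\<lambda>c d. F [a \<odot> c, S d] [b]))"
proof -
  note [simp] = left_balanced_linear[OF F] left_balanced_linear[OF left_balanced_SW[OF F]]
  have "SW k (\<lambda>c d. SW_word [h, c, S d] F)
      = SW k (\<lambda>c d. SW c (\<lambda>p q. SW d (\<lambda>r s. SW h (\<lambda>a b. F [a, p, S s] [b, q, S r]))))"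
    by (simp add: SW_S) (intro SW_cong SW_swap_pair)
  also have "\<dots> = SW k (\<lambda>c d. SW d (\<lambda>r s. SW c (\<lambda>p q. SW h (\<lambda>a b. F [a, p, S s] [b, q, S r]))))"
    by (intro SW_cong SW_swap)
  also have "\<dots> = SW4 k (\<lambda>p q r s. SW h (\<lambda>a b. F [a, p, S s] [b, q, S r]))"
    by (simp add: right_nested)
  also have "\<dots> = SW k (\<lambda>c d. SW h (\<lambda>a b. F [a, c, S d] [b]))"
    by (rule left_balanced_absorb_E[OF left_balanced_SW[OF F], where w = "\<lambda>d. [S d]" and y = "[]"]) simp
  also have "\<dots> = SW h (\<lambda>a b. SW k (\<lambda>c d. F [a, c, S d] [b]))"
    by (rule SW_swap)
  also have "\<dots> = SW h (\<lambda>a b. SW k (\<lambda>c d. F [a \<odot> c, S d] [b]))"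
    using par_form_left_E[OF left_balanced_par_form_left[OF F], of k "[]"] by simp
  finally show ?thesis .
qed

lemma SW_word_mul_E_left:
  assumes F: "left_balanced F"
  shows "SW k (\<lambda>c d. SW_word [h \<odot> c, S d] F) = SW h (\<lambda>a b. SW k (\<lambda>c d. F [a \<odot> c, S d] [b]))"
proof -
  note [simp] = left_balanced_linear[OF F]
  note form_left = left_balanced_par_form_left[OF F] and form_right = left_balanced_par_form_right[OF F]
  have "SW k (\<lambda>c d. SW_word [h \<odot> c, S d] F)
      = SW k (\<lambda>c d. SW h (\<lambda>a b. SW c (\<lambda>p q. SW d (\<lambda>r s. F [a \<odot> p, S s] [b \<odot> q, S r]))))"
    by (simp add: SW_S SW_mul)
  also have "\<dots> = SW h (\<lambda>a b. SW k (\<lambda>c d. SW d (\<lambda>r s. SW c (\<lambda>p q. F [a \<odot> p, S s] [b \<odot> q, S r]))))"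
    by (subst SW_swap) (intro SW_cong SW_swap)
  also have "\<dots> = SW h (\<lambda>a b. SW3 k (\<lambda>p m s. SW m (\<lambda>q r. F [a \<odot> p, S s] [b \<odot> q, S r])))"
    by (simp add: right_nested)
  also have "\<dots> = SW h (\<lambda>a b. SW3 k (\<lambda>p m s. SW b (\<lambda>x y. SW (x \<odot> m) (\<lambda>q r. F [a \<odot> p, S s] [q, S r, y]))))"
    using par_form_left_E[OF form_right, of _ _ "[]"] par_form_letter_E[OF form_right, of _ _ "[]"]
    by simp
  also have "\<dots> = SW h (\<lambda>a b. SW3 k (\<lambda>p m s. SW b (\<lambda>x y. SW (x \<odot> m) (\<lambda>q r. F [r, T q, a \<odot> p, S s] [y]))))"
    by (simp add: left_balanced_move[OF F])
  also have "\<dots> = SW h (\<lambda>a b. SW k (\<lambda>n s. SW n (\<lambda>p m. SW b (\<lambda>x y. SW (x \<odot> m) (\<lambda>q r. F [r, T q, a \<odot> p, S s] [y])))))"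
    by (simp add: right_nested)
  also have "\<dots> = SW h (\<lambda>a b. SW b (\<lambda>x y. SW k (\<lambda>n s. SW n (\<lambda>p m. SW (x \<odot> m) (\<lambda>q r. F [r, T q, a \<odot> p, S s] [y])))))"
    by (intro SW_cong SW_swap_pair[symmetric])
  also have "\<dots> = SW h (\<lambda>z y. SW z (\<lambda>a x. SW k (\<lambda>n s. SW n (\<lambda>p m. SW (x \<odot> m) (\<lambda>q r. F [r, T q, a \<odot> p, S s] [y])))))"
    by (simp add: right_nested)
  also have "\<dots> = SW h (\<lambda>z y. SW k (\<lambda>n s. SW (z \<odot> n) (\<lambda>e f. SW f (\<lambda>q r. F [r, T q, e, S s] [y]))))"
    by (subst SW_swap) (simp add: SW_mul)
  also have "\<dots> = SW h (\<lambda>a b. SW k (\<lambda>c d. F [a \<odot> c, S d] [b]))"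
  proof (intro SW_cong)
    show "SW z (\<lambda>e f. SW f (\<lambda>q r. F [r, T q, e, S s] [y])) = F [z, S s] [y]" for z s y
      using cop.par_form_triple[OF par_form_cop[OF form_left], of "[]" z "[S s]" "[y]", symmetric]
      by (simp add: right_nested)
  qed
  finally show ?thesis .
qed

lemma SW_word_E_letter:
  assumes F: "left_balanced F"
  shows "SW h (\<lambda>c d. SW_word [c, S d, k] F) = SW k (\<lambda>e f. SW h (\<lambda>a b. F [a, S b, e] [f]))"
proof -
  note [simp] = left_balanced_linear[OF F]
  have "SW h (\<lambda>c d. SW_word [c, S d, k] F)
      = SW h (\<lambda>c d. SW d (\<lambda>r s. SW c (\<lambda>p q. SW k (\<lambda>e f. F [p, S s, e] [q, S r, f]))))"
    by (subst SW_swap) (simp add: SW_S)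
  also have "\<dots> = SW4 h (\<lambda>p q r s. SW k (\<lambda>e f. F [p, S s, e] [q, S r, f]))"
    by (simp add: right_nested)
  also have "\<dots> = SW k (\<lambda>e f. SW4 h (\<lambda>p q r s. F [p, S s, e] [q, S r, f]))"
    by (simp only: SW_swap[of _ k])
  also have "\<dots> = SW k (\<lambda>e f. SW h (\<lambda>a b. F [a, S b, e] [f]))"
    by (simp add: left_balanced_absorb_E[OF F, where w = "\<lambda>d. [S d, _]"])
  finally show ?thesis .
qed

lemma SW_word_E_mul:
  assumes F: "left_balanced F"
  shows "SW h (\<lambda>c d. SW_word [c, S d \<odot> k] F) = SW k (\<lambda>e f. SW h (\<lambda>a b. F [a, S b, e] [f]))"
proof -
  note [simp] = left_balanced_linear[OF F]
  have "SW h (\<lambda>c d. SW_word [c, S d \<odot> k] F)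
      = SW h (\<lambda>c d. SW d (\<lambda>r s. SW c (\<lambda>p q. SW k (\<lambda>e f. F [p, S s \<odot> e] [q, S r \<odot> f]))))"
    by (subst SW_swap) (simp add: SW_S SW_mul)
  also have "\<dots> = SW3 h (\<lambda>p m s. SW m (\<lambda>q r. SW k (\<lambda>e f. F [p, S s \<odot> e] [q, S r \<odot> f])))"
    by (simp add: right_nested)
  also have "\<dots> = SW k (\<lambda>e f. SW3 h (\<lambda>p m s. SW m (\<lambda>q r. F [p, S s \<odot> e] [q, S r \<odot> f])))"
    by (simp only: SW_swap[of _ k])
  also have "\<dots> = SW k (\<lambda>e f. SW3 h (\<lambda>p m s. SW m (\<lambda>q r. F [p, S s \<odot> e] [q, S r, f])))"
    using par_form_E_right[OF left_balanced_par_form_right[OF F], of _ _ "[]"] by simp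
  also have "\<dots> = SW k (\<lambda>e f. SW4 h (\<lambda>p q r s. F [p, S s \<odot> e] [q, S r, f]))"
    by (simp add: right_nested)
  also have "\<dots> = SW k (\<lambda>e f. SW h (\<lambda>a b. F [a, S b \<odot> e] [f]))"
    by (simp add: left_balanced_absorb_E[OF F, where w = "\<lambda>d. [S d \<odot> _]"])
  also have "\<dots> = SW k (\<lambda>e f. SW h (\<lambda>a b. F [a, S b, e] [f]))"
    using par_form_E_right[OF left_balanced_par_form_left[OF F], of _ "[]"] by simp
  finally show ?thesis .
qed

lemma SW_word_triple:
  assumes F: "left_balanced F"
  shows "SW_word [h] F = SW3 h (\<lambda>a b c. SW_word [a, S b, c] F)"
proof -
  note [simp] = left_balanced_linear[OF F]
    multilinear_form_linear[OF multilinear_form_SW_word[OF par_form_multilinear par_form_multilinear],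
      OF left_balanced_par_form_left[OF F] left_balanced_par_form_right[OF F]]
  have "SW3 h (\<lambda>a b c. SW_word [a, S b, c] F) = SW h (\<lambda>p c. SW p (\<lambda>a b. SW_word [a, S b, c] F))"
    by (rule SW_coassoc[symmetric]) (simp del: SW_word.simps)
  also have "\<dots> = SW h (\<lambda>p c. SW c (\<lambda>e f. SW p (\<lambda>a b. F [a, S b, e] [f])))"
    by (simp only: SW_word_E_letter[OF F])
  also have "\<dots> = SW h (\<lambda>m f. SW m (\<lambda>p e. SW p (\<lambda>a b. F [a, S b, e] [f])))"
    by (simp add: right_nested)
  also have "\<dots> = SW h (\<lambda>m f. SW3 m (\<lambda>a b c. F [a, S b, c] [f]))"
    by (simp add: right_nested)
  also have "\<dots> = SW h (\<lambda>m f. F [m] [f])"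
    by (simp add: par_form_triple[OF left_balanced_par_form_left[OF F], of "[]" _ "[]", simplified, symmetric])
  finally show ?thesis
    by (simp only: SW_word.simps)
qed

lemma left_balanced_multilinear_SW_word: "left_balanced F \<Longrightarrow> multilinear_form (\<lambda>w. SW_word w F)"
  by (intro multilinear_form_SW_word par_form_multilinear left_balancedD)

lemma SW_word_left_E:
  assumes F: "left_balanced F"
  shows "SW k (\<lambda>a b. SW_word (u @ h # a # S b # v) F) = SW k (\<lambda>a b. SW_word (u @ (h \<odot> a) # S b # v) F)"
proof -
  note G = left_balanced_context[OF F, of u v]
  show ?thesis
    using trans[OF SW_word_letter_E_left[OF G, of k h] SW_word_mul_E_left[OF G, of k h, symmetric]]
    by (simp only: SW_word_context[of u _ v F, symmetric] append_Cons append_Nil)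
qed

lemma SW_word_E_right:
  assumes F: "left_balanced F"
  shows "SW h (\<lambda>a b. SW_word (u @ a # S b # k # v) F) = SW h (\<lambda>a b. SW_word (u @ a # (S b \<odot> k) # v) F)"
proof -
  note G = left_balanced_context[OF F, of u v]
  show ?thesis
    using trans[OF SW_word_E_letter[OF G, of h k] SW_word_E_mul[OF G, of h k, symmetric]]
    by (simp only: SW_word_context[of u _ v F, symmetric] append_Cons append_Nil)
qed

end

context invertible_weak_hopf_algebra
begin

interpretation cop: invertible_weak_hopf_algebra sc mul one "\<lambda>h F. SW h (\<lambda>a b. F b a)" \<epsilon> T S
  by (rule invertible_weak_hopf_algebra_cop)

text \<open>The relations with \<open>S\<close> on the first letter follow from the others for $H^{cop}$.\<close>

lemma par_form_Delta_l:
  assumes F: "left_balanced F"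
  shows "par_form (\<lambda>w. SW_word w F)"
proof (rule par_formI[OF left_balanced_multilinear_SW_word[OF F]])
  note [simp] = multilinear_form_linear[OF left_balanced_multilinear_SW_word[OF F]]
  fix u v h k
  note G = left_balanced_context[OF F, of u v]
  show "SW_word (u @ one # v) F = SW_word (u @ v) F"
    using left_balanced_one[OF G] SW_word_context[of u "[one]" v F] SW_word_context[of u "[]" v F]
    by simp
  show "SW k (\<lambda>a b. SW_word (u @ h # S a # b # v) F) = SW k (\<lambda>a b. SW_word (u @ (h \<odot> S a) # b # v) F)"
    using cop.SW_word_left_E[OF left_balanced_cop[OF F], of "S k" u h v] by (simp add: cop_SW_word SW_S)
  show "SW h (\<lambda>a b. SW_word (u @ S a # b # k # v) F) = SW h (\<lambda>a b. SW_word (u @ S a # (b \<odot> k) # v) F)"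
    using cop.SW_word_E_right[OF left_balanced_cop[OF F], of "S h" u k v] by (simp add: cop_SW_word SW_S)
  show "SW_word (u @ h # v) F = SW3 h (\<lambda>a b c. SW_word (u @ a # S b # c # v) F)"
    using SW_word_triple[OF G, of h]
    by (simp only: SW_word_context[of u _ v F, symmetric] append_Cons append_Nil)
qed (rule SW_word_left_E[OF F] SW_word_E_right[OF F])+

end

context invertible_weak_hopf_algebra
begin

lemma par_form_Delta_r: "right_balanced F \<Longrightarrow> par_form (\<lambda>w. SW_word w F)"
  using par_form_unrev[OF opcop.par_form_Delta_l[OF right_balanced_rev]] by (simp add: opcop_SW_word_rev)

end

section \<open>The base algebras\<close>

text \<open>Elements of the free algebra are represented by the evaluation operators they induce on
  functions of words.\<close>

inductive_set generated_algebra :: "(('h list \<Rightarrow> 'k::field) \<Rightarrow> 'k) set \<Rightarrow> (('h list \<Rightarrow> 'k) \<Rightarrow> 'k) set"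
  for G where
  generated_algebra_unit: "(\<lambda>\<phi>. c * \<phi> []) \<in> generated_algebra G"
| generated_algebra_generator: "g \<in> G \<Longrightarrow> g \<in> generated_algebra G"
| generated_algebra_add: "\<alpha> \<in> generated_algebra G \<Longrightarrow> \<beta> \<in> generated_algebra G
    \<Longrightarrow> (\<lambda>\<phi>. \<alpha> \<phi> + \<beta> \<phi>) \<in> generated_algebra G"
| generated_algebra_mult: "\<alpha> \<in> generated_algebra G \<Longrightarrow> \<beta> \<in> generated_algebra G
    \<Longrightarrow> (\<lambda>\<phi>. \<alpha> (\<lambda>u. \<beta> (\<lambda>v. \<phi> (u @ v)))) \<in> generated_algebra G"

lemma generated_algebra_finitely_supported:
  assumes "\<alpha> \<in> generated_algebra G" "\<And>g. g \<in> G \<Longrightarrow> finitely_supported g"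
  shows "finitely_supported \<alpha>"
  using assms(1)
proof induction
  case (generated_algebra_mult \<alpha> \<beta>)
  then show ?case using finitely_supported_bind[of \<alpha> "\<lambda>_. \<beta>" "(@)"] by simp
qed (auto intro: finitely_supported_point finitely_supported_add assms(2))

lemma generated_algebra_scale:
  assumes "\<alpha> \<in> generated_algebra G"
  shows "(\<lambda>\<phi>. c * \<alpha> \<phi>) \<in> generated_algebra G"
  using generated_algebra_mult[OF generated_algebra_unit[of c] assms] by simp

lemma generated_algebra_sum:
  assumes \<Theta>: "finitely_supported \<Theta>" and \<alpha>: "\<And>z. \<alpha> z \<in> generated_algebra G"
  shows "(\<lambda>\<phi>. \<Theta> (\<lambda>z. \<alpha> z \<phi>)) \<in> generated_algebra G"
proof -
  obtain p where p: "\<Theta> = (\<lambda>f. lin_ext f p)"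
    using \<Theta> by (auto simp: finitely_supported_def)
  have "(\<lambda>\<phi>. \<Sum>z\<in>I. Poly_Mapping.lookup p z * \<alpha> z \<phi>) \<in> generated_algebra G" if "finite I" for I
    using that
  proof induction
    case empty
    show ?case using generated_algebra_unit[of 0] by simp
  next
    case (insert x I)
    then show ?case
      using generated_algebra_add[OF generated_algebra_scale[OF \<alpha>[of x]] insert.IH] by simp
  qed
  from this[OF finite_keys] show ?thesis
    by (simp add: p lin_ext_def)
qed

lemma generated_algebra_antimap:
  assumes "\<alpha> \<in> generated_algebra G" and fin: "\<And>g. g \<in> G \<Longrightarrow> finitely_supported g"
    and gen: "\<And>g. g \<in> G \<Longrightarrow> (\<lambda>\<phi>. g (\<lambda>w. \<phi> (rev (map f w)))) \<in> generated_algebra G'"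
  shows "(\<lambda>\<phi>. \<alpha> (\<lambda>w. \<phi> (rev (map f w)))) \<in> generated_algebra G'"
  using assms(1)
proof induction
  case (generated_algebra_mult \<alpha> \<beta>)
  note fins = generated_algebra_finitely_supported[OF generated_algebra_mult.hyps(1) fin]
    generated_algebra_finitely_supported[OF generated_algebra_mult.hyps(2) fin]
  from generated_algebra.generated_algebra_mult[OF generated_algebra_mult.IH(2,1)] show ?case
    by (simp add: finitely_supported_swap[OF fins])
qed (auto intro: generated_algebra.intros gen)

lemma generated_algebra_rev:
  assumes "\<alpha> \<in> generated_algebra G" and "\<And>g. g \<in> G \<Longrightarrow> finitely_supported g"
    and "\<And>g. g \<in> G \<Longrightarrow> (\<lambda>\<phi>. g (\<lambda>w. \<phi> (rev w))) \<in> generated_algebra G'"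
  shows "(\<lambda>\<phi>. \<alpha> (\<lambda>w. \<phi> (rev w))) \<in> generated_algebra G'"
  using generated_algebra_antimap[OF assms(1,2), of "\<lambda>x. x" G'] assms(3) by simp

context weak_hopf_algebra
begin

definition A_ops :: "(('h list \<Rightarrow> 'k) \<Rightarrow> 'k) set" where
  "A_ops = generated_algebra (range (\<lambda>h \<phi>. SW h (\<lambda>a b. \<phi> [a, S b])))"

definition At_ops :: "(('h list \<Rightarrow> 'k) \<Rightarrow> 'k) set" where
  "At_ops = generated_algebra (range (\<lambda>h \<phi>. SW h (\<lambda>a b. \<phi> [S a, b])))"

lemma A_ops_E: "(\<lambda>\<phi>. SW h (\<lambda>a b. \<phi> [a, S b])) \<in> A_ops"
  unfolding A_ops_def by (rule generated_algebra_generator) auto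

lemma At_ops_Et: "(\<lambda>\<phi>. SW h (\<lambda>a b. \<phi> [S a, b])) \<in> At_ops"
  unfolding At_ops_def by (rule generated_algebra_generator) auto

lemma A_ops_finitely_supported: "\<alpha> \<in> A_ops \<Longrightarrow> finitely_supported \<alpha>"
  unfolding A_ops_def
  by (erule generated_algebra_finitely_supported) (auto intro: finitely_supported_SW_map)

lemma generated_algebra_par_cong:
  assumes "\<alpha> \<in> generated_algebra G" and fin: "\<And>g. g \<in> G \<Longrightarrow> finitely_supported g"
    and gen: "\<And>g. g \<in> G \<Longrightarrow> \<exists>\<beta>\<in>generated_algebra G'. \<forall>\<phi>. par_form \<phi> \<longrightarrow> \<beta> \<phi> = g \<phi>"
  shows "\<exists>\<beta>\<in>generated_algebra G'. \<forall>\<phi>. par_form \<phi> \<longrightarrow> \<beta> \<phi> = \<alpha> \<phi>"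
  using assms(1)
proof induction
  case (generated_algebra_unit c)
  show ?case by (intro bexI[OF _ generated_algebra.generated_algebra_unit[of c]]) simp
next
  case (generated_algebra_generator g)
  then show ?case by (rule gen)
next
  case (generated_algebra_add \<alpha> \<beta>)
  then obtain \<alpha>' \<beta>' where "\<alpha>' \<in> generated_algebra G'" "\<forall>\<phi>. par_form \<phi> \<longrightarrow> \<alpha>' \<phi> = \<alpha> \<phi>"
    "\<beta>' \<in> generated_algebra G'" "\<forall>\<phi>. par_form \<phi> \<longrightarrow> \<beta>' \<phi> = \<beta> \<phi>" by blast
  then show ?case
    by (intro bexI[OF _ generated_algebra.generated_algebra_add[of \<alpha>' G' \<beta>']]) auto
next
  case (generated_algebra_mult \<alpha> \<beta>)
  then obtain \<alpha>' \<beta>' where \<alpha>': "\<alpha>' \<in> generated_algebra G'" "\<And>\<phi>. par_form \<phi> \<Longrightarrow> \<alpha>' \<phi> = \<alpha> \<phi>"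
    and \<beta>': "\<beta>' \<in> generated_algebra G'" "\<And>\<phi>. par_form \<phi> \<Longrightarrow> \<beta>' \<phi> = \<beta> \<phi>" by metis
  note fin_\<beta> = generated_algebra_finitely_supported[OF generated_algebra_mult.hyps(2) fin]
  have "\<alpha>' (\<lambda>u. \<beta>' (\<lambda>v. \<phi> (u @ v))) = \<alpha> (\<lambda>u. \<beta> (\<lambda>v. \<phi> (u @ v)))" if \<phi>: "par_form \<phi>" for \<phi>
    by (simp add: \<beta>'(2)[OF par_form_append_left[OF \<phi>]]
        \<alpha>'(2)[OF par_form_finitely_supported[OF fin_\<beta> par_form_append_right[OF \<phi>]]])
  then show ?case
    by (intro bexI[OF _ generated_algebra.generated_algebra_mult[OF \<alpha>'(1) \<beta>'(1)]]) simp
qed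

lemma A_ops_coalgebra_antimap:
  assumes \<alpha>: "\<alpha> \<in> A_ops" and f: "linear_endo f"
    and anti: "\<And>F h. bilinear_form F \<Longrightarrow> SW (f h) F = SW h (\<lambda>a b. F (f b) (f a))"
    and fS: "\<And>x. f (S x) = S (f x)"
  shows "\<exists>\<beta>\<in>At_ops. \<forall>\<phi>. par_form \<phi> \<longrightarrow> \<beta> \<phi> = \<alpha> (\<lambda>w. \<phi> (rev (map f w)))"
  unfolding At_ops_def
proof (rule generated_algebra_par_cong)
  let ?G = "range (\<lambda>h (\<phi> :: 'h list \<Rightarrow> 'k). SW h (\<lambda>a b. \<phi> [f (S b), f a]))"
  show "(\<lambda>\<phi>. \<alpha> (\<lambda>w. \<phi> (rev (map f w)))) \<in> generated_algebra ?G"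
    using \<alpha> unfolding A_ops_def
    by (rule generated_algebra_antimap)
      (auto intro: finitely_supported_SW_map generated_algebra_generator)
  fix g assume "g \<in> ?G"
  then obtain h where g: "g = (\<lambda>\<phi>. SW h (\<lambda>a b. \<phi> [f (S b), f a]))" by auto
  show "finitely_supported g"
    unfolding g by (rule finitely_supported_SW_map)
  have "SW (f h) (\<lambda>a b. \<phi> [S a, b]) = g \<phi>" if "par_form \<phi>" for \<phi>
  proof -
    note [simp] = par_form_linear[OF that]
    show ?thesis by (simp add: g anti fS)
  qed
  then show "\<exists>\<beta>\<in>generated_algebra (range (\<lambda>h \<phi>. SW h (\<lambda>a b. \<phi> [S a, b]))). \<forall>\<phi>. par_form \<phi> \<longrightarrow> \<beta> \<phi> = g \<phi>"
    by (intro bexI[OF _ At_ops_Et[of "f h", unfolded At_ops_def]]) simp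
qed

end

context weak_hopf_algebra
begin

lemma At_ops_rev: "\<beta> \<in> At_ops \<Longrightarrow> (\<lambda>\<phi>. \<beta> (\<lambda>w. \<phi> (rev w))) \<in> opcop.A_ops"
  unfolding opcop.A_ops_def At_ops_def
  by (erule generated_algebra_rev) (auto intro!: finitely_supported_SW_map generated_algebra_generator)

lemma A_ops_rev: "\<alpha> \<in> A_ops \<Longrightarrow> (\<lambda>\<phi>. \<alpha> (\<lambda>w. \<phi> (rev w))) \<in> opcop.At_ops"
  unfolding opcop.At_ops_def A_ops_def
  by (erule generated_algebra_rev) (auto intro!: finitely_supported_SW_map generated_algebra_generator)

end

context weak_hopf_algebra
begin

lemma At_ops_unrev: "\<beta> \<in> opcop.A_ops \<Longrightarrow> (\<lambda>\<phi>. \<beta> (\<lambda>w. \<phi> (rev w))) \<in> At_ops"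
  by (rule opcop.A_ops_rev)

lemma A_ops_unrev: "\<alpha> \<in> opcop.At_ops \<Longrightarrow> (\<lambda>\<phi>. \<alpha> (\<lambda>w. \<phi> (rev w))) \<in> A_ops"
  by (rule opcop.At_ops_rev)

lemma At_ops_finitely_supported:
  assumes "\<beta> \<in> At_ops"
  shows "finitely_supported \<beta>"
  using finitely_supported_map[OF opcop.A_ops_finitely_supported[OF At_ops_rev[OF assms]], of rev]
  by simp

lemma At_ops_coalgebra_antimap:
  assumes \<beta>: "\<beta> \<in> At_ops" and f: "linear_endo f"
    and anti: "\<And>F h. bilinear_form F \<Longrightarrow> SW (f h) F = SW h (\<lambda>a b. F (f b) (f a))"
    and fS: "\<And>x. f (S x) = S (f x)"
  shows "\<exists>\<alpha>\<in>A_ops. \<forall>\<phi>. par_form \<phi> \<longrightarrow> \<alpha> \<phi> = \<beta> (\<lambda>w. \<phi> (rev (map f w)))"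
proof -
  have "SW (f h) (\<lambda>a b. F b a) = SW h (\<lambda>b a. F (f b) (f a))" if "bilinear_form F" for F h
    using anti[of "\<lambda>a b. F b a" h] that by simp
  from opcop.A_ops_coalgebra_antimap[OF At_ops_rev[OF \<beta>] f this fS] obtain \<alpha>
    where \<alpha>: "\<alpha> \<in> opcop.At_ops" "\<And>\<phi>. opcop.par_form \<phi> \<Longrightarrow> \<alpha> \<phi> = \<beta> (\<lambda>w. \<phi> (rev (map f (rev w))))"
    by blast
  show ?thesis
  proof (rule bexI[OF _ A_ops_unrev[OF \<alpha>(1)]], intro allI impI)
    fix \<phi> assume "par_form \<phi>"
    from \<alpha>(2)[OF par_form_rev[OF this]] show "\<alpha> (\<lambda>w. \<phi> (rev w)) = \<beta> (\<lambda>w. \<phi> (rev (map f w)))"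
      by (simp add: rev_map)
  qed
qed

definition ops_commute :: "(('h list \<Rightarrow> 'k) \<Rightarrow> 'k) \<Rightarrow> (('h list \<Rightarrow> 'k) \<Rightarrow> 'k) \<Rightarrow> bool" where
  "ops_commute \<alpha> \<beta> \<longleftrightarrow>
    (\<forall>\<phi>. par_form \<phi> \<longrightarrow> \<alpha> (\<lambda>u. \<beta> (\<lambda>v. \<phi> (u @ v))) = \<alpha> (\<lambda>u. \<beta> (\<lambda>v. \<phi> (v @ u))))"

lemma ops_commuteD:
  "ops_commute \<alpha> \<beta> \<Longrightarrow> par_form \<phi> \<Longrightarrow> \<alpha> (\<lambda>u. \<beta> (\<lambda>v. \<phi> (u @ v))) = \<alpha> (\<lambda>u. \<beta> (\<lambda>v. \<phi> (v @ u)))"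
  by (simp add: ops_commute_def)

lemma ops_commute_sym:
  "finitely_supported \<alpha> \<Longrightarrow> finitely_supported \<beta> \<Longrightarrow> ops_commute \<alpha> \<beta> \<Longrightarrow> ops_commute \<beta> \<alpha>"
  unfolding ops_commute_def by (simp add: finitely_supported_swap[of \<beta> \<alpha>])

lemma ops_commute_generated_algebra:
  assumes "\<beta> \<in> generated_algebra G" and \<alpha>: "finitely_supported \<alpha>"
    and G: "\<And>g. g \<in> G \<Longrightarrow> finitely_supported g" "\<And>g. g \<in> G \<Longrightarrow> ops_commute \<alpha> g"
  shows "ops_commute \<alpha> \<beta>"
  using assms(1)
proof induction
  case (generated_algebra_unit c)
  show ?case by (simp add: ops_commute_def finitely_supported_fun_scale[OF \<alpha>])
next
  case (generated_algebra_generator g)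
  then show ?case by (rule G(2))
next
  case (generated_algebra_add \<beta> \<gamma>)
  then show ?case by (simp add: ops_commute_def finitely_supported_fun_add[OF \<alpha>])
next
  case (generated_algebra_mult \<beta> \<gamma>)
  note fin = generated_algebra_finitely_supported[OF _ G(1)]
  note \<beta> = fin[OF generated_algebra_mult.hyps(1)] and \<gamma> = fin[OF generated_algebra_mult.hyps(2)]
  show ?case
    unfolding ops_commute_def
  proof (intro allI impI)
    fix \<phi> assume \<phi>: "par_form \<phi>"
    have "\<alpha> (\<lambda>u. \<beta> (\<lambda>v. \<gamma> (\<lambda>w. \<phi> (u @ v @ w)))) = \<gamma> (\<lambda>w. \<alpha> (\<lambda>u. \<beta> (\<lambda>v. \<phi> ((u @ v) @ w))))"
      by (simp add: finitely_supported_swap[OF \<beta> \<gamma>] finitely_supported_swap[OF \<alpha> \<gamma>])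
    also have "\<dots> = \<gamma> (\<lambda>w. \<alpha> (\<lambda>u. \<beta> (\<lambda>v. \<phi> ((v @ u) @ w))))"
      by (simp only: ops_commuteD[OF generated_algebra_mult.IH(1) par_form_append_right[OF \<phi>]])
    also have "\<dots> = \<beta> (\<lambda>v. \<alpha> (\<lambda>u. \<gamma> (\<lambda>w. \<phi> (v @ u @ w))))"
      by (simp add: finitely_supported_swap[OF \<alpha> \<gamma>] finitely_supported_swap[OF \<beta> \<alpha>]
          finitely_supported_swap[OF \<beta> \<gamma>])
    also have "\<dots> = \<beta> (\<lambda>v. \<alpha> (\<lambda>u. \<gamma> (\<lambda>w. \<phi> (v @ w @ u))))"
      by (simp only: ops_commuteD[OF generated_algebra_mult.IH(2) par_form_append_left[OF \<phi>]])
    also have "\<dots> = \<alpha> (\<lambda>u. \<beta> (\<lambda>v. \<gamma> (\<lambda>w. \<phi> ((v @ w) @ u))))"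
      by (simp add: finitely_supported_swap[OF \<beta> \<alpha>])
    finally show "\<alpha> (\<lambda>u. \<beta> (\<lambda>v. \<gamma> (\<lambda>w. \<phi> (u @ v @ w)))) = \<alpha> (\<lambda>u. \<beta> (\<lambda>v. \<gamma> (\<lambda>w. \<phi> ((v @ w) @ u))))" .
  qed
qed

end

context invertible_weak_hopf_algebra
begin

interpretation cop: invertible_weak_hopf_algebra sc mul one "\<lambda>h F. SW h (\<lambda>a b. F b a)" \<epsilon> T S
  by (rule invertible_weak_hopf_algebra_cop)

lemma A_ops_antipode: "\<alpha> \<in> A_ops \<Longrightarrow> \<exists>\<beta>\<in>At_ops. \<forall>\<phi>. par_form \<phi> \<longrightarrow> \<beta> \<phi> = \<alpha> (\<lambda>w. \<phi> (\<S> w))"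
  and At_ops_antipode: "\<alpha> \<in> At_ops \<Longrightarrow> \<exists>\<beta>\<in>A_ops. \<forall>\<phi>. par_form \<phi> \<longrightarrow> \<beta> \<phi> = \<alpha> (\<lambda>w. \<phi> (\<S> w))"
  by (erule A_ops_coalgebra_antimap[OF _ linear_S] At_ops_coalgebra_antimap[OF _ linear_S]; simp add: SW_S)+

lemma A_ops_inverse_antipode: "\<alpha> \<in> A_ops \<Longrightarrow> \<exists>\<beta>\<in>At_ops. \<forall>\<phi>. par_form \<phi> \<longrightarrow> \<beta> \<phi> = \<alpha> (\<lambda>w. \<phi> (\<S>' w))"
  and At_ops_inverse_antipode: "\<alpha> \<in> At_ops \<Longrightarrow> \<exists>\<beta>\<in>A_ops. \<forall>\<phi>. par_form \<phi> \<longrightarrow> \<beta> \<phi> = \<alpha> (\<lambda>w. \<phi> (\<S>' w))"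
  by (erule A_ops_coalgebra_antimap[OF _ linear_T] At_ops_coalgebra_antimap[OF _ linear_T]; simp add: SW_T)+

lemma A_ops_At_ops_commute:
  assumes "\<alpha> \<in> A_ops" "\<beta> \<in> At_ops"
  shows "ops_commute \<alpha> \<beta>"
proof -
  have generators: "ops_commute (\<lambda>\<phi>. SW k (\<lambda>c d. \<phi> [S c, d])) (\<lambda>\<phi>. SW h (\<lambda>a b. \<phi> [a, S b]))" for h k
    unfolding ops_commute_def
  proof (intro allI impI)
    fix \<phi> assume "par_form \<phi>"
    from par_form_E_Et_commute[OF this, of h k "[]" "[]"]
    show "SW k (\<lambda>c d. SW h (\<lambda>a b. \<phi> ([S c, d] @ [a, S b])))
        = SW k (\<lambda>c d. SW h (\<lambda>a b. \<phi> ([a, S b] @ [S c, d])))"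
      by (subst (1 2) SW_swap) simp
  qed
  have "ops_commute (\<lambda>\<phi>. SW k (\<lambda>c d. \<phi> [S c, d])) \<alpha>" for k
    using assms(1) unfolding A_ops_def
    by (rule ops_commute_generated_algebra) (auto intro: finitely_supported_SW_map generators)
  then have commute_Et: "ops_commute \<alpha> (\<lambda>\<phi>. SW k (\<lambda>c d. \<phi> [S c, d]))" for k
    by (intro ops_commute_sym[OF finitely_supported_SW_map A_ops_finitely_supported[OF assms(1)]])
  show ?thesis
    using assms(2) A_ops_finitely_supported[OF assms(1)] unfolding At_ops_def
    by (rule ops_commute_generated_algebra) (auto intro: finitely_supported_SW_map commute_Et)
qed

lemma A_ops_tA_commute:
  assumes \<alpha>: "\<alpha> \<in> A_ops" and \<gamma>: "\<gamma> \<in> A_ops" and \<phi>: "par_form \<phi>"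
  shows "\<alpha> (\<lambda>u. \<gamma> (\<lambda>v. \<phi> (u @ \<S>' v))) = \<alpha> (\<lambda>u. \<gamma> (\<lambda>v. \<phi> (\<S>' v @ u)))"
proof -
  obtain \<beta> where \<beta>: "\<beta> \<in> At_ops" "\<And>\<phi>. par_form \<phi> \<Longrightarrow> \<beta> \<phi> = \<gamma> (\<lambda>w. \<phi> (\<S>' w))"
    using A_ops_inverse_antipode[OF \<gamma>] by blast
  from ops_commuteD[OF A_ops_At_ops_commute[OF \<alpha> \<beta>(1)] \<phi>] show ?thesis
    by (simp add: \<beta>(2) par_form_append_left[OF \<phi>] par_form_append_right[OF \<phi>])
qed

section \<open>The left coproduct on the base algebra\<close>

lemma left_balanced_move_A:
  assumes "\<alpha> \<in> A_ops" and F: "left_balanced F"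
  shows "\<alpha> (\<lambda>u. F (\<S>' u @ x) y) = \<alpha> (\<lambda>u. F x (u @ y))"
  using assms(1) unfolding A_ops_def
proof (induction arbitrary: x y)
  case (generated_algebra_generator g)
  then show ?case using left_balanced_move[OF F] by auto
next
  case (generated_algebra_mult \<alpha> \<beta>)
  note swap = finitely_supported_swap[OF A_ops_finitely_supported A_ops_finitely_supported,
      unfolded A_ops_def, OF generated_algebra_mult.hyps]
  have "\<alpha> (\<lambda>u. \<beta> (\<lambda>v. F (\<S>' (u @ v) @ x) y)) = \<alpha> (\<lambda>u. \<beta> (\<lambda>v. F (\<S>' u @ x) (v @ y)))"
    using generated_algebra_mult.IH(2) by simp
  also have "\<dots> = \<beta> (\<lambda>v. \<alpha> (\<lambda>u. F x (u @ v @ y)))"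
    by (simp add: swap generated_algebra_mult.IH(1))
  also have "\<dots> = \<alpha> (\<lambda>u. \<beta> (\<lambda>v. F x ((u @ v) @ y)))"
    by (simp add: swap)
  finally show ?case .
qed simp_all

lemma Takeuchi_l:
  assumes \<alpha>: "\<alpha> \<in> A_ops" and F: "left_balanced F"
  shows "\<alpha> (\<lambda>u. SW_word w (\<lambda>p q. F (p @ \<S>' u) q)) = \<alpha> (\<lambda>u. SW_word w (\<lambda>p q. F p (q @ u)))"
  using left_balanced_move_A[OF \<alpha> left_balanced_SW_word_left[OF F, of w], of "[]" "[]"] by simp

lemma left_balanced_A_left:
  assumes \<alpha>: "\<alpha> \<in> A_ops" and F: "left_balanced F"
  shows "left_balanced (\<lambda>x y. \<alpha> (\<lambda>u. F (u @ x) y))"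
  unfolding left_balanced_def
proof (intro conjI allI)
  note fin = A_ops_finitely_supported[OF \<alpha>]
  show "par_form (\<lambda>p. \<alpha> (\<lambda>u. F (u @ p) q))" for q
    by (intro par_form_finitely_supported[OF fin] par_form_append_left[where \<phi> = "\<lambda>p. F p q"]
        left_balanced_par_form_left[OF F])
  show "par_form (\<lambda>q. \<alpha> (\<lambda>u. F (u @ p) q))" for p
    by (intro par_form_finitely_supported[OF fin] left_balanced_par_form_right[OF F])
  fix h x y
  have "SW h (\<lambda>a b. \<alpha> (\<lambda>u. F (u @ b # T a # x) y)) = \<alpha> (\<lambda>u. SW h (\<lambda>a b. F ((u @ \<S>' [a, S b]) @ x) y))"
    by (simp add: SW_finitely_supported_swap[OF fin])
  also have "\<dots> = \<alpha> (\<lambda>u. SW h (\<lambda>a b. F ((\<S>' [a, S b] @ u) @ x) y))"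
    by (rule A_ops_tA_commute[OF \<alpha> A_ops_E, of "\<lambda>w. F (w @ x) y"])
      (rule par_form_append_right[OF left_balanced_par_form_left[OF F]])
  also have "\<dots> = \<alpha> (\<lambda>u. SW h (\<lambda>a b. F (u @ x) (a # S b # y)))"
    by (simp add: left_balanced_move[OF F])
  also have "\<dots> = SW h (\<lambda>a b. \<alpha> (\<lambda>u. F (u @ x) (a # S b # y)))"
    by (rule SW_finitely_supported_swap[OF fin, symmetric])
  finally show "SW h (\<lambda>a b. \<alpha> (\<lambda>u. F (u @ b # T a # x) y))
      = SW h (\<lambda>a b. \<alpha> (\<lambda>u. F (u @ x) (a # S b # y)))" .
qed

lemma Delta_l_E:
  assumes F: "left_balanced F"
  shows "SW h (\<lambda>a b. SW_word [a, S b] F) = SW h (\<lambda>a b. F [a, S b] [])"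
proof -
  note [simp] = left_balanced_linear[OF F]
  have "SW h (\<lambda>a b. SW_word [a, S b] F) = SW h (\<lambda>c d. SW d (\<lambda>r s. SW c (\<lambda>p q. F [p, S s] [q, S r])))"
    by (subst SW_swap) (simp add: SW_S)
  also have "\<dots> = SW4 h (\<lambda>p q r s. F [p, S s] [q, S r])"
    by (simp add: right_nested)
  also have "\<dots> = SW h (\<lambda>a b. F [a, S b] [])"
    by (simp add: left_balanced_absorb_E[OF F, where w = "\<lambda>d. [S d]"])
  finally show ?thesis .
qed

lemma Delta_l_A_mult:
  assumes \<alpha>: "\<alpha> \<in> A_ops" and F: "left_balanced F" and \<beta>: "finitely_supported \<beta>"
    and Delta_\<alpha>: "\<And>F. left_balanced F \<Longrightarrow> \<alpha> (\<lambda>w. SW_word w F) = \<alpha> (\<lambda>u. F u [])"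
  shows "\<alpha> (\<lambda>u. \<beta> (\<lambda>v. SW_word (u @ v) F)) = \<beta> (\<lambda>v. SW_word v (\<lambda>r s. \<alpha> (\<lambda>u. F (u @ r) s)))"
proof -
  note fin = A_ops_finitely_supported[OF \<alpha>]
  have "\<alpha> (\<lambda>u. \<beta> (\<lambda>v. SW_word (u @ v) F))
      = \<beta> (\<lambda>v. \<alpha> (\<lambda>u. SW_word u (\<lambda>p q. SW_word v (\<lambda>r s. F (p @ r) (q @ s)))))"
    by (simp add: finitely_supported_swap[OF fin \<beta>] SW_word_append)
  also have "\<dots> = \<beta> (\<lambda>v. \<alpha> (\<lambda>u. SW_word v (\<lambda>r s. F (u @ r) s)))"
    using Delta_\<alpha>[OF left_balanced_SW_word_right[OF F]] by simp
  also have "\<dots> = \<beta> (\<lambda>v. SW_word v (\<lambda>r s. \<alpha> (\<lambda>u. F (u @ r) s)))"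
    by (simp add: SW_word_finitely_supported_swap[OF fin])
  finally show ?thesis .
qed

lemma Delta_l_A:
  assumes "\<alpha> \<in> A_ops" and "left_balanced F"
  shows "\<alpha> (\<lambda>w. SW_word w F) = \<alpha> (\<lambda>u. F u [])"
  using assms unfolding A_ops_def
proof (induction arbitrary: F)
  case (generated_algebra_generator g)
  then show ?case using Delta_l_E by auto
next
  case (generated_algebra_mult \<alpha> \<beta>)
  note \<alpha> = generated_algebra_mult.hyps(1)[folded A_ops_def]
    and \<beta> = generated_algebra_mult.hyps(2)[folded A_ops_def]
  have "\<alpha> (\<lambda>u. \<beta> (\<lambda>v. SW_word (u @ v) F)) = \<beta> (\<lambda>v. SW_word v (\<lambda>r s. \<alpha> (\<lambda>u. F (u @ r) s)))"
    by (rule Delta_l_A_mult[OF \<alpha> generated_algebra_mult.prems A_ops_finitely_supported[OF \<beta>]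
          generated_algebra_mult.IH(1)])
  also have "\<dots> = \<beta> (\<lambda>v. \<alpha> (\<lambda>u. F (u @ v) []))"
    by (rule generated_algebra_mult.IH(2)[OF left_balanced_A_left[OF \<alpha> generated_algebra_mult.prems]])
  also have "\<dots> = \<alpha> (\<lambda>u. \<beta> (\<lambda>v. F (u @ v) []))"
    by (rule finitely_supported_swap[OF A_ops_finitely_supported[OF \<beta>] A_ops_finitely_supported[OF \<alpha>]])
  finally show ?case .
qed simp_all

lemma A_ops_cop: "\<gamma> \<in> A_ops \<Longrightarrow> (\<lambda>\<phi>. \<gamma> (\<lambda>v. \<phi> (\<S>' v))) \<in> cop.A_ops"
  unfolding A_ops_def cop.A_ops_def
  by (erule generated_algebra_antimap) (auto intro!: finitely_supported_SW_map generated_algebra_generator)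

end

context invertible_weak_hopf_algebra
begin

interpretation cop: invertible_weak_hopf_algebra sc mul one "\<lambda>h F. SW h (\<lambda>a b. F b a)" \<epsilon> T S
  by (rule invertible_weak_hopf_algebra_cop)

lemma Delta_l_tA:
  assumes \<gamma>: "\<gamma> \<in> A_ops" and F: "left_balanced F"
  shows "\<gamma> (\<lambda>v. SW_word (\<S>' v) F) = \<gamma> (\<lambda>v. F [] (\<S>' v))"
  using cop.Delta_l_A[OF A_ops_cop[OF \<gamma>] left_balanced_cop[OF F]] by (simp add: cop_SW_word)

lemma Delta_l_bimodule:
  assumes \<alpha>: "\<alpha> \<in> A_ops" and \<gamma>: "\<gamma> \<in> A_ops" and F: "left_balanced F"
  shows "\<alpha> (\<lambda>u. \<gamma> (\<lambda>v. SW_word ((u @ \<S>' v) @ w) F))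
       = \<alpha> (\<lambda>u. \<gamma> (\<lambda>v. SW_word w (\<lambda>r s. F (u @ r) (\<S>' v @ s))))"
proof -
  define H where "H = (\<lambda>x y. SW_word w (\<lambda>r s. F (x @ r) (y @ s)))"
  have H: "left_balanced H"
    unfolding H_def by (rule left_balanced_SW_word_right[OF F])
  have "\<alpha> (\<lambda>u. \<gamma> (\<lambda>v. SW_word ((u @ \<S>' v) @ w) F)) = \<alpha> (\<lambda>u. \<gamma> (\<lambda>v. SW_word (u @ \<S>' v) H))"
    by (simp only: H_def SW_word_append[of "_ @ _" w])
  also have "\<dots> = \<gamma> (\<lambda>v. SW_word (\<S>' v) (\<lambda>r s. \<alpha> (\<lambda>u. H (u @ r) s)))"
    by (rule Delta_l_A_mult[OF \<alpha> H, of "\<lambda>\<phi>. \<gamma> (\<lambda>v. \<phi> (\<S>' v))"])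
      (simp_all add: finitely_supported_map[OF A_ops_finitely_supported[OF \<gamma>]] Delta_l_A[OF \<alpha>])
  also have "\<dots> = \<gamma> (\<lambda>v. \<alpha> (\<lambda>u. H u (\<S>' v)))"
    using Delta_l_tA[OF \<gamma> left_balanced_A_left[OF \<alpha> H]] by simp
  also have "\<dots> = \<alpha> (\<lambda>u. \<gamma> (\<lambda>v. H u (\<S>' v)))"
    by (rule finitely_supported_swap[OF A_ops_finitely_supported[OF \<gamma>] A_ops_finitely_supported[OF \<alpha>]])
  finally show ?thesis
    by (simp add: H_def)
qed

end

section \<open>The right coproduct on the base algebras\<close>

context invertible_weak_hopf_algebra
begin

lemma right_balanced_antipode:
  assumes \<phi>: "par_form \<phi>"
  shows "right_balanced (\<lambda>x y. \<phi> (x @ \<S> y))"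
  unfolding right_balanced_def
  by (simp add: par_form_append_right[OF \<phi>] par_form_antipode[OF par_form_append_left[OF \<phi>]])

lemma right_balanced_append_left:
  assumes "right_balanced F"
  shows "right_balanced (\<lambda>x y. F (p @ x) (q @ y))"
  using right_balanced_unrev[OF opcop.left_balanced_append_right[OF right_balanced_rev[OF assms], of "rev p" "rev q"]]
  by simp

lemma right_balanced_SW_word_right:
  assumes "right_balanced F"
  shows "right_balanced (\<lambda>x y. SW_word w (\<lambda>r s. F (x @ r) (y @ s)))"
  using right_balanced_unrev[OF opcop.left_balanced_SW_word_left[OF right_balanced_rev[OF assms], of "rev w"]]
  by (simp add: opcop_SW_word SW_word_rev)

lemma Delta_r_At:
  assumes \<beta>: "\<beta> \<in> At_ops" and F: "right_balanced F"
  shows "\<beta> (\<lambda>w. SW_word w F) = \<beta> (\<lambda>u. F [] u)"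
  using opcop.Delta_l_A[OF At_ops_rev[OF \<beta>] right_balanced_rev[OF F]] by (simp add: opcop_SW_word_rev)

lemma Delta_r_A:
  assumes \<alpha>: "\<alpha> \<in> A_ops" and F: "right_balanced F"
  shows "\<alpha> (\<lambda>w. SW_word w F) = \<alpha> (\<lambda>u. F u [])"
proof -
  obtain \<beta> where \<beta>: "\<beta> \<in> At_ops" "\<And>\<phi>. par_form \<phi> \<Longrightarrow> \<beta> \<phi> = \<alpha> (\<lambda>w. \<phi> (\<S> w))"
    using A_ops_antipode[OF \<alpha>] by blast
  have "\<alpha> (\<lambda>w. SW_word w F) = \<beta> (\<lambda>w. SW_word (\<S>' w) F)"
    by (subst \<beta>(2)[OF par_form_inverse_antipode[OF par_form_Delta_r[OF F]]]) simp
  also have "\<dots> = \<beta> (\<lambda>u. F (\<S>' u) [])"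
    using opcop.Delta_l_tA[OF At_ops_rev[OF \<beta>(1)] right_balanced_rev[OF F]]
    by (simp add: opcop_SW_word_rev[symmetric] rev_map)
  also have "\<dots> = \<alpha> (\<lambda>u. F u [])"
    by (subst \<beta>(2)[OF par_form_inverse_antipode[OF right_balanced_par_form_left[OF F]]]) simp
  finally show ?thesis .
qed

lemma Delta_r_tA:
  assumes \<gamma>: "\<gamma> \<in> A_ops" and F: "right_balanced F"
  shows "\<gamma> (\<lambda>v. SW_word (\<S>' v) F) = \<gamma> (\<lambda>v. F [] (\<S>' v))"
proof -
  obtain \<beta> where \<beta>: "\<beta> \<in> At_ops" "\<And>\<phi>. par_form \<phi> \<Longrightarrow> \<beta> \<phi> = \<gamma> (\<lambda>w. \<phi> (\<S>' w))"
    using A_ops_inverse_antipode[OF \<gamma>] by blast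
  from Delta_r_At[OF \<beta>(1) F] show ?thesis
    by (simp only: \<beta>(2)[OF par_form_Delta_r[OF F]] \<beta>(2)[OF right_balanced_par_form_right[OF F]])
qed

lemma Delta_r_A_left:
  assumes \<alpha>: "\<alpha> \<in> A_ops" and F: "right_balanced F"
  shows "\<alpha> (\<lambda>u. SW_word (u @ w) F) = \<alpha> (\<lambda>u. SW_word w (\<lambda>r s. F (u @ r) s))"
  using Delta_r_A[OF \<alpha> right_balanced_SW_word_right[OF F, of w]] by (simp add: SW_word_append)

lemma Delta_r_tA_left:
  assumes \<gamma>: "\<gamma> \<in> A_ops" and F: "right_balanced F"
  shows "\<gamma> (\<lambda>v. SW_word (\<S>' v @ w) F) = \<gamma> (\<lambda>v. SW_word w (\<lambda>r s. F r (\<S>' v @ s)))"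
  using Delta_r_tA[OF \<gamma> right_balanced_SW_word_right[OF F, of w]] by (simp add: SW_word_append)

end

section \<open>The left counit\<close>

lemma merge_letters_induct [case_names Nil single merge]:
  assumes "P []" "\<And>h. P [h]" "\<And>h g u. P u \<Longrightarrow> (\<And>x. P (x # u)) \<Longrightarrow> P (h # g # u)"
  shows "P w"
proof (induction w rule: length_induct)
  case (1 w)
  then show ?case
    by (cases w; cases "tl w") (auto intro: assms)
qed

context weak_hopf_algebra
begin

fun eps_l :: "'h list \<Rightarrow> ('h list \<Rightarrow> 'k) \<Rightarrow> 'k" where
  "eps_l [] \<phi> = \<phi> []"
| "eps_l [h] \<phi> = SW h (\<lambda>a b. \<phi> [a, S b])"
| "eps_l (h # g # u) \<phi> = SW h (\<lambda>a b. SW a (\<lambda>c d. eps_l ((b \<odot> g) # u) (\<lambda>w. \<phi> (c # S d # w))))"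

lemma eps_l_in_A: "eps_l w \<in> A_ops"
proof (induction w rule: merge_letters_induct)
  case Nil
  show ?case
    unfolding A_ops_def using generated_algebra_unit[of 1] by (simp add: fun_eq_iff)
next
  case (single h)
  show ?case using A_ops_E[of h] by simp
next
  case (merge h g u)
  have "(\<lambda>\<phi>. SW a (\<lambda>c d. eps_l ((b \<odot> g) # u) (\<lambda>w. \<phi> (c # S d # w)))) \<in> A_ops" for a b
    using generated_algebra_mult[OF A_ops_E[unfolded A_ops_def], of "eps_l ((b \<odot> g) # u)" a] merge.IH(2)
    by (simp add: A_ops_def)
  then have "(\<lambda>\<phi>. SW h (\<lambda>a b. SW a (\<lambda>c d. eps_l ((b \<odot> g) # u) (\<lambda>w. \<phi> (c # S d # w))))) \<in> A_ops"
    unfolding A_ops_def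
    using generated_algebra_sum[OF finitely_supported_SW,
        of "\<lambda>(a, b) \<phi>. SW a (\<lambda>c d. eps_l ((b \<odot> g) # u) (\<lambda>w. \<phi> (c # S d # w)))"] by auto
  then show ?case by simp
qed

lemma eps_l_finitely_supported: "finitely_supported (eps_l w)"
  by (rule A_ops_finitely_supported[OF eps_l_in_A])

text \<open>The relation $[g_1][S(g_2)][k] = [g_1][S(g_2)k]$ persists with an element of the base algebra
  inserted after $[g_1]$, since $[g]E_m = E_{g_1 m}[g_2]$ moves it to the left.\<close>

definition E_right_insertable :: "(('h list \<Rightarrow> 'k) \<Rightarrow> 'k) \<Rightarrow> bool" where
  "E_right_insertable \<beta> \<longleftrightarrow> (\<forall>\<phi> g k. par_form \<phi> \<longrightarrow>
     SW g (\<lambda>a b. \<beta> (\<lambda>w. \<phi> (a # w @ [S b, k]))) = SW g (\<lambda>a b. \<beta> (\<lambda>w. \<phi> (a # w @ [S b \<odot> k]))))"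

lemma E_right_insertableD:
  "E_right_insertable \<beta> \<Longrightarrow> par_form \<phi> \<Longrightarrow>
    SW g (\<lambda>a b. \<beta> (\<lambda>w. \<phi> (a # w @ [S b, k]))) = SW g (\<lambda>a b. \<beta> (\<lambda>w. \<phi> (a # w @ [S b \<odot> k])))"
  by (simp add: E_right_insertable_def)

lemma par_form_letter_E_insert:
  assumes \<beta>: "finitely_supported \<beta>" and \<phi>: "par_form \<phi>" and z: "linear_in_letter z"
  shows "SW g (\<lambda>a b. SW m (\<lambda>c d. \<beta> (\<lambda>w. \<phi> (a # c # S d # w @ z b))))
       = SW g (\<lambda>x r. SW (x \<odot> m) (\<lambda>c d. SW r (\<lambda>y b. \<beta> (\<lambda>w. \<phi> (c # S d # y # w @ z b)))))"
proof -
  note [simp] = par_form_linear[OF \<phi>] linear_form_finitely_supported[OF \<beta>] z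
  have "SW g (\<lambda>a b. SW m (\<lambda>c d. \<beta> (\<lambda>w. \<phi> (a # c # S d # w @ z b))))
      = SW g (\<lambda>a b. \<beta> (\<lambda>w. SW m (\<lambda>c d. \<phi> (a # c # S d # w @ z b))))"
    by (simp add: SW_finitely_supported_swap[OF \<beta>])
  also have "\<dots> = SW g (\<lambda>a b. \<beta> (\<lambda>w. SW a (\<lambda>x y. SW (x \<odot> m) (\<lambda>c d. \<phi> (c # S d # y # w @ z b)))))"
    using par_form_letter_E[OF \<phi>, of m "[]"] by simp
  also have "\<dots> = SW g (\<lambda>a b. SW a (\<lambda>x y. SW (x \<odot> m) (\<lambda>c d. \<beta> (\<lambda>w. \<phi> (c # S d # y # w @ z b)))))"
    by (simp add: SW_finitely_supported_swap[OF \<beta>])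
  also have "\<dots> = SW g (\<lambda>x r. SW r (\<lambda>y b. SW (x \<odot> m) (\<lambda>c d. \<beta> (\<lambda>w. \<phi> (c # S d # y # w @ z b)))))"
    by (rule SW_coassoc) simp
  also have "\<dots> = SW g (\<lambda>x r. SW (x \<odot> m) (\<lambda>c d. SW r (\<lambda>y b. \<beta> (\<lambda>w. \<phi> (c # S d # y # w @ z b)))))"
    by (intro SW_cong SW_swap)
  finally show ?thesis .
qed

lemma E_right_insertable_mult:
  assumes "\<alpha> \<in> A_ops" and "finitely_supported \<beta>" and "E_right_insertable \<beta>"
  shows "E_right_insertable (\<lambda>\<phi>. \<alpha> (\<lambda>u. \<beta> (\<lambda>v. \<phi> (u @ v))))"
  using assms unfolding A_ops_def
proof (induction arbitrary: \<beta>)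
  case (generated_algebra_unit c)
  then show ?case by (simp add: E_right_insertable_def SW_scale)
next
  case (generated_algebra_add \<alpha> \<alpha>')
  then show ?case by (simp add: E_right_insertable_def SW_add)
next
  case (generated_algebra_mult \<alpha> \<alpha>')
  note fin = A_ops_finitely_supported[unfolded A_ops_def, OF generated_algebra_mult.hyps(2)]
  from generated_algebra_mult.IH(1)[OF finitely_supported_bind[OF fin generated_algebra_mult.prems(1), of "(@)"]
      generated_algebra_mult.IH(2)[OF generated_algebra_mult.prems]]
  show ?case by simp
next
  case (generated_algebra_generator f)
  then obtain m where f: "f = (\<lambda>\<phi>. SW m (\<lambda>a b. \<phi> [a, S b]))" by auto
  note \<beta> = \<open>finitely_supported \<beta>\<close>
  have insert: "SW r (\<lambda>y b. \<beta> (\<lambda>w. \<phi> (c # S d # y # w @ [S b, k])))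
      = SW r (\<lambda>y b. \<beta> (\<lambda>w. \<phi> (c # S d # y # w @ [S b \<odot> k])))" if "par_form \<phi>" for \<phi> c d r k
    using E_right_insertableD[OF \<open>E_right_insertable \<beta>\<close> par_form_append_left[OF that, of "[c, S d]"]]
    by simp
  show ?case
    unfolding f E_right_insertable_def
  proof (intro allI impI)
    fix \<phi> g k assume \<phi>: "par_form \<phi>"
    show "SW g (\<lambda>a b. SW m (\<lambda>c d. \<beta> (\<lambda>v. \<phi> (a # ([c, S d] @ v) @ [S b, k]))))
        = SW g (\<lambda>a b. SW m (\<lambda>c d. \<beta> (\<lambda>v. \<phi> (a # ([c, S d] @ v) @ [S b \<odot> k]))))"
      using par_form_letter_E_insert[OF \<beta> \<phi>, of "\<lambda>b. [S b, k]" g m]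
        par_form_letter_E_insert[OF \<beta> \<phi>, of "\<lambda>b. [S b \<odot> k]" g m]
      by (simp add: insert[OF \<phi>])
  qed
qed

lemma E_right_insertable_A: "\<alpha> \<in> A_ops \<Longrightarrow> E_right_insertable \<alpha>"
  using E_right_insertable_mult[of \<alpha> "\<lambda>\<phi>. 1 * \<phi> []", OF _ finitely_supported_point]
  by (simp add: E_right_insertable_def par_form_E_right[where u = "[]", simplified])

lemma par_form_triple_mul:
  assumes \<phi>: "par_form \<phi>"
  shows "SW3 x (\<lambda>a b c. \<phi> (a # S b # (c \<odot> r) # v)) = \<phi> (x # r # v)"
proof -
  have "SW3 x (\<lambda>a b c. \<phi> (a # S b # (c \<odot> r) # v)) = SW3 x (\<lambda>a b c. \<phi> (a # S b # c # r # v))"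
    using par_form_Et_right[OF \<phi>, of _ "[_]"] by simp
  also have "\<dots> = \<phi> (x # r # v)"
    using par_form_triple[OF \<phi>, of "[]" x "r # v"] by simp
  finally show ?thesis .
qed

text \<open>$[h_1][g_1] \beta [S(g_2)][S(h_2)] = E_{h_1} [h_2 g_1] \beta [S(h_3 g_2)]$\<close>

lemma par_form_merge_letters:
  assumes \<beta>: "\<beta> \<in> A_ops" and \<phi>: "par_form \<phi>"
  shows "SW h (\<lambda>a b. SW g (\<lambda>c d. \<beta> (\<lambda>w. \<phi> (a # c # w @ [S d, S b]))))
       = SW h (\<lambda>a b. SW a (\<lambda>c d. SW (b \<odot> g) (\<lambda>e f. \<beta> (\<lambda>w. \<phi> (c # S d # e # w @ [S f])))))"
proof -
  note fin = A_ops_finitely_supported[OF \<beta>]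
  note [simp] = par_form_linear[OF \<phi>] linear_form_finitely_supported[OF fin]
  have "SW h (\<lambda>a b. SW a (\<lambda>c d. SW (b \<odot> g) (\<lambda>e f. \<beta> (\<lambda>w. \<phi> (c # S d # e # w @ [S f])))))
      = SW h (\<lambda>a b. SW a (\<lambda>c d. SW b (\<lambda>p q. SW g (\<lambda>r s. \<beta> (\<lambda>w. \<phi> (c # S d # (p \<odot> r) # w @ [S s \<odot> S q]))))))"
    by (simp add: SW_mul S_mul)
  also have "\<dots> = SW h (\<lambda>a b. SW b (\<lambda>p q. SW a (\<lambda>c d. SW g (\<lambda>r s. \<beta> (\<lambda>w. \<phi> (c # S d # (p \<odot> r) # w @ [S s \<odot> S q]))))))"
    by (intro SW_cong SW_swap)
  also have "\<dots> = SW h (\<lambda>x q. SW3 x (\<lambda>c d p. SW g (\<lambda>r s. \<beta> (\<lambda>w. \<phi> (c # S d # (p \<odot> r) # w @ [S s \<odot> S q])))))"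
    by (simp add: right_nested)
  also have "\<dots> = SW h (\<lambda>x q. SW g (\<lambda>r s. SW3 x (\<lambda>c d p. \<beta> (\<lambda>w. \<phi> (c # S d # (p \<odot> r) # w @ [S s \<odot> S q])))))"
    by (intro SW_cong SW_swap_pair[symmetric])
  also have "\<dots> = SW h (\<lambda>x q. SW g (\<lambda>r s. \<beta> (\<lambda>w. \<phi> (x # r # w @ [S s \<odot> S q]))))"
    by (simp add: SW_finitely_supported_swap[OF fin] par_form_triple_mul[OF \<phi>])
  also have "\<dots> = SW h (\<lambda>x q. SW g (\<lambda>r s. \<beta> (\<lambda>w. \<phi> (x # r # w @ [S s, S q]))))"
    by (simp only: E_right_insertableD[OF E_right_insertable_A[OF \<beta>] par_form_Cons[OF \<phi>]])
  finally show ?thesis ..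
qed

lemma eps_l_eq:
  assumes "par_form \<phi>"
  shows "eps_l w \<phi> = SW_word w (\<lambda>x y. \<phi> (x @ \<S> y))"
  using assms
proof (induction w arbitrary: \<phi> rule: merge_letters_induct)
  case (merge h g u)
  note \<phi> = \<open>par_form \<phi>\<close>
  have eps_l_product: "eps_l ((b \<odot> g) # u) \<psi> = SW (b \<odot> g) (\<lambda>e f. eps_l u (\<lambda>w. \<psi> (e # w @ [S f])))"
    if \<psi>: "par_form \<psi>" for b \<psi>
    using merge.IH(2)[OF \<psi>] merge.IH(1)[OF par_form_append_right[OF par_form_Cons[OF \<psi>]]] by simp
  have "eps_l (h # g # u) \<phi>
      = SW h (\<lambda>a b. SW a (\<lambda>c d. SW (b \<odot> g) (\<lambda>e f. eps_l u (\<lambda>w. \<phi> (c # S d # e # w @ [S f])))))"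
    by (simp add: eps_l_product[OF par_form_Cons[OF par_form_Cons[OF \<phi>]]])
  also have "\<dots> = SW h (\<lambda>a b. SW g (\<lambda>c d. eps_l u (\<lambda>w. \<phi> (a # c # w @ [S d, S b]))))"
    by (rule par_form_merge_letters[OF eps_l_in_A \<phi>, symmetric])
  also have "\<dots> = SW_word (h # g # u) (\<lambda>x y. \<phi> (x @ \<S> y))"
    using merge.IH(1)[OF par_form_append_right[OF par_form_Cons[OF par_form_Cons[OF \<phi>]]]] by simp
  finally show ?case .
qed simp_all

end

context invertible_weak_hopf_algebra
begin

lemma par_form_eps_l: "par_form \<phi> \<Longrightarrow> par_form (\<lambda>w. eps_l w \<phi>)"
  using par_form_Delta_r[OF right_balanced_antipode] by (simp add: eps_l_eq)

lemma eps_l_bimodule: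
  assumes \<alpha>: "\<alpha> \<in> A_ops" and \<gamma>: "\<gamma> \<in> A_ops" and \<phi>: "par_form \<phi>"
  shows "\<alpha> (\<lambda>u. \<gamma> (\<lambda>v. eps_l ((u @ \<S>' v) @ w) \<phi>)) = \<alpha> (\<lambda>u. eps_l w (\<lambda>z. \<gamma> (\<lambda>v. \<phi> ((u @ z) @ v))))"
proof -
  let ?F = "\<lambda>x y. \<phi> (x @ \<S> y)"
  note F = right_balanced_antipode[OF \<phi>]
  note fin_\<alpha> = A_ops_finitely_supported[OF \<alpha>] and fin_\<gamma> = A_ops_finitely_supported[OF \<gamma>]
  have "\<alpha> (\<lambda>u. \<gamma> (\<lambda>v. eps_l ((u @ \<S>' v) @ w) \<phi>)) = \<gamma> (\<lambda>v. \<alpha> (\<lambda>u. SW_word (u @ \<S>' v @ w) ?F))"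
    by (simp add: eps_l_eq[OF \<phi>] finitely_supported_swap[OF fin_\<alpha> fin_\<gamma>])
  also have "\<dots> = \<gamma> (\<lambda>v. \<alpha> (\<lambda>u. SW_word (\<S>' v @ w) (\<lambda>r s. ?F (u @ r) s)))"
    by (simp only: Delta_r_A_left[OF \<alpha> F])
  also have "\<dots> = \<alpha> (\<lambda>u. \<gamma> (\<lambda>v. SW_word (\<S>' v @ w) (\<lambda>r s. ?F (u @ r) s)))"
    by (rule finitely_supported_swap[OF fin_\<gamma> fin_\<alpha>])
  also have "\<dots> = \<alpha> (\<lambda>u. \<gamma> (\<lambda>v. SW_word w (\<lambda>r s. ?F (u @ r) (\<S>' v @ s))))"
    by (simp only: Delta_r_tA_left[OF \<gamma> right_balanced_append_left[OF F, of _ "[]", unfolded append_Nil]])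
  also have "\<dots> = \<alpha> (\<lambda>u. SW_word w (\<lambda>r s. \<gamma> (\<lambda>v. \<phi> ((u @ r @ \<S> s) @ v))))"
    by (simp add: SW_word_finitely_supported_swap[OF fin_\<gamma>])
  also have "\<dots> = \<alpha> (\<lambda>u. eps_l w (\<lambda>z. \<gamma> (\<lambda>v. \<phi> ((u @ z) @ v))))"
    by (simp add: eps_l_eq par_form_finitely_supported[OF fin_\<gamma>] par_form_context[OF \<phi>])
  finally show ?thesis .
qed

lemma eps_l_Cons:
  assumes \<phi>: "par_form \<phi>"
  shows "eps_l (a # u) \<phi> = SW a (\<lambda>c d. eps_l u (\<lambda>z. \<phi> (c # z @ [S d])))"
  using eps_l_eq[OF \<phi>] eps_l_eq[OF par_form_append_right[OF par_form_Cons[OF \<phi>]]] by simp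

lemma eps_l_counit:
  assumes "par_form \<phi>"
  shows "SW_word w (\<lambda>u v. eps_l u (\<lambda>z. \<phi> (z @ v))) = \<phi> w"
  using assms
proof (induction w arbitrary: \<phi>)
  case (Cons h w)
  note \<phi> = \<open>par_form \<phi>\<close>
  note [simp] = par_form_linear[OF \<phi>] linear_form_finitely_supported[OF eps_l_finitely_supported]
  have "SW_word (h # w) (\<lambda>u v. eps_l u (\<lambda>z. \<phi> (z @ v)))
      = SW_word w (\<lambda>u v. SW h (\<lambda>a b. SW a (\<lambda>c d. eps_l u (\<lambda>z. \<phi> (c # z @ S d # b # v)))))"
    by (simp add: eps_l_Cons[OF par_form_append_right[OF \<phi>]] SW_SW_word_swap)
  also have "\<dots> = SW_word w (\<lambda>u v. SW3 h (\<lambda>c d b. eps_l u (\<lambda>z. \<phi> (c # z @ S d # b # v))))"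
    by (simp add: right_nested)
  also have "\<dots> = SW_word w (\<lambda>u v. SW3 h (\<lambda>c d b. eps_l u (\<lambda>z. \<phi> (c # S d # b # z @ v))))"
  proof (rule SW_word_cong, rule SW_cong)
    fix u v c r
    from ops_commuteD[OF A_ops_At_ops_commute[OF eps_l_in_A[of u] At_ops_Et[of r]]
        par_form_append_right[OF par_form_Cons[OF \<phi>, of c], of v]]
    show "SW r (\<lambda>d b. eps_l u (\<lambda>z. \<phi> (c # z @ S d # b # v)))
        = SW r (\<lambda>d b. eps_l u (\<lambda>z. \<phi> (c # S d # b # z @ v)))"
      by (simp add: SW_finitely_supported_swap[OF eps_l_finitely_supported])
  qed
  also have "\<dots> = SW_word w (\<lambda>u v. eps_l u (\<lambda>z. \<phi> (h # z @ v)))"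
    using par_form_triple[OF \<phi>, of "[]" h]
    by (simp add: SW_finitely_supported_swap[OF eps_l_finitely_supported])
  also have "\<dots> = \<phi> (h # w)"
    by (rule Cons.IH[OF par_form_Cons[OF \<phi>]])
  finally show ?case .
qed simp

lemma eps_l_mult:
  assumes \<phi>: "par_form \<phi>"
  shows "eps_l (x @ y) \<phi> = eps_l y (\<lambda>z. eps_l (x @ z) \<phi>)"
    and "eps_l (x @ y) \<phi> = eps_l y (\<lambda>z. eps_l (x @ \<S>' z) \<phi>)"
proof -
  let ?F = "\<lambda>x y. \<phi> (x @ \<S> y)"
  note F = right_balanced_append_left[OF right_balanced_antipode[OF \<phi>]]
  have inner: "eps_l y (\<lambda>z. \<phi> (p @ z @ \<S> q)) = SW_word y (\<lambda>r s. ?F (p @ r) (q @ s))" for p q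
    using eps_l_eq[OF par_form_context[OF \<phi>]] by simp
  have "eps_l y (\<lambda>z. eps_l (x @ z) \<phi>)
      = SW_word x (\<lambda>p q. eps_l y (\<lambda>z. SW_word z (\<lambda>r s. ?F (p @ r) (q @ s))))"
    by (simp only: eps_l_eq[OF \<phi>] SW_word_append SW_word_finitely_supported_swap[OF eps_l_finitely_supported])
  also have "\<dots> = SW_word x (\<lambda>p q. eps_l y (\<lambda>z. ?F (p @ z) (q @ [])))"
    by (simp only: Delta_r_A[OF eps_l_in_A F])
  also have "\<dots> = eps_l (x @ y) \<phi>"
    by (simp add: inner eps_l_eq[OF \<phi>] SW_word_append)
  finally show "eps_l (x @ y) \<phi> = eps_l y (\<lambda>z. eps_l (x @ z) \<phi>)" ..
  have "eps_l y (\<lambda>z. eps_l (x @ \<S>' z) \<phi>)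
      = SW_word x (\<lambda>p q. eps_l y (\<lambda>z. SW_word (\<S>' z) (\<lambda>r s. ?F (p @ r) (q @ s))))"
    by (simp only: eps_l_eq[OF \<phi>] SW_word_append SW_word_finitely_supported_swap[OF eps_l_finitely_supported])
  also have "\<dots> = SW_word x (\<lambda>p q. eps_l y (\<lambda>z. ?F (p @ []) (q @ \<S>' z)))"
    by (simp only: Delta_r_tA[OF eps_l_in_A F])
  also have "\<dots> = eps_l (x @ y) \<phi>"
    by (simp add: inner eps_l_eq[OF \<phi>] SW_word_append)
  finally show "eps_l (x @ y) \<phi> = eps_l y (\<lambda>z. eps_l (x @ \<S>' z) \<phi>)" ..
qed

lemma eps_l_inverse_antipode_At:
  assumes \<beta>: "\<beta> \<in> At_ops" and \<phi>: "par_form \<phi>"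
  shows "\<beta> (\<lambda>v. eps_l (\<S>' v) \<phi>) = \<beta> (\<lambda>v. \<phi> (\<S>' v))"
    and "\<beta> (\<lambda>v. eps_l v (\<lambda>z. \<phi> (\<S>' z))) = \<beta> \<phi>"
proof -
  obtain \<alpha> where \<alpha>: "\<alpha> \<in> A_ops" "\<And>\<phi>. par_form \<phi> \<Longrightarrow> \<alpha> \<phi> = \<beta> (\<lambda>w. \<phi> (\<S>' w))"
    using At_ops_inverse_antipode[OF \<beta>] by blast
  from Delta_r_A[OF \<alpha>(1) right_balanced_antipode[OF \<phi>]]
  show "\<beta> (\<lambda>v. eps_l (\<S>' v) \<phi>) = \<beta> (\<lambda>v. \<phi> (\<S>' v))"
    by (simp add: eps_l_eq[OF \<phi>, symmetric] \<alpha>(2)[OF par_form_eps_l[OF \<phi>]] \<alpha>(2)[OF \<phi>])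
  show "\<beta> (\<lambda>v. eps_l v (\<lambda>z. \<phi> (\<S>' z))) = \<beta> \<phi>"
    using Delta_r_At[OF \<beta> right_balanced_antipode[OF par_form_inverse_antipode[OF \<phi>]]]
    by (simp add: eps_l_eq[OF par_form_inverse_antipode[OF \<phi>]])
qed

end

context invertible_weak_hopf_algebra
begin

interpretation cop: invertible_weak_hopf_algebra sc mul one "\<lambda>h F. SW h (\<lambda>a b. F b a)" \<epsilon> T S
  by (rule invertible_weak_hopf_algebra_cop)

text \<open>$t(\epsilon_l(x)) = x_2 \mathcal S'(x_1)$ is the left counit of $H^{cop}$.\<close>

lemma eps_l_counit_t:
  assumes \<phi>: "par_form \<phi>"
  shows "SW_word w (\<lambda>u v. eps_l v (\<lambda>z. \<phi> (\<S>' z @ u))) = \<phi> w"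
proof -
  have "eps_l v (\<lambda>z. \<phi> (\<S>' z @ u)) = SW_word v (\<lambda>x y. \<phi> (y @ \<S>' x @ u))" for u v
    using eps_l_eq[OF par_form_inverse_antipode[OF par_form_append_right[OF \<phi>, of u]], of v] by simp
  moreover have "cop.eps_l v (\<lambda>z. \<phi> (z @ u)) = SW_word v (\<lambda>x y. \<phi> (y @ \<S>' x @ u))" for u v
    using cop.eps_l_eq[OF par_form_cop[OF par_form_append_right[OF \<phi>, of u]], of v]
    by (simp add: cop_SW_word)
  ultimately show ?thesis
    using cop.eps_l_counit[OF par_form_cop[OF \<phi>], of w] by (simp add: cop_SW_word)
qed

end

section \<open>The right-handed statements\<close>

context weak_hopf_algebra
begin

definition eps_r :: "'h list \<Rightarrow> ('h list \<Rightarrow> 'k) \<Rightarrow> 'k" where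
  "eps_r w \<phi> = opcop.eps_l (rev w) (\<lambda>w. \<phi> (rev w))"

lemma eps_r_in_At: "eps_r w \<in> At_ops"
  using At_ops_unrev[OF opcop.eps_l_in_A[of "rev w"]] unfolding eps_r_def .

lemma eps_r_finitely_supported: "finitely_supported (eps_r w)"
  by (rule At_ops_finitely_supported[OF eps_r_in_At])

lemma eps_r_eq:
  assumes "par_form \<phi>"
  shows "eps_r w \<phi> = SW_word w (\<lambda>x y. \<phi> (\<S> x @ y))"
  unfolding eps_r_def using opcop.eps_l_eq[OF par_form_rev[OF assms], of "rev w"]
  by (simp add: opcop_SW_word SW_word_rev rev_map)

end

context invertible_weak_hopf_algebra
begin

lemma At_ops_tAt_commute:
  assumes "\<alpha> \<in> At_ops" "\<gamma> \<in> At_ops" "par_form \<phi>"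
  shows "\<alpha> (\<lambda>u. \<gamma> (\<lambda>v. \<phi> (u @ \<S>' v))) = \<alpha> (\<lambda>u. \<gamma> (\<lambda>v. \<phi> (\<S>' v @ u)))"
  using opcop.A_ops_tA_commute[OF At_ops_rev[OF assms(1)] At_ops_rev[OF assms(2)]
    par_form_rev[OF assms(3)]]
  by (simp add: rev_map)

lemma Delta_r_bimodule:
  assumes "\<alpha> \<in> At_ops" "\<gamma> \<in> At_ops" "right_balanced F"
  shows "\<alpha> (\<lambda>u. \<gamma> (\<lambda>v. SW_word (w @ \<S>' v @ u) F))
       = \<alpha> (\<lambda>u. \<gamma> (\<lambda>v. SW_word w (\<lambda>r s. F (r @ \<S>' v) (s @ u))))"
proof -
  have reverse: "(rev u @ opcop.\<S>' (rev v)) @ rev w = rev (w @ \<S>' v @ u)" for u v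
    by (simp add: rev_map)
  from opcop.Delta_l_bimodule[OF At_ops_rev[OF assms(1)] At_ops_rev[OF assms(2)] right_balanced_rev[OF assms(3)],
      of "rev w", unfolded reverse opcop_SW_word_rev]
  show ?thesis
    by (simp add: opcop_SW_word SW_word_rev rev_map)
qed

lemma Takeuchi_r:
  assumes "\<alpha> \<in> At_ops" "right_balanced F"
  shows "\<alpha> (\<lambda>u. SW_word w (\<lambda>p q. F (u @ p) q)) = \<alpha> (\<lambda>u. SW_word w (\<lambda>p q. F p (\<S>' u @ q)))"
  using opcop.Takeuchi_l[OF At_ops_rev[OF assms(1)] right_balanced_rev[OF assms(2)], of "rev w"]
  by (simp add: opcop_SW_word SW_word_rev rev_map)

lemma par_form_eps_r: "par_form \<phi> \<Longrightarrow> par_form (\<lambda>w. eps_r w \<phi>)"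
  unfolding eps_r_def by (rule par_form_unrev[OF opcop.par_form_eps_l[OF par_form_rev]])

lemma eps_r_bimodule:
  assumes "\<alpha> \<in> At_ops" "\<gamma> \<in> At_ops" "par_form \<phi>"
  shows "\<alpha> (\<lambda>u. \<gamma> (\<lambda>v. eps_r (w @ \<S>' v @ u) \<phi>)) = \<alpha> (\<lambda>u. eps_r w (\<lambda>z. \<gamma> (\<lambda>v. \<phi> (v @ z @ u))))"
  using opcop.eps_l_bimodule[OF At_ops_rev[OF assms(1)] At_ops_rev[OF assms(2)]
    par_form_rev[OF assms(3)], of "rev w"]
  by (simp add: eps_r_def rev_map)

lemma eps_r_counit:
  assumes "par_form \<phi>"
  shows "SW_word w (\<lambda>u v. eps_r v (\<lambda>z. \<phi> (u @ z))) = \<phi> w"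
  using opcop.eps_l_counit[OF par_form_rev[OF assms], of "rev w"]
  by (simp add: eps_r_def opcop_SW_word SW_word_rev)

lemma eps_r_counit_t:
  assumes "par_form \<phi>"
  shows "SW_word w (\<lambda>u v. eps_r u (\<lambda>z. \<phi> (v @ \<S>' z))) = \<phi> w"
  using opcop.eps_l_counit_t[OF par_form_rev[OF assms], of "rev w"]
  by (simp add: eps_r_def opcop_SW_word SW_word_rev rev_map)

lemma eps_r_mult:
  assumes "par_form \<phi>"
  shows "eps_r (x @ y) \<phi> = eps_r x (\<lambda>z. eps_r (z @ y) \<phi>)"
    and "eps_r (x @ y) \<phi> = eps_r x (\<lambda>z. eps_r (\<S>' z @ y) \<phi>)"
  using opcop.eps_l_mult[OF par_form_rev[OF assms], of "rev y" "rev x"]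
  by (simp_all add: eps_r_def rev_map)

lemma eps_r_inverse_antipode_A:
  assumes "\<alpha> \<in> A_ops" "par_form \<phi>"
  shows "\<alpha> (\<lambda>v. eps_r (\<S>' v) \<phi>) = \<alpha> (\<lambda>v. \<phi> (\<S>' v))"
    and "\<alpha> (\<lambda>v. eps_r v (\<lambda>z. \<phi> (\<S>' z))) = \<alpha> \<phi>"
  using opcop.eps_l_inverse_antipode_At[OF A_ops_rev[OF assms(1)] par_form_rev[OF assms(2)]]
  by (simp_all add: eps_r_def rev_map)

end

section \<open>Linear forms on the operations of formal sums\<close>

lemma lin_ext_wd [simp]: "lin_ext f (wd u) = f u"
  by (simp add: wd_def)

lemma lin_ext_fone [simp]: "lin_ext f fone = f []"
  by (simp add: fone_def)

lemma lin_ext_fsw [simp]: "lin_ext f (fsw D g) = lin_ext (\<lambda>xs. lin_ext f (g xs)) D"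
  unfolding fsw_def lin_ext_sum lin_ext_fsc by (simp add: lin_ext_def)

lemma kcontr_eq_lin_ext: "kcontr f X = lin_ext f X"
  by (simp add: kcontr_def lin_ext_def)

lemma lin_ext_splice [simp]:
  "lin_ext f (splice i g X)
      = lin_ext (\<lambda>xs. lin_ext (\<lambda>ys. f (take i xs @ ys @ drop (Suc i) xs)) (g (xs ! i))) X"
  unfolding splice_def lin_ext_sum lin_ext_single by (simp add: lin_ext_def sum_distrib_left mult.assoc)

lemma lin_ext_tmul [simp]: "lin_ext f (tmul m X Y) = lin_ext (\<lambda>xs. lin_ext (\<lambda>ys. f (map2 m xs ys)) Y) X"
  unfolding tmul_def lin_ext_sum lin_ext_single by (simp add: lin_ext_def sum_distrib_left mult.assoc)

lemma lin_ext_tcons [simp]: "lin_ext f (tcons a X) = lin_ext (\<lambda>xs. f (a # xs)) X"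
  unfolding tcons_def lin_ext_sum lin_ext_single by (simp add: lin_ext_def)

lemma lin_ext_tsnoc [simp]: "lin_ext f (tsnoc X a) = lin_ext (\<lambda>xs. f (xs @ [a])) X"
  unfolding tsnoc_def lin_ext_sum lin_ext_single by (simp add: lin_ext_def)

lemma lin_ext_fmul [simp]: "lin_ext f (fmul p q) = lin_ext (\<lambda>u. lin_ext (\<lambda>v. f (u @ v)) q) p"
  unfolding fmul_def lin_ext_sum lin_ext_single by (simp add: lin_ext_def sum_distrib_left mult.assoc)

lemma lin_ext_antiw [simp]: "lin_ext f (antiw g p) = lin_ext (\<lambda>u. f (rev (map g u))) p"
  unfolding antiw_def lin_ext_sum lin_ext_single by (simp add: lin_ext_def)

lemma lin_ext_DeltaP [simp]: "lin_ext f (DeltaP \<Delta> p) = lin_ext (\<lambda>u. lin_ext f (dword \<Delta> u)) p"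
  unfolding DeltaP_def lin_ext_sum lin_ext_fsc by (simp add: lin_ext_def)

lemma lin_ext_EpsL [simp]: "lin_ext f (EpsL \<Delta> S p) = lin_ext (\<lambda>u. lin_ext f (epsl \<Delta> S u)) p"
  unfolding EpsL_def lin_ext_sum lin_ext_fsc by (simp add: lin_ext_def)

lemma lin_ext_EpsR [simp]: "lin_ext f (EpsR \<Delta> S p) = lin_ext (\<lambda>u. lin_ext f (epsr_rev \<Delta> S (rev u))) p"
  unfolding EpsR_def lin_ext_sum lin_ext_fsc by (simp add: lin_ext_def)

lemma lin_ext_ttens_Nil [simp]: "lin_ext f (ttens []) = f []"
  by simp

lemma lin_ext_ttens_Cons [simp]:
  "lin_ext f (ttens (p # ps)) = lin_ext (\<lambda>u. lin_ext (\<lambda>ws. f (u # ws)) (ttens ps)) p"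
  unfolding ttens.simps lin_ext_sum lin_ext_single by (simp add: lin_ext_def sum_distrib_left mult.assoc)

declare ttens.simps [simp del]

lemma lin_ext_ttens_wd: "lin_ext f (ttens (map wd ws)) = f ws"
  by (induction ws arbitrary: f) simp_all

lemma lin_ext_ttens_update:
  "i < length ws \<Longrightarrow> lin_ext f (ttens ((map wd ws)[i := p])) = lin_ext (\<lambda>u. f (ws[i := u])) p"
  by (induction ws arbitrary: f i) (auto simp: lin_ext_ttens_wd split: nat.split)

lemma lin_ext_slotl [simp]:
  "lin_ext f (slotl i p X) = lin_ext (\<lambda>ws. lin_ext (\<lambda>u. f (ws[i := u @ ws ! i])) p) X"
  unfolding slotl_def lin_ext_sum lin_ext_single by (simp add: lin_ext_def sum_distrib_left ac_simps)

lemma lin_ext_slotr [simp]: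
  "lin_ext f (slotr i p X) = lin_ext (\<lambda>ws. lin_ext (\<lambda>u. f (ws[i := ws ! i @ u])) p) X"
  unfolding slotr_def lin_ext_sum lin_ext_single by (simp add: lin_ext_def sum_distrib_left ac_simps)

lemma lin_ext_tcontr [simp]: "lin_ext \<phi> (tcontr f X) = lin_ext (\<lambda>ws. lin_ext \<phi> (f (ws ! 0) (ws ! 1))) X"
  unfolding tcontr_def lin_ext_sum lin_ext_fsc by (simp add: lin_ext_def)

lemma lin_ext_Ep [simp]: "lin_ext f (Ep \<Delta> S h) = lin_ext (\<lambda>xs. f [xs ! 0, S (xs ! 1)]) (\<Delta> h)"
  by (simp add: Ep_def)

lemma lin_ext_Et [simp]: "lin_ext f (Et \<Delta> S h) = lin_ext (\<lambda>xs. f [S (xs ! 0), xs ! 1]) (\<Delta> h)"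
  by (simp add: Et_def)

section \<open>Identities between formal sums\<close>

lemma formal_sum_eqI:
  assumes "\<And>f. lin_ext f p = lin_ext f q"
  shows "p = q"
proof (rule poly_mapping_eqI)
  fix u
  have "lin_ext (\<lambda>v. if v = u then 1 else 0) r = Poly_Mapping.lookup r u" for r :: "'a \<Rightarrow>\<^sub>0 'b"
    by (simp add: lin_ext_def if_distrib sum.delta in_keys_iff cong: if_cong)
  with assms show "Poly_Mapping.lookup p u = Poly_Mapping.lookup q u"
    by metis
qed

lemma antiw_add: "antiw f (x + y) = antiw f x + antiw f y"
  and antiw_fsc: "antiw f (fsc c x) = fsc c (antiw f x)"
  and antiw_fone: "antiw f fone = fone"
  by (rule formal_sum_eqI, simp)+

lemma antiw_fmul: "antiw f (fmul x y) = fmul (antiw f y) (antiw f x)"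
  by (rule formal_sum_eqI) (simp add: lin_ext_swap[of _ y x])

lemma DeltaP_add: "DeltaP \<Delta> (x + y) = DeltaP \<Delta> x + DeltaP \<Delta> y"
  and DeltaP_fsc: "DeltaP \<Delta> (fsc c x) = fsc c (DeltaP \<Delta> x)"
  and DeltaP_fone: "DeltaP \<Delta> fone = ttens [fone, fone]"
  by (rule formal_sum_eqI, simp)+

lemma EpsL_add: "EpsL \<Delta> S (x + y) = EpsL \<Delta> S x + EpsL \<Delta> S y"
  and EpsL_fsc: "EpsL \<Delta> S (fsc c x) = fsc c (EpsL \<Delta> S x)"
  and EpsR_add: "EpsR \<Delta> S (x + y) = EpsR \<Delta> S x + EpsR \<Delta> S y"
  and EpsR_fsc: "EpsR \<Delta> S (fsc c x) = fsc c (EpsR \<Delta> S x)"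
  by (rule formal_sum_eqI, simp)+

lemma fmul_fsc_fone: "fmul (fsc c fone) x = fsc c x"
  by (rule formal_sum_eqI) simp

lemma fmul_assoc: "fmul (fmul x y) z = fmul x (fmul y z)"
  by (rule formal_sum_eqI) simp

lemma subspace_lspan: "module.subspace fsc (lspan G)"
proof -
  interpret vector_space "fsc :: 'a \<Rightarrow> ('b \<Rightarrow>\<^sub>0 'a) \<Rightarrow> _" by (rule vector_space_fsc)
  show ?thesis
    by (auto simp: subspace_def intro: lspan.intros)
qed

lemma subspace_fideal: "module.subspace fsc (fideal G)"
proof -
  interpret vector_space "fsc :: 'a \<Rightarrow> ('b list \<Rightarrow>\<^sub>0 'a) \<Rightarrow> _" by (rule vector_space_fsc)
  show ?thesis
    using fideal_lmul[of _ G "fsc _ fone"]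
    by (auto simp: subspace_def fmul_fsc_fone intro: fideal.intros)
qed

lemma lspan_separation:
  assumes "\<And>f. \<forall>g\<in>G. lin_ext f g = 0 \<Longrightarrow> lin_ext f x = 0"
  shows "x \<in> lspan G"
  by (rule formal_sum_in_subspaceI[OF subspace_lspan]) (use assms lspan_gen in blast)

lemma lin_ext_subalg:
  assumes "a \<in> subalg G" "\<And>g. g \<in> G \<Longrightarrow> (\<lambda>\<phi>. lin_ext \<phi> g) \<in> generated_algebra G'"
  shows "(\<lambda>\<phi>. lin_ext \<phi> a) \<in> generated_algebra G'"
  using assms(1) by induction (auto intro: generated_algebra.intros assms(2))

lemma generated_algebra_subalg:
  assumes "\<alpha> \<in> generated_algebra G'" "\<And>g. g \<in> G' \<Longrightarrow> \<exists>a\<in>G. g = (\<lambda>\<phi>. lin_ext \<phi> a)"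
  shows "\<exists>a\<in>subalg G. \<alpha> = (\<lambda>\<phi>. lin_ext \<phi> a)"
  using assms(1)
proof induction
  case (generated_algebra_unit c)
  show ?case by (rule bexI[OF _ subalg_scalar[of c]]) simp
next
  case (generated_algebra_generator g)
  then show ?case using assms(2) subalg_gen by blast
next
  case (generated_algebra_add \<alpha> \<beta>)
  then obtain a b where "a \<in> subalg G" "\<alpha> = (\<lambda>\<phi>. lin_ext \<phi> a)" "b \<in> subalg G" "\<beta> = (\<lambda>\<phi>. lin_ext \<phi> b)" by blast
  then show ?case by (intro bexI[OF _ subalg_add[of a _ b]]) simp_all
next
  case (generated_algebra_mult \<alpha> \<beta>)
  then obtain a b where "a \<in> subalg G" "\<alpha> = (\<lambda>\<phi>. lin_ext \<phi> a)" "b \<in> subalg G" "\<beta> = (\<lambda>\<phi>. lin_ext \<phi> b)" by blast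
  then show ?case by (intro bexI[OF _ subalg_mul[of a _ b]]) simp_all
qed

section \<open>The concrete weak Hopf algebra\<close>

definition on_pairs :: "('h \<Rightarrow> 'h \<Rightarrow> 'k) \<Rightarrow> 'h list \<Rightarrow> 'k::field" where
  "on_pairs F xs = (case xs of [a, b] \<Rightarrow> F a b | _ \<Rightarrow> 0)"

definition on_triples :: "('h \<Rightarrow> 'h \<Rightarrow> 'h \<Rightarrow> 'k) \<Rightarrow> 'h list \<Rightarrow> 'k::field" where
  "on_triples F xs = (case xs of [a, b, c] \<Rightarrow> F a b c | _ \<Rightarrow> 0)"

lemma on_pairs [simp]: "on_pairs F [a, b] = F a b"
  by (simp add: on_pairs_def)

lemma on_triples [simp]: "on_triples F [a, b, c] = F a b c"
  by (simp add: on_triples_def)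

context vector_space
begin

lemma multilinear_form_on_pairs:
  assumes F: "bilinear_form F"
  shows "multilinear_form (on_pairs F)"
  unfolding multilinear_form_def
proof (intro allI)
  fix u v :: "'b list"
  consider b where "u = []" "v = [b]" | a where "u = [a]" "v = []" | (other) "length u + length v \<noteq> 1"
    by (cases u; cases v) auto
  then show "linear_form (\<lambda>x. on_pairs F (u @ x # v))"
  proof cases
    case other
    then have "on_pairs F (u @ x # v) = 0" for x
      by (auto simp: on_pairs_def Cons_eq_append_conv append_eq_Cons_conv split: list.split)
    then show ?thesis by simp
  qed (use F in \<open>simp_all add: bilinear_form_def\<close>)
qed

lemma multilinear_form_on_triples:
  assumes F: "trilinear_form F"
  shows "multilinear_form (on_triples F)"
  unfolding multilinear_form_def
proof (intro allI)
  fix u v :: "'b list"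
  consider b c where "u = []" "v = [b, c]" | a c where "u = [a]" "v = [c]" | a b where "u = [a, b]" "v = []"
    | (other) "length u + length v \<noteq> 2"
    by (cases u; cases v; cases "tl u"; cases "tl v") auto
  then show "linear_form (\<lambda>x. on_triples F (u @ x # v))"
  proof cases
    case other
    then have "on_triples F (u @ x # v) = 0" for x
      by (auto simp: on_triples_def Cons_eq_append_conv append_eq_Cons_conv split: list.split)
    then show ?thesis by simp
  qed (use F in \<open>simp_all add: trilinear_form_def\<close>)
qed

end

locale concrete_weak_hopf_algebra =
  fixes sc :: "'k::field \<Rightarrow> 'h::ring_1 \<Rightarrow> 'h"
    and \<Delta> :: "'h \<Rightarrow> ('h list \<Rightarrow>\<^sub>0 'k)"
    and \<epsilon> :: "'h \<Rightarrow> 'k"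
    and S :: "'h \<Rightarrow> 'h"
  assumes weak_hopf: "weak_hopf sc \<Delta> \<epsilon> S" and bij_S: "bij S"
begin

lemma weak_hopfD:
  shows kalg: "kalg sc"
    and length_Delta: "xs \<in> Poly_Mapping.keys (\<Delta> h) \<Longrightarrow> length xs = 2"
    and Delta_add: "htens_eq sc (\<Delta> (x + y)) (\<Delta> x + \<Delta> y)"
    and Delta_sc: "htens_eq sc (\<Delta> (sc c x)) (fsc c (\<Delta> x))"
    and eps_add: "\<epsilon> (x + y) = \<epsilon> x + \<epsilon> y"
    and eps_sc: "\<epsilon> (sc c x) = c * \<epsilon> x"
    and S_add: "S (x + y) = S x + S y"
    and S_sc: "S (sc c x) = sc c (S x)"
    and Delta_coassoc: "htens_eq sc (splice 0 \<Delta> (\<Delta> h)) (splice 1 \<Delta> (\<Delta> h))"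
    and Delta_counit_left: "hcontr sc (\<lambda>xs. sc (\<epsilon> (xs!0)) (xs!1)) (\<Delta> h) = h"
    and Delta_counit_right: "hcontr sc (\<lambda>xs. sc (\<epsilon> (xs!1)) (xs!0)) (\<Delta> h) = h"
    and Delta_mul: "htens_eq sc (\<Delta> (k * h)) (tmul (*) (\<Delta> k) (\<Delta> h))"
    and eps_mul: "kcontr (\<lambda>xs. \<epsilon> (k * xs!0) * \<epsilon> (xs!1 * g)) (\<Delta> h) = \<epsilon> (k * h * g)"
    and eps_mul_flip: "kcontr (\<lambda>xs. \<epsilon> (k * xs!1) * \<epsilon> (xs!0 * g)) (\<Delta> h) = \<epsilon> (k * h * g)"
    and Delta_unit: "htens_eq sc (tmul (*) (tcons 1 (\<Delta> 1)) (tsnoc (\<Delta> 1) 1)) (splice 0 \<Delta> (\<Delta> 1))"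
    and Delta_unit_flip: "htens_eq sc (splice 0 \<Delta> (\<Delta> 1)) (tmul (*) (tsnoc (\<Delta> 1) 1) (tcons 1 (\<Delta> 1)))"
    and S_target: "hcontr sc (\<lambda>xs. xs!0 * S (xs!1)) (\<Delta> h) = hcontr sc (\<lambda>xs. sc (\<epsilon> (xs!0 * h)) (xs!1)) (\<Delta> 1)"
    and S_source: "hcontr sc (\<lambda>xs. S (xs!0) * xs!1) (\<Delta> h) = hcontr sc (\<lambda>xs. sc (\<epsilon> (h * xs!1)) (xs!0)) (\<Delta> 1)"
    and S_convolution: "S h = hcontr sc (\<lambda>xs. S (xs!0) * xs!1 * S (xs!2)) (splice 0 \<Delta> (\<Delta> h))"
  using weak_hopf[unfolded weak_hopf_def] by - (elim conjE, fast)+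

definition SW :: "'h \<Rightarrow> ('h \<Rightarrow> 'h \<Rightarrow> 'k) \<Rightarrow> 'k" where
  "SW h F = lin_ext (\<lambda>xs. F (xs ! 0) (xs ! 1)) (\<Delta> h)"

lemma lin_ext_Delta: "lin_ext f (\<Delta> h) = SW h (\<lambda>a b. f [a, b])"
  unfolding SW_def
proof (rule lin_ext_cong)
  fix xs assume "xs \<in> Poly_Mapping.keys (\<Delta> h)"
  from length_Delta[OF this] show "f xs = f [xs ! 0, xs ! 1]"
    by (cases xs; cases "tl xs") auto
qed

sublocale vector_space sc
  using kalg by unfold_locales (simp_all add: kalg_def)

lemma htens_eq_lin_ext:
  assumes "htens_eq sc X Y" "multilinear_form f"
  shows "lin_ext f X = lin_ext f Y"
proof -
  have "lin_ext f z = 0" if "z \<in> lspan (mlin_gens sc)" for z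
    using that
  proof induction
    case (lspan_gen g)
    then show ?case
      using assms(2) unfolding mlin_gens_def multilinear_form_def linear_form_iff by auto
  qed simp_all
  from this[of "X - Y"] assms(1) show ?thesis
    by (simp add: htens_eq_def)
qed

lemma linear_form_hcontr: "linear_form f \<Longrightarrow> f (hcontr sc g X) = lin_ext (\<lambda>xs. f (g xs)) X"
  unfolding hcontr_def lin_ext_def by (simp add: linear_form_sum) (simp add: linear_form_iff)

lemma prebialgebra: "prebialgebra sc (*) 1 SW \<epsilon>"
proof (intro prebialgebra.intro prebialgebra_axioms.intro vector_space_axioms)
  show "linear_endo (\<lambda>x. x * y)" "linear_endo (\<lambda>x. y * x)" "linear_form \<epsilon>" for y
    using kalg by (auto simp: linear_endo_iff linear_form_iff kalg_def algebra_simps eps_add eps_sc)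
  show "finitely_supported (\<lambda>f. SW h (\<lambda>a b. f (a, b)))" for h
    unfolding SW_def using finitely_supported_map[OF finitely_supported_lin_ext, where g = "\<lambda>xs. (xs ! 0, xs ! 1)"]
    by simp
  show "SW h (\<lambda>a b. \<epsilon> a * f b) = f h" "SW h (\<lambda>a b. \<epsilon> b * f a) = f h" if "linear_form f" for f h
    using linear_form_hcontr[OF that, of "\<lambda>xs. sc (\<epsilon> (xs!0)) (xs!1)" "\<Delta> h", unfolded Delta_counit_left]
      linear_form_hcontr[OF that, of "\<lambda>xs. sc (\<epsilon> (xs!1)) (xs!0)" "\<Delta> h", unfolded Delta_counit_right] that
    by (simp_all add: SW_def linear_form_iff)
next
  fix F :: "'h \<Rightarrow> 'h \<Rightarrow> 'k" and x y
  assume "bilinear_form F"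
  note form = multilinear_form_on_pairs[OF this]
  show "linear_form (\<lambda>h. SW h F)"
    using htens_eq_lin_ext[OF Delta_add form] htens_eq_lin_ext[OF Delta_sc form]
    by (simp add: linear_form_iff lin_ext_Delta)
  show "SW (x * y) F = SW x (\<lambda>a b. SW y (\<lambda>c d. F (a * c) (b * d)))"
    using htens_eq_lin_ext[OF Delta_mul form, of x y] by (simp add: lin_ext_Delta)
next
  fix G :: "'h \<Rightarrow> 'h \<Rightarrow> 'h \<Rightarrow> 'k" and h
  assume "trilinear_form G"
  from htens_eq_lin_ext[OF Delta_coassoc multilinear_form_on_triples[OF this], of h]
  show "SW h (\<lambda>a b. SW a (\<lambda>c d. G c d b)) = SW h (\<lambda>a b. SW b (\<lambda>c d. G a c d))"
    by (simp add: lin_ext_Delta)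
qed (simp_all add: algebra_simps)

lemma weak_bialgebra: "weak_bialgebra sc (*) 1 SW \<epsilon>"
proof (intro weak_bialgebra.intro prebialgebra weak_bialgebra_axioms.intro)
  interpret prebialgebra sc "(*)" 1 SW \<epsilon> by (rule prebialgebra)
  show "SW h (\<lambda>a b. \<epsilon> (k * a) * \<epsilon> (b * g)) = \<epsilon> (k * h * g)"
    "SW h (\<lambda>a b. \<epsilon> (k * b) * \<epsilon> (a * g)) = \<epsilon> (k * h * g)" for h k g
    using eps_mul[of k g h] eps_mul_flip[of k g h] by (simp_all add: kcontr_eq_lin_ext SW_def)
  fix G :: "'h \<Rightarrow> 'h \<Rightarrow> 'h \<Rightarrow> 'k"
  assume G: "trilinear_form G"
  note form = multilinear_form_on_triples[OF G] and nest = SW_coassoc[OF G, of 1, symmetric]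
  show "SW 1 (\<lambda>a b. SW b (\<lambda>c d. G a c d)) = SW 1 (\<lambda>a b. SW 1 (\<lambda>c d. G a (c * b) d))"
    unfolding nest using htens_eq_lin_ext[OF Delta_unit form]
    by (subst SW_swap) (simp add: lin_ext_Delta)
  show "SW 1 (\<lambda>a b. SW b (\<lambda>c d. G a c d)) = SW 1 (\<lambda>a b. SW 1 (\<lambda>c d. G a (b * c) d))"
    unfolding nest using htens_eq_lin_ext[OF Delta_unit_flip form] by (simp add: lin_ext_Delta)
qed

lemma weak_hopf_algebra: "weak_hopf_algebra sc (*) 1 SW \<epsilon> S"
proof (intro weak_hopf_algebra.intro weak_bialgebra weak_hopf_algebra_axioms.intro)
  interpret weak_bialgebra sc "(*)" 1 SW \<epsilon> by (rule weak_bialgebra)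
  show S: "linear_endo S"
    by (simp add: linear_endo_iff S_add S_sc)
  fix f :: "'h \<Rightarrow> 'k" and h assume f: "linear_form f"
  note [simp] = linear_form_comp[OF f] linear_endo_comp[OF S]
  have f_sc: "f (sc c x) = c * f x" for c x
    using f by (simp add: linear_form_iff)
  show "SW h (\<lambda>a b. f (a * S b)) = f (eps_t h)"
    using arg_cong[OF S_target, of f h]
    by (simp add: linear_form_hcontr[OF f] linear_form_eps_t[OF f] f_sc SW_def)
  show "SW h (\<lambda>a b. f (S a * b)) = f (eps_s h)"
    using arg_cong[OF S_source, of f h]
    by (simp add: linear_form_hcontr[OF f] linear_form_eps_s[OF f] f_sc SW_def)
  show "f (S h) = SW3 h (\<lambda>a b c. f (S a * b * S c))"
    using arg_cong[OF S_convolution, of f h]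
    by (simp add: linear_form_hcontr[OF f] lin_ext_Delta right_nested)
qed

sublocale invertible_weak_hopf_algebra sc "(*)" 1 SW \<epsilon> S "inv S"
  by (intro invertible_weak_hopf_algebra.intro weak_hopf_algebra invertible_weak_hopf_algebra_axioms.intro)
    (use bij_S in \<open>simp_all add: bij_is_surj surj_f_inv_f bij_is_inj inv_f_f\<close>)

end

section \<open>Equality in the partial algebra and in the tensor products\<close>

context concrete_weak_hopf_algebra
begin

abbreviation (input) T :: "'h \<Rightarrow> 'h" where
  "T \<equiv> inv S"

lemma par_form_vanishes_on_par_gens:
  assumes "g \<in> par_gens sc \<Delta> S" and \<phi>: "par_form \<phi>"
  shows "lin_ext \<phi> g = 0"
proof -
  note [simp] = par_form_linear[OF \<phi>]
  have letter: "linear_form (\<lambda>x. \<phi> (u @ x # v))" for u v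
    by simp
  have add: "\<phi> (u @ (a + b) # v) = \<phi> (u @ a # v) + \<phi> (u @ b # v)" for u v a b
    using letter[of u v] unfolding linear_form_iff by blast
  have scale: "\<phi> (u @ sc c a # v) = c * \<phi> (u @ a # v)" for u v a c
    using letter[of u v] unfolding linear_form_iff by blast
  have triple: "\<phi> [h] = SW h (\<lambda>a b. SW a (\<lambda>c d. \<phi> [c, S d, b]))" for h
    using par_form_triple[OF \<phi>, of "[]" h "[]"] by (simp add: right_nested)
  show ?thesis
    using assms(1) unfolding par_gens_def
    using add scale triple par_form_one[OF \<phi>, of "[]" "[]"]
      par_form_left_E[OF \<phi>, of _ "[]" _ "[]"] par_form_left_Et[OF \<phi>, of _ "[]" _ "[]"]
      par_form_E_right[OF \<phi>, of _ "[]" _ "[]"] par_form_Et_right[OF \<phi>, of _ "[]" _ "[]"]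
    by (auto simp: lin_ext_fun_diff lin_ext_Delta)
qed

lemma par_form_vanishes_on_fideal:
  assumes "x \<in> fideal (par_gens sc \<Delta> S)" "par_form \<phi>"
  shows "lin_ext \<phi> x = 0"
  using assms
proof (induction arbitrary: \<phi>)
  case (fideal_gen g)
  then show ?case by (rule par_form_vanishes_on_par_gens)
next
  case (fideal_lmul x a)
  then show ?case by (simp add: par_form_append_left) (simp add: lin_ext_def)
next
  case (fideal_rmul x a)
  have "lin_ext (\<lambda>u. lin_ext (\<lambda>v. \<phi> (u @ v)) a) x = 0"
    by (rule fideal_rmul.IH)
      (intro par_form_finitely_supported[OF finitely_supported_lin_ext] par_form_append_right fideal_rmul.prems)
  then show ?case by simp
qed simp_all

lemma par_gens_relations:
  shows "wd [1] - wd [] \<in> par_gens sc \<Delta> S"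
    and "fsw (\<Delta> k) (\<lambda>xs. wd [h, xs!0, S (xs!1)] - wd [h * xs!0, S (xs!1)]) \<in> par_gens sc \<Delta> S"
    and "fsw (\<Delta> k) (\<lambda>xs. wd [h, S (xs!0), xs!1] - wd [h * S (xs!0), xs!1]) \<in> par_gens sc \<Delta> S"
    and "fsw (\<Delta> h) (\<lambda>xs. wd [xs!0, S (xs!1), k] - wd [xs!0, S (xs!1) * k]) \<in> par_gens sc \<Delta> S"
    and "fsw (\<Delta> h) (\<lambda>xs. wd [S (xs!0), xs!1, k] - wd [S (xs!0), xs!1 * k]) \<in> par_gens sc \<Delta> S"
    and "wd [h] - fsw (splice 0 \<Delta> (\<Delta> h)) (\<lambda>xs. wd [xs!0, S (xs!1), xs!2]) \<in> par_gens sc \<Delta> S"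
  unfolding par_gens_def by blast+

lemma multilinear_form_if_vanishes_on_fideal:
  assumes "\<And>g. g \<in> fideal (par_gens sc \<Delta> S) \<Longrightarrow> lin_ext \<phi> g = 0"
  shows "multilinear_form \<phi>"
  unfolding multilinear_form_def linear_form_iff
proof (intro allI conjI)
  fix u v x y c
  have "wd (u @ [x + y] @ v) - wd (u @ [x] @ v) - wd (u @ [y] @ v) \<in> par_gens sc \<Delta> S"
    "wd (u @ [sc c x] @ v) - fsc c (wd (u @ [x] @ v)) \<in> par_gens sc \<Delta> S"
    unfolding par_gens_def by blast+
  from this[THEN fideal_gen, THEN assms]
  show "\<phi> (u @ (x + y) # v) = \<phi> (u @ x # v) + \<phi> (u @ y # v)" "\<phi> (u @ sc c x # v) = c * \<phi> (u @ x # v)"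
    by (simp_all add: algebra_simps)
qed

lemma par_form_if_vanishes_on_fideal:
  assumes vanishes: "\<And>g. g \<in> fideal (par_gens sc \<Delta> S) \<Longrightarrow> lin_ext \<phi> g = 0"
  shows "par_form \<phi>"
proof (rule par_formI)
  show multilinear: "multilinear_form \<phi>"
    by (rule multilinear_form_if_vanishes_on_fideal[OF vanishes])
  note [simp] = multilinear_form_linear[OF multilinear] lin_ext_fun_diff lin_ext_Delta
  have in_context: "lin_ext (\<lambda>w. \<phi> (u @ w @ v)) g = 0" if "g \<in> par_gens sc \<Delta> S" for u v g
    using vanishes[OF fideal_rmul[OF fideal_lmul[OF fideal_gen[OF that]], of "wd u" "wd v"]] by simp
  fix u v h k
  show "\<phi> (u @ 1 # v) = \<phi> (u @ v)"
    using in_context[OF par_gens_relations(1), of u v] by simp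
  show "SW k (\<lambda>a b. \<phi> (u @ h # a # S b # v)) = SW k (\<lambda>a b. \<phi> (u @ (h * a) # S b # v))"
    using in_context[OF par_gens_relations(2), of u v k h] by simp
  show "SW k (\<lambda>a b. \<phi> (u @ h # S a # b # v)) = SW k (\<lambda>a b. \<phi> (u @ (h * S a) # b # v))"
    using in_context[OF par_gens_relations(3), of u v k h] by simp
  show "SW h (\<lambda>a b. \<phi> (u @ a # S b # k # v)) = SW h (\<lambda>a b. \<phi> (u @ a # (S b * k) # v))"
    using in_context[OF par_gens_relations(4), of u v h k] by simp
  show "SW h (\<lambda>a b. \<phi> (u @ S a # b # k # v)) = SW h (\<lambda>a b. \<phi> (u @ S a # (b * k) # v))"
    using in_context[OF par_gens_relations(5), of u v h k] by simp
  show "\<phi> (u @ h # v) = SW3 h (\<lambda>a b c. \<phi> (u @ a # S b # c # v))"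
    using in_context[OF par_gens_relations(6), of u v h] by (simp add: right_nested)
qed

abbreviation par_eq :: "('h list \<Rightarrow>\<^sub>0 'k) \<Rightarrow> ('h list \<Rightarrow>\<^sub>0 'k) \<Rightarrow> bool" (infix "\<approx>" 50) where
  "x \<approx> y \<equiv> peq sc \<Delta> S x y"

lemma peq_lin_ext: "x \<approx> y \<Longrightarrow> par_form \<phi> \<Longrightarrow> lin_ext \<phi> x = lin_ext \<phi> y"
  unfolding peq_def using par_form_vanishes_on_fideal[of "x - y" \<phi>] by simp

lemma peqI:
  assumes "\<And>\<phi>. par_form \<phi> \<Longrightarrow> lin_ext \<phi> x = lin_ext \<phi> y"
  shows "x \<approx> y"
  unfolding peq_def
proof (rule formal_sum_in_subspaceI[OF subspace_fideal])
  fix \<phi> assume "\<And>g. g \<in> fideal (par_gens sc \<Delta> S) \<Longrightarrow> lin_ext \<phi> g = 0"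
  from assms[OF par_form_if_vanishes_on_fideal[OF this]] show "lin_ext \<phi> (x - y) = 0"
    by simp
qed

lemma tgens_par_form:
  assumes vanishes: "\<forall>g\<in>tgens sc \<Delta> S bs. lin_ext \<Phi> g = 0"
    and "length ws = Suc (length bs)" "i < length ws"
  shows "par_form (\<lambda>p. \<Phi> (ws[i := p]))"
proof (rule par_form_if_vanishes_on_fideal)
  fix x assume "x \<in> fideal (par_gens sc \<Delta> S)"
  then have "ttens ((map wd ws)[i := x]) \<in> tgens sc \<Delta> S bs"
    unfolding tgens_def using assms(2,3) by (intro UnI1) (simp, metis length_map)
  from bspec[OF vanishes this] show "lin_ext (\<lambda>p. \<Phi> (ws[i := p])) x = 0"
    by (simp add: lin_ext_ttens_update assms(3))
qed

lemma teq_LA_I: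
  assumes "\<And>\<Phi>. left_balanced (\<lambda>x y. \<Phi> [x, y]) \<Longrightarrow> lin_ext \<Phi> X = lin_ext \<Phi> Y"
  shows "teq sc \<Delta> S [LA] X Y"
  unfolding teq_def
proof (rule lspan_separation)
  fix \<Phi> assume vanishes: "\<forall>g\<in>tgens sc \<Delta> S [LA]. lin_ext \<Phi> g = 0"
  have "left_balanced (\<lambda>x y. \<Phi> [x, y])"
    unfolding left_balanced_def
  proof (intro conjI allI)
    show "par_form (\<lambda>p. \<Phi> [p, q])" "par_form (\<lambda>q. \<Phi> [p, q])" for p q
      using tgens_par_form[OF vanishes, where ws = "[[], q]" and i = 0]
        tgens_par_form[OF vanishes, where ws = "[p, []]" and i = 1] by simp_all
    fix h x y
    have "Ep \<Delta> S h \<in> Apar \<Delta> S"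
      unfolding Apar_def by (rule subalg_gen) simp
    then have "ttens [fmul (antiw T (Ep \<Delta> S h)) (wd x), wd y] - ttens [wd x, fmul (Ep \<Delta> S h) (wd y)]
        \<in> tgens sc \<Delta> S [LA]"
      unfolding tgens_def
      by (intro UnI1[OF UnI2] CollectI exI[of _ "[wd x, wd y]"] exI[of _ 0] exI[of _ "wd x"] exI[of _ "wd y"]
          exI[of _ "Ep \<Delta> S h"]) simp
    from bspec[OF vanishes this] show "SW h (\<lambda>a b. \<Phi> [b # T a # x, y]) = SW h (\<lambda>a b. \<Phi> [x, a # S b # y])"
      by (simp add: lin_ext_Delta)
  qed
  from assms[OF this] show "lin_ext \<Phi> (X - Y) = 0"
    by simp
qed

lemma teq_RA_I:
  assumes "\<And>\<Phi>. right_balanced (\<lambda>x y. \<Phi> [x, y]) \<Longrightarrow> lin_ext \<Phi> X = lin_ext \<Phi> Y"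
  shows "teq sc \<Delta> S [RA] X Y"
  unfolding teq_def
proof (rule lspan_separation)
  fix \<Phi> assume vanishes: "\<forall>g\<in>tgens sc \<Delta> S [RA]. lin_ext \<Phi> g = 0"
  have "right_balanced (\<lambda>x y. \<Phi> [x, y])"
    unfolding right_balanced_def
  proof (intro conjI allI)
    show "par_form (\<lambda>p. \<Phi> [p, q])" "par_form (\<lambda>q. \<Phi> [p, q])" for p q
      using tgens_par_form[OF vanishes, where ws = "[[], q]" and i = 0]
        tgens_par_form[OF vanishes, where ws = "[p, []]" and i = 1] by simp_all
    fix h x y
    have "Et \<Delta> S h \<in> Atpar \<Delta> S"
      unfolding Atpar_def by (rule subalg_gen) simp
    then have "ttens [fmul (wd x) (Et \<Delta> S h), wd y] - ttens [wd x, fmul (wd y) (antiw T (Et \<Delta> S h))]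
        \<in> tgens sc \<Delta> S [RA]"
      unfolding tgens_def
      by (intro UnI2 CollectI exI[of _ "[wd x, wd y]"] exI[of _ 0] exI[of _ "wd x"] exI[of _ "wd y"]
          exI[of _ "Et \<Delta> S h"]) simp
    from bspec[OF vanishes this] show "SW h (\<lambda>a b. \<Phi> [x @ [S a, b], y]) = SW h (\<lambda>a b. \<Phi> [x, y @ [T b, a]])"
      by (simp add: lin_ext_Delta)
  qed
  from assms[OF this] show "lin_ext \<Phi> (X - Y) = 0"
    by simp
qed

lemma lin_ext_dword [simp]: "lin_ext \<Phi> (dword \<Delta> u) = SW_word u (\<lambda>x y. \<Phi> [x, y])"
proof (induction u arbitrary: \<Phi>)
  case (Cons h u)
  have "lin_ext \<Phi> (dword \<Delta> (h # u))
      = lin_ext (\<lambda>xs. lin_ext (\<lambda>ws. \<Phi> [xs!0 # ws!0, xs!1 # ws!1]) (dword \<Delta> u)) (\<Delta> h)"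
    unfolding dword.simps lin_ext_sum lin_ext_single
    by (simp add: lin_ext_def sum_distrib_left mult.assoc)
  then show ?case
    by (simp add: Cons lin_ext_Delta)
qed simp

lemma teq_coassoc:
  "teq sc \<Delta> S [i, j] (splice 0 (dword \<Delta>) (DeltaP \<Delta> h)) (splice 1 (dword \<Delta>) (DeltaP \<Delta> h))"
  unfolding teq_def
proof (rule lspan_separation)
  fix \<Phi> assume vanishes: "\<forall>g\<in>tgens sc \<Delta> S [i, j]. lin_ext \<Phi> g = 0"
  have "par_form (\<lambda>x. \<Phi> [x, y, z])" "par_form (\<lambda>y. \<Phi> [x, y, z])" "par_form (\<lambda>z. \<Phi> [x, y, z])" for x y z
    using tgens_par_form[OF vanishes, where ws = "[x, y, z]" and i = 0]
      tgens_par_form[OF vanishes, where ws = "[x, y, z]" and i = 1]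
      tgens_par_form[OF vanishes, where ws = "[x, y, z]" and i = 2] by simp_all
  from SW_word_coassoc[OF this[THEN par_form_multilinear]]
  show "lin_ext \<Phi> (splice 0 (dword \<Delta>) (DeltaP \<Delta> h) - splice 1 (dword \<Delta>) (DeltaP \<Delta> h)) = 0"
    by (simp del: dword.simps)
qed

end

context concrete_weak_hopf_algebra
begin

lemma lin_ext_epsl [simp]: "lin_ext \<phi> (epsl \<Delta> S w) = eps_l w \<phi>"
  by (induction w arbitrary: \<phi> rule: merge_letters_induct) (simp_all add: lin_ext_Delta)

lemma lin_ext_epsr_rev: "lin_ext \<phi> (epsr_rev \<Delta> S w) = opcop.eps_l w (\<lambda>w. \<phi> (rev w))"
proof (induction w arbitrary: \<phi> rule: merge_letters_induct)
  case (merge h g u)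
  have "lin_ext \<phi> (epsr_rev \<Delta> S (h # g # u))
      = SW h (\<lambda>a b. SW b (\<lambda>c d. lin_ext (\<lambda>u. \<phi> (u @ [S c, d])) (epsr_rev \<Delta> S ((g * a) # u))))"
    by (simp add: lin_ext_Delta SW_finitely_supported_swap[OF finitely_supported_lin_ext])
  then show ?case
    by (simp add: merge.IH(2))
qed (simp_all add: lin_ext_Delta)

lemma lin_ext_epsr [simp]: "lin_ext \<phi> (epsr_rev \<Delta> S (rev w)) = eps_r w \<phi>"
  by (simp add: lin_ext_epsr_rev eps_r_def)

lemma lin_ext_Apar: "a \<in> Apar \<Delta> S \<Longrightarrow> (\<lambda>\<phi>. lin_ext \<phi> a) \<in> A_ops"
  unfolding Apar_def A_ops_def
  by (erule lin_ext_subalg) (auto intro!: generated_algebra_generator simp: lin_ext_Delta)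

lemma lin_ext_Atpar: "b \<in> Atpar \<Delta> S \<Longrightarrow> (\<lambda>\<phi>. lin_ext \<phi> b) \<in> At_ops"
  unfolding Atpar_def At_ops_def
  by (erule lin_ext_subalg) (auto intro!: generated_algebra_generator simp: lin_ext_Delta)

lemma A_ops_Apar: "\<alpha> \<in> A_ops \<Longrightarrow> \<exists>a\<in>Apar \<Delta> S. \<alpha> = (\<lambda>\<phi>. lin_ext \<phi> a)"
  unfolding Apar_def A_ops_def by (erule generated_algebra_subalg) (auto simp: lin_ext_Delta)

lemma At_ops_Atpar: "\<beta> \<in> At_ops \<Longrightarrow> \<exists>b\<in>Atpar \<Delta> S. \<beta> = (\<lambda>\<phi>. lin_ext \<phi> b)"
  unfolding Atpar_def At_ops_def by (erule generated_algebra_subalg) (auto simp: lin_ext_Delta)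

lemma peq_refl [simp]: "x \<approx> x"
  by (rule peqI) simp

lemma teq_refl [simp]: "teq sc \<Delta> S bs X X"
  by (simp add: teq_def lspan_zero)

lemma teq_sym: "teq sc \<Delta> S bs X Y \<Longrightarrow> teq sc \<Delta> S bs Y X"
proof -
  assume "teq sc \<Delta> S bs X Y"
  then have "fsc (- 1) (X - Y) \<in> lspan (tgens sc \<Delta> S bs)"
    unfolding teq_def by (rule lspan_sc)
  moreover have "fsc (- 1) (X - Y) = Y - X"
    by (rule formal_sum_eqI) simp
  ultimately show ?thesis
    by (simp add: teq_def)
qed

lemma antiw_S_cong: "x \<approx> y \<Longrightarrow> antiw S x \<approx> antiw S y"
  and antiw_T_cong: "x \<approx> y \<Longrightarrow> antiw T x \<approx> antiw T y"
  by (rule peqI, simp add: peq_lin_ext par_form_antipode par_form_inverse_antipode)+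

lemma antiw_S_T: "antiw S (antiw T x) = x"
  and antiw_T_S: "antiw T (antiw S x) = x"
  by (rule formal_sum_eqI, simp add: rev_map comp_def)+

section \<open>The left bialgebroid\<close>

lemma Apar_t_commute:
  assumes "a \<in> Apar \<Delta> S" "b \<in> Apar \<Delta> S"
  shows "fmul a (antiw T b) \<approx> fmul (antiw T b) a"
  by (rule peqI) (simp add: A_ops_tA_commute[OF assms[THEN lin_ext_Apar]], rule lin_ext_swap)

lemma DeltaP_cong_LA: "x \<approx> y \<Longrightarrow> teq sc \<Delta> S [LA] (DeltaP \<Delta> x) (DeltaP \<Delta> y)"
  by (rule teq_LA_I) (simp add: peq_lin_ext par_form_Delta_l)

lemma DeltaP_bimodule_LA:
  assumes "a \<in> Apar \<Delta> S" "b \<in> Apar \<Delta> S"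
  shows "teq sc \<Delta> S [LA] (DeltaP \<Delta> (fmul (fmul a (antiw T b)) h)) (slotl 0 a (slotl 1 (antiw T b) (DeltaP \<Delta> h)))"
proof (rule teq_LA_I)
  fix \<Phi> assume F: "left_balanced (\<lambda>x y. \<Phi> [x, y])"
  have "lin_ext \<Phi> (DeltaP \<Delta> (fmul (fmul a (antiw T b)) h))
      = lin_ext (\<lambda>w. lin_ext (\<lambda>u. lin_ext (\<lambda>v. SW_word ((u @ \<S>' v) @ w) (\<lambda>x y. \<Phi> [x, y])) b) a) h"
    by (simp add: lin_ext_swap[of _ h b] lin_ext_swap[of _ h a])
  also have "\<dots> = lin_ext (\<lambda>w. lin_ext (\<lambda>u. lin_ext (\<lambda>v. SW_word w (\<lambda>r s. \<Phi> [u @ r, \<S>' v @ s])) b) a) h"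
    by (simp only: Delta_l_bimodule[OF assms[THEN lin_ext_Apar] F])
  also have "\<dots> = lin_ext \<Phi> (slotl 0 a (slotl 1 (antiw T b) (DeltaP \<Delta> h)))"
    by (simp add: SW_word_finitely_supported_swap[OF finitely_supported_lin_ext] lin_ext_swap[of _ b a])
  finally show "lin_ext \<Phi> (DeltaP \<Delta> (fmul (fmul a (antiw T b)) h))
      = lin_ext \<Phi> (slotl 0 a (slotl 1 (antiw T b) (DeltaP \<Delta> h)))" .
qed

lemma EpsL_cong: "x \<approx> y \<Longrightarrow> EpsL \<Delta> S x \<approx> EpsL \<Delta> S y"
  by (rule peqI) (simp add: peq_lin_ext par_form_eps_l)

lemma EpsL_in_Apar: "\<exists>a\<in>Apar \<Delta> S. EpsL \<Delta> S x \<approx> a"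
proof -
  have "(\<lambda>\<phi>. lin_ext (\<lambda>u. eps_l u \<phi>) x) \<in> A_ops"
    using eps_l_in_A unfolding A_ops_def by (intro generated_algebra_sum[OF finitely_supported_lin_ext])
  then obtain a where "a \<in> Apar \<Delta> S" "(\<lambda>\<phi>. lin_ext (\<lambda>u. eps_l u \<phi>) x) = (\<lambda>\<phi>. lin_ext \<phi> a)"
    using A_ops_Apar by blast
  then show ?thesis
    by (intro bexI peqI) (simp_all add: fun_eq_iff)
qed

lemma EpsL_bimodule:
  assumes "a \<in> Apar \<Delta> S" "b \<in> Apar \<Delta> S"
  shows "EpsL \<Delta> S (fmul (fmul a (antiw T b)) h) \<approx> fmul (fmul a (EpsL \<Delta> S h)) b"
proof (rule peqI)
  fix \<phi> assume \<phi>: "par_form \<phi>"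
  have "lin_ext \<phi> (EpsL \<Delta> S (fmul (fmul a (antiw T b)) h))
      = lin_ext (\<lambda>w. lin_ext (\<lambda>u. lin_ext (\<lambda>v. eps_l ((u @ \<S>' v) @ w) \<phi>) b) a) h"
    by (simp add: lin_ext_swap[of _ h b] lin_ext_swap[of _ h a])
  also have "\<dots> = lin_ext (\<lambda>w. lin_ext (\<lambda>u. eps_l w (\<lambda>z. lin_ext (\<lambda>v. \<phi> ((u @ z) @ v)) b)) a) h"
    by (simp only: eps_l_bimodule[OF assms[THEN lin_ext_Apar] \<phi>])
  also have "\<dots> = lin_ext \<phi> (fmul (fmul a (EpsL \<Delta> S h)) b)"
    by (simp add: lin_ext_swap[of _ a h])
  finally show "lin_ext \<phi> (EpsL \<Delta> S (fmul (fmul a (antiw T b)) h))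
      = lin_ext \<phi> (fmul (fmul a (EpsL \<Delta> S h)) b)" .
qed

lemma EpsL_counit: "tcontr (\<lambda>u v. fmul (EpsL \<Delta> S (wd u)) (wd v)) (DeltaP \<Delta> h) \<approx> h"
  by (rule peqI) (simp add: eps_l_counit)

lemma EpsL_counit_t: "tcontr (\<lambda>u v. fmul (antiw T (EpsL \<Delta> S (wd v))) (wd u)) (DeltaP \<Delta> h) \<approx> h"
  by (rule peqI) (simp add: eps_l_counit_t)

lemma Takeuchi_LA:
  assumes "a \<in> Apar \<Delta> S"
  shows "teq sc \<Delta> S [LA] (slotr 0 (antiw T a) (DeltaP \<Delta> h)) (slotr 1 a (DeltaP \<Delta> h))"
proof (rule teq_LA_I)
  fix \<Phi> assume "left_balanced (\<lambda>x y. \<Phi> [x, y])"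
  from Takeuchi_l[OF lin_ext_Apar[OF assms] this]
  show "lin_ext \<Phi> (slotr 0 (antiw T a) (DeltaP \<Delta> h)) = lin_ext \<Phi> (slotr 1 a (DeltaP \<Delta> h))"
    by (simp add: SW_word_finitely_supported_swap[OF finitely_supported_lin_ext])
qed

lemma DeltaP_fmul_LA: "teq sc \<Delta> S [LA] (DeltaP \<Delta> (fmul x y)) (tmul (@) (DeltaP \<Delta> x) (DeltaP \<Delta> y))"
  and DeltaP_fmul_RA: "teq sc \<Delta> S [RA] (DeltaP \<Delta> (fmul x y)) (tmul (@) (DeltaP \<Delta> x) (DeltaP \<Delta> y))"
  by (rule teq_LA_I teq_RA_I,
      simp add: SW_word_append SW_word_finitely_supported_swap[OF finitely_supported_lin_ext])+

lemma EpsL_fmul: "EpsL \<Delta> S (fmul x y) \<approx> EpsL \<Delta> S (fmul x (EpsL \<Delta> S y))"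
  and EpsL_fmul_t: "EpsL \<Delta> S (fmul x y) \<approx> EpsL \<Delta> S (fmul x (antiw T (EpsL \<Delta> S y)))"
  by (rule peqI, simp add: eps_l_mult(1)[symmetric], rule peqI, simp add: eps_l_mult(2)[symmetric])

lemma left_bialgebroid: "par_left_bialgebroid sc \<Delta> S"
  unfolding par_left_bialgebroid_def Let_def
  by (simp add: antiw_T_cong antiw_add antiw_fmul antiw_fsc antiw_fone Apar_t_commute
      DeltaP_cong_LA DeltaP_add DeltaP_fsc DeltaP_bimodule_LA teq_coassoc
      EpsL_cong EpsL_in_Apar EpsL_add EpsL_fsc EpsL_bimodule EpsL_counit EpsL_counit_t
      Takeuchi_LA DeltaP_fmul_LA DeltaP_fone EpsL_fmul EpsL_fmul_t
      del: One_nat_def)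

section \<open>The right bialgebroid\<close>

lemma Atpar_t_commute:
  assumes "a \<in> Atpar \<Delta> S" "b \<in> Atpar \<Delta> S"
  shows "fmul a (antiw T b) \<approx> fmul (antiw T b) a"
  by (rule peqI) (simp add: At_ops_tAt_commute[OF assms[THEN lin_ext_Atpar]], rule lin_ext_swap)

lemma DeltaP_cong_RA: "x \<approx> y \<Longrightarrow> teq sc \<Delta> S [RA] (DeltaP \<Delta> x) (DeltaP \<Delta> y)"
  by (rule teq_RA_I) (simp add: peq_lin_ext par_form_Delta_r)

lemma DeltaP_bimodule_RA:
  assumes "a \<in> Atpar \<Delta> S" "b \<in> Atpar \<Delta> S"
  shows "teq sc \<Delta> S [RA] (DeltaP \<Delta> (fmul h (fmul (antiw T a) b))) (slotr 0 (antiw T a) (slotr 1 b (DeltaP \<Delta> h)))"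
proof (rule teq_RA_I)
  fix \<Phi> assume F: "right_balanced (\<lambda>x y. \<Phi> [x, y])"
  have "lin_ext \<Phi> (DeltaP \<Delta> (fmul h (fmul (antiw T a) b)))
      = lin_ext (\<lambda>w. lin_ext (\<lambda>u. lin_ext (\<lambda>v. SW_word (w @ \<S>' v @ u) (\<lambda>x y. \<Phi> [x, y])) a) b) h"
    by (simp add: lin_ext_swap[of _ a b])
  also have "\<dots> = lin_ext (\<lambda>w. lin_ext (\<lambda>u. lin_ext (\<lambda>v. SW_word w (\<lambda>r s. \<Phi> [r @ \<S>' v, s @ u])) a) b) h"
    by (simp only: Delta_r_bimodule[OF assms(2,1)[THEN lin_ext_Atpar] F])
  also have "\<dots> = lin_ext \<Phi> (slotr 0 (antiw T a) (slotr 1 b (DeltaP \<Delta> h)))"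
    by (simp add: SW_word_finitely_supported_swap[OF finitely_supported_lin_ext])
  finally show "lin_ext \<Phi> (DeltaP \<Delta> (fmul h (fmul (antiw T a) b)))
      = lin_ext \<Phi> (slotr 0 (antiw T a) (slotr 1 b (DeltaP \<Delta> h)))" .
qed

lemma EpsR_cong: "x \<approx> y \<Longrightarrow> EpsR \<Delta> S x \<approx> EpsR \<Delta> S y"
  by (rule peqI) (simp add: peq_lin_ext par_form_eps_r)

lemma lin_ext_eps_r_in_At: "(\<lambda>\<phi>. lin_ext (\<lambda>w. eps_r w \<phi>) x) \<in> At_ops"
  using eps_r_in_At unfolding At_ops_def by (intro generated_algebra_sum[OF finitely_supported_lin_ext])

lemma EpsR_in_Atpar: "\<exists>b\<in>Atpar \<Delta> S. EpsR \<Delta> S x \<approx> b"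
proof -
  obtain b where "b \<in> Atpar \<Delta> S" "(\<lambda>\<phi>. lin_ext (\<lambda>w. eps_r w \<phi>) x) = (\<lambda>\<phi>. lin_ext \<phi> b)"
    using At_ops_Atpar[OF lin_ext_eps_r_in_At] by blast
  then show ?thesis
    by (intro bexI peqI) (simp_all add: fun_eq_iff)
qed

lemma EpsR_bimodule:
  assumes "a \<in> Atpar \<Delta> S" "b \<in> Atpar \<Delta> S"
  shows "EpsR \<Delta> S (fmul h (fmul (antiw T a) b)) \<approx> fmul (fmul a (EpsR \<Delta> S h)) b"
proof (rule peqI)
  fix \<phi> assume \<phi>: "par_form \<phi>"
  note swap = finitely_supported_swap[OF At_ops_finitely_supported[OF lin_ext_eps_r_in_At[of h]]
      finitely_supported_lin_ext]
  have "lin_ext \<phi> (EpsR \<Delta> S (fmul h (fmul (antiw T a) b)))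
      = lin_ext (\<lambda>w. lin_ext (\<lambda>u. lin_ext (\<lambda>v. eps_r (w @ \<S>' v @ u) \<phi>) a) b) h"
    by (simp add: lin_ext_swap[of _ a b])
  also have "\<dots> = lin_ext (\<lambda>w. lin_ext (\<lambda>u. eps_r w (\<lambda>z. lin_ext (\<lambda>v. \<phi> (v @ z @ u)) a)) b) h"
    by (simp only: eps_r_bimodule[OF assms(2,1)[THEN lin_ext_Atpar] \<phi>])
  also have "\<dots> = lin_ext (\<lambda>u. lin_ext (\<lambda>w. eps_r w (\<lambda>z. lin_ext (\<lambda>v. \<phi> (v @ z @ u)) a)) h) b"
    by (rule lin_ext_swap)
  also have "\<dots> = lin_ext (\<lambda>v. lin_ext (\<lambda>u. lin_ext (\<lambda>w. eps_r w (\<lambda>z. \<phi> (v @ z @ u))) h) b) a"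
    by (simp only: swap lin_ext_swap[of _ a b])
  also have "\<dots> = lin_ext \<phi> (fmul (fmul a (EpsR \<Delta> S h)) b)"
    by (simp add: swap)
  finally show "lin_ext \<phi> (EpsR \<Delta> S (fmul h (fmul (antiw T a) b)))
      = lin_ext \<phi> (fmul (fmul a (EpsR \<Delta> S h)) b)" .
qed

lemma EpsR_counit: "tcontr (\<lambda>u v. fmul (wd u) (EpsR \<Delta> S (wd v))) (DeltaP \<Delta> h) \<approx> h"
  by (rule peqI) (simp add: eps_r_counit)

lemma EpsR_counit_t: "tcontr (\<lambda>u v. fmul (wd v) (antiw T (EpsR \<Delta> S (wd u)))) (DeltaP \<Delta> h) \<approx> h"
  by (rule peqI) (simp add: eps_r_counit_t)

lemma Takeuchi_RA:
  assumes "a \<in> Atpar \<Delta> S"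
  shows "teq sc \<Delta> S [RA] (slotl 0 a (DeltaP \<Delta> h)) (slotl 1 (antiw T a) (DeltaP \<Delta> h))"
proof (rule teq_RA_I)
  fix \<Phi> assume "right_balanced (\<lambda>x y. \<Phi> [x, y])"
  from Takeuchi_r[OF lin_ext_Atpar[OF assms] this]
  show "lin_ext \<Phi> (slotl 0 a (DeltaP \<Delta> h)) = lin_ext \<Phi> (slotl 1 (antiw T a) (DeltaP \<Delta> h))"
    by (simp add: SW_word_finitely_supported_swap[OF finitely_supported_lin_ext])
qed

lemma EpsR_fmul: "EpsR \<Delta> S (fmul x y) \<approx> EpsR \<Delta> S (fmul (EpsR \<Delta> S x) y)"
  and EpsR_fmul_t: "EpsR \<Delta> S (fmul x y) \<approx> EpsR \<Delta> S (fmul (antiw T (EpsR \<Delta> S x)) y)"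
proof -
  note swap = finitely_supported_swap[OF eps_r_finitely_supported finitely_supported_lin_ext]
  show "EpsR \<Delta> S (fmul x y) \<approx> EpsR \<Delta> S (fmul (EpsR \<Delta> S x) y)"
    by (rule peqI) (simp add: eps_r_mult(1)[symmetric] swap)
  show "EpsR \<Delta> S (fmul x y) \<approx> EpsR \<Delta> S (fmul (antiw T (EpsR \<Delta> S x)) y)"
    by (rule peqI) (simp add: eps_r_mult(2)[symmetric] swap)
qed

lemma right_bialgebroid: "par_right_bialgebroid sc \<Delta> S"
  unfolding par_right_bialgebroid_def Let_def
  by (simp add: antiw_T_cong antiw_add antiw_fmul antiw_fsc antiw_fone Atpar_t_commute
      DeltaP_cong_RA DeltaP_add DeltaP_fsc DeltaP_bimodule_RA teq_coassoc
      EpsR_cong EpsR_in_Atpar EpsR_add EpsR_fsc EpsR_bimodule EpsR_counit EpsR_counit_t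
      Takeuchi_RA DeltaP_fmul_RA DeltaP_fone EpsR_fmul EpsR_fmul_t
      del: One_nat_def)

section \<open>The antipode\<close>

lemma antiw_T_eq_iff: "antiw T x \<approx> antiw T y \<longleftrightarrow> x \<approx> y"
  using antiw_T_cong[of x y] antiw_S_cong[of "antiw T x" "antiw T y"] by (auto simp: antiw_S_T)

lemma antiw_T_Apar:
  assumes "a \<in> Apar \<Delta> S"
  shows "\<exists>b\<in>Atpar \<Delta> S. antiw T a \<approx> b"
proof -
  obtain \<beta> where \<beta>: "\<beta> \<in> At_ops" "\<And>\<phi>. par_form \<phi> \<Longrightarrow> \<beta> \<phi> = lin_ext (\<lambda>w. \<phi> (\<S>' w)) a"
    using A_ops_inverse_antipode[OF lin_ext_Apar[OF assms]] by blast
  obtain b where b: "b \<in> Atpar \<Delta> S" "\<beta> = (\<lambda>\<phi>. lin_ext \<phi> b)"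
    using At_ops_Atpar[OF \<beta>(1)] by blast
  show ?thesis
    by (rule bexI[OF _ b(1)], rule peqI) (use \<beta>(2) in \<open>simp add: b(2)\<close>)
qed

lemma antiw_T_onto_Atpar:
  assumes "b \<in> Atpar \<Delta> S"
  shows "\<exists>a\<in>Apar \<Delta> S. antiw T a \<approx> b"
proof -
  obtain \<alpha> where \<alpha>: "\<alpha> \<in> A_ops" "\<And>\<phi>. par_form \<phi> \<Longrightarrow> \<alpha> \<phi> = lin_ext (\<lambda>w. \<phi> (\<S> w)) b"
    using At_ops_antipode[OF lin_ext_Atpar[OF assms]] by blast
  obtain a where a: "a \<in> Apar \<Delta> S" "\<alpha> = (\<lambda>\<phi>. lin_ext \<phi> a)"
    using A_ops_Apar[OF \<alpha>(1)] by blast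
  have "a \<approx> antiw S b"
    by (rule peqI) (use \<alpha>(2) in \<open>simp add: a(2)\<close>)
  from antiw_T_cong[OF this] a(1) show ?thesis
    by (auto simp: antiw_T_S)
qed

lemma base_algebras_anti_isomorphic:
  "\<exists>\<phi>. (\<forall>a\<in>Apar \<Delta> S. \<exists>b\<in>Atpar \<Delta> S. \<phi> a \<approx> b) \<and>
    (\<forall>a\<in>Apar \<Delta> S. \<forall>b\<in>Apar \<Delta> S. a \<approx> b \<longleftrightarrow> \<phi> a \<approx> \<phi> b) \<and>
    (\<forall>b\<in>Atpar \<Delta> S. \<exists>a\<in>Apar \<Delta> S. \<phi> a \<approx> b) \<and>
    (\<forall>a\<in>Apar \<Delta> S. \<forall>b\<in>Apar \<Delta> S. \<phi> (a + b) \<approx> \<phi> a + \<phi> b \<and> \<phi> (fmul a b) \<approx> fmul (\<phi> b) (\<phi> a)) \<and>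
    (\<forall>a\<in>Apar \<Delta> S. \<forall>c. \<phi> (fsc c a) \<approx> fsc c (\<phi> a)) \<and> \<phi> fone \<approx> fone"
  by (rule exI[of _ "antiw T"])
    (simp add: antiw_T_Apar antiw_T_onto_Atpar antiw_T_eq_iff antiw_add antiw_fmul antiw_fsc antiw_fone)

lemma EpsL_t_Atpar:
  assumes "b \<in> Atpar \<Delta> S"
  shows "EpsL \<Delta> S (antiw T b) \<approx> antiw T b" and "antiw T (EpsL \<Delta> S b) \<approx> b"
  by (rule peqI, simp add: eps_l_inverse_antipode_At[OF lin_ext_Atpar[OF assms]])+

lemma EpsR_t_Apar:
  assumes "a \<in> Apar \<Delta> S"
  shows "EpsR \<Delta> S (antiw T a) \<approx> antiw T a" and "antiw T (EpsR \<Delta> S a) \<approx> a"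
  by (rule peqI, simp add: eps_r_inverse_antipode_A[OF lin_ext_Apar[OF assms]])+

lemma antipode_EpsR: "tcontr (\<lambda>u v. fmul (antiw S (wd u)) (wd v)) (DeltaP \<Delta> h) \<approx> EpsR \<Delta> S h"
  by (rule peqI) (simp add: eps_r_eq)

lemma antipode_EpsL: "tcontr (\<lambda>u v. fmul (wd u) (antiw S (wd v))) (DeltaP \<Delta> h) \<approx> EpsL \<Delta> S h"
  by (rule peqI) (simp add: eps_l_eq)

lemma hopf_compat: "par_hopf_compat sc \<Delta> S"
  unfolding par_hopf_compat_def Let_def
  using base_algebras_anti_isomorphic
  by (simp add: antiw_S_cong antiw_T_cong antiw_add antiw_fmul antiw_fsc antiw_fone antiw_S_T fmul_assoc
      EpsL_t_Atpar EpsR_t_Apar teq_coassoc teq_coassoc[THEN teq_sym] antipode_EpsR antipode_EpsL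
      del: One_nat_def)

end

theorem theorem5p2:
  fixes sc :: "'k::field \<Rightarrow> 'h::ring_1 \<Rightarrow> 'h"
    and \<Delta> :: "'h \<Rightarrow> ('h list \<Rightarrow>\<^sub>0 'k)"
    and \<epsilon> :: "'h \<Rightarrow> 'k"
    and S :: "'h \<Rightarrow> 'h"
  assumes "weak_hopf sc \<Delta> \<epsilon> S"
    and "bij S"
  shows "par_left_bialgebroid sc \<Delta> S \<and> par_right_bialgebroid sc \<Delta> S \<and> par_hopf_compat sc \<Delta> S"
proof -
  interpret concrete_weak_hopf_algebra sc \<Delta> \<epsilon> S
    by (rule concrete_weak_hopf_algebra.intro) (fact assms)+
  show ?thesis
    by (intro conjI left_bialgebroid right_bialgebroid hopf_compat)
qed

end
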